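(* Let $X$ be a Banach space, let $A\colon [0,+\infty)\to B(X)$ be continuous, and suppose that the linear equation $v'=A(t)v$ admits a nonuniform $(\mu,\nu)$-dichotomy in $[0,+\infty)$ for some growth rates $\mu,\nu$, with projections $P(t)$ and constants $D\ge 1$, $a<0\le b$, $\varepsilon\ge 0$. Let $f\colon[0,+\infty)\times X\to X$ satisfy, for some $c>0$ and $q>0$ and all $t\ge 0$, $u,v\in X$, $$f(t,0)=0,\qquad \|f(t,u)-f(t,v)\|\le c\,\|u-v\|\,(\|u\|+\|v\|)^q .$$ Assume that $$\lim_{t\to+\infty}\mu(t)^{a-b}\nu(t)^{\varepsilon}=0\qquad\text{and}\qquad \int_0^{+\infty}\mu(r)^{aq}\nu(r)^{\varepsilon}\,dr \text{ is convergent.}$$ Define $\beta,\tilde\beta\colon[0,+\infty)\to[0,+\infty)$ by $$\beta(t)=\frac{\mu(t)^a}{\nu(t)^{\varepsilon(1+1/q)}\left(\int_t^{+\infty}\mu(r)^{aq}\nu(r)^{\varepsilon}\,dr\right)^{1/q}},\qquad \tilde\beta(t)=\beta(t)\,\nu(t)^{-\varepsilon},$$ and suppose that $t\mapsto\beta(t)$ and $t\mapsto\mu(t)^a\beta(t)^{-1}$ are decreasing. Then, for every $C>D$, choosing $\delta>0$ sufficiently small, there is a unique $\phi\in\mathcal X_{\delta,\beta}$ such that $$\Psi_\tau\left(\mathcal V_{\phi,\frac{\delta}{C},\tilde\beta}\right)\subset\mathcal V_{\phi,\delta,\beta}\quad\text{for every }\tau\ge 0 .$$ Furthermore, given $s\ge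 0$, we have $$\|\Psi_{t-s}(p_{s,\xi})-\Psi_{t-s}(p_{s,\bar\xi})\|\le 2C\left(\frac{\mu(t)}{\mu(s)}\right)^a\nu(s)^{\varepsilon}\,\|\xi-\bar\xi\|$$ for every $t\ge s$ and all $\xi,\bar\xi\in B_{s,\frac{\delta}{C},\tilde\beta}$, where $p_{s,\xi}=(s,\xi,\phi(s,\xi))$.
   Context: $B(X)$ is the space of bounded linear operators on $X$. All solutions of $v'=A(t)v$, $v(s)=v_s$ are assumed global, and $T(t,s)$ ($t,s\ge0$) denotes the associated (invertible) evolution operator, $v(t)=T(t,s)v_s$. A growth rate is an increasing function $\mu\colon[0,+\infty)\to[1,+\infty)$ with $\mu(0)=1$ and $\lim_{t\to+\infty}\mu(t)=+\infty$. The equation $v'=A(t)v$ admits a nonuniform $(\mu,\nu)$-dichotomy in $[0,+\infty)$ (with constants $D\ge1$, $a<0\le b$, $\varepsilon\ge0$) if there are projections $P(t)$, $t\ge 0$, with $P(t)T(t,s)=T(t,s)P(s)$ for all $t,s\ge 0$, and, for all $t\ge s\ge 0$, $$\|T(t,s)P(s)\|\le D\left(\tfrac{\mu(t)}{\mu(s)}\right)^a\nu(s)^\varepsilon,\qquad \|T(t,s)^{-1}Q(t)\|\le D\left(\tfrac{\mu(t)}{\mu(s)}\right)^{-b}\nu(t)^\varepsilon,$$ where $Q(t)=\mathrm{Id}-P(t)$. Put $E(t)=P(t)X$ and $F(t)=Q(t)X$; the spaces $E(t)\times F(t)$ and $E(t)\oplus F(t)=X$ are identified, $(\xi,\eta)$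 corresponding to $\xi+\eta$. It is understood that for each $(s,v_s)\in[0,+\infty)\times X$ the problem $v'=A(t)v+f(t,v)$, $v(s)=v_s$ has a unique (maximal forward) solution, written as $(x(t,s,v_s),y(t,s,v_s))\in E(t)\times F(t)$. The semiflow is $\Psi_\tau(s,v_s)=(s+\tau,\,x(s+\tau,s,v_s),\,y(s+\tau,s,v_s))$, $\tau\ge0$; the inclusion in the claim includes the fact that the solutions starting in the left-hand set are defined for all $\tau\ge 0$. Two images $\Psi_{t-s}(p_{s,\xi})$, $\Psi_{t-s}(p_{s,\bar\xi})$ have the same first coordinate $t$, and the norm of their difference is the norm in $X$ of the difference of the remaining components. For $\delta>0$ and a decreasing function $\beta\colon[0,+\infty)\to[0,+\infty)$: $B_{s,\delta,\beta}$ is the open ball of $E(s)$ centered at $0$ with radius $\delta\beta(s)$; $G_{\delta,\beta}=\bigcup_{s\ge 0}\{s\}\times B_{s,\delta,\beta}$; $\mathcal X_{\delta,\beta}$ is the space of functions $\phi\colon G_{\delta,\beta}\to X$ such that for all $(s,\xi),(s,\bar\xi)\in G_{\delta,\beta}$: $\phi(s,\xi)\in F(s)$, $\phi(s,0)=0$, and $\|\phi(s,\xi)-\phi(s,\bar\xi)\|\le\|\xi-\bar\xi\|$. For $\phi\in\mathcal X_{\delta,\beta}$, $\mathcal V_{\phi,\delta,\beta}=\{(s,\xi,\phi(s,\xi)):(s,\xi)\in G_{\delta,\beta}\}$ and $\mathcal V_{\phi,\frac{\delta}{C},\tilde\beta}=\{(s,\xi,\phi(s,\xi)):(s,\xi)\in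 G_{\frac{\delta}{C},\tilde\beta}\}$.
   Formalization: Uniqueness of φ is claimed only on the smaller domain G_{δ/C,β̃}: on all of G_{δ,β} it fails, since at s=0 values of φ outside the smaller ball are not constrained by the inclusion. Solutions are understood in integrated form, as f is not assumed continuous in t. *)

theory Defs
  imports "HOL-Analysis.Analysis"
begin

section \<open>Growth rates, evolution operators, dichotomies\<close>

text \<open>"Increasing" is read in the weak sense; the bound \<open>\<mu> t \<ge> 1\<close> for \<open>t \<ge> 0\<close> is then implied.\<close>

definition growth_rate :: "(real \<Rightarrow> real) \<Rightarrow> bool" where
  "growth_rate \<mu> \<longleftrightarrow> mono_on {0..} \<mu> \<and> \<mu> 0 = 1 \<and> filterlim \<mu> at_top at_top"

definition evolution_operator ::
  "(real \<Rightarrow> 'a::banach \<Rightarrow>\<^sub>L 'a) \<Rightarrow> (real \<Rightarrow> real \<Rightarrow> 'a \<Rightarrow>\<^sub>L 'a) \<Rightarrow> bool" where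
  "evolution_operator A T \<longleftrightarrow>
     (\<forall>s\<ge>0. \<forall>v. T s s v = v \<and>
        (\<forall>t\<ge>0. ((\<lambda>t. T t s v) has_vector_derivative A t (T t s v)) (at t within {0..})))"

definition compl_proj :: "('a::real_normed_vector \<Rightarrow>\<^sub>L 'a) \<Rightarrow> 'a \<Rightarrow>\<^sub>L 'a" where
  "compl_proj p = id_blinfun - p"

definition nonuniform_dichotomy ::
  "(real \<Rightarrow> real \<Rightarrow> 'a::banach \<Rightarrow>\<^sub>L 'a) \<Rightarrow> (real \<Rightarrow> real) \<Rightarrow> (real \<Rightarrow> real) \<Rightarrow>
   (real \<Rightarrow> 'a \<Rightarrow>\<^sub>L 'a) \<Rightarrow> real \<Rightarrow> real \<Rightarrow> real \<Rightarrow> real \<Rightarrow> bool" where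
  "nonuniform_dichotomy T \<mu> \<nu> P D a b \<epsilon> \<longleftrightarrow>
     D \<ge> 1 \<and> a < 0 \<and> 0 \<le> b \<and> \<epsilon> \<ge> 0 \<and>
     (\<forall>t\<ge>0. P t o\<^sub>L P t = P t) \<and>
     (\<forall>t\<ge>0. \<forall>s\<ge>0. P t o\<^sub>L T t s = T t s o\<^sub>L P s) \<and>
     (\<forall>s\<ge>0. \<forall>t\<ge>s.
        norm (T t s o\<^sub>L P s) \<le> D * (\<mu> t / \<mu> s) powr a * \<nu> s powr \<epsilon> \<and>
        onorm (\<lambda>x. inv (blinfun_apply (T t s)) (compl_proj (P t) x))
          \<le> D * (\<mu> t / \<mu> s) powr (- b) * \<nu> t powr \<epsilon>)"

section \<open>Solutions of the perturbed equation\<close>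

text \<open>
  The perturbation is not assumed to be continuous in time, so \<open>v' = g(t, v)\<close>, \<open>v(s) = v0\<close> is
  understood in integrated form (continuity of \<open>v\<close> on \<open>J\<close> is then automatic). For continuous
  \<open>g\<close> this is the classical notion; see lemma \<open>solves_iff_classical\<close> below.
\<close>

definition solves ::
  "(real \<Rightarrow> 'a::banach \<Rightarrow> 'a) \<Rightarrow> real \<Rightarrow> 'a \<Rightarrow> real set \<Rightarrow> (real \<Rightarrow> 'a) \<Rightarrow> bool" where
  "solves g s v0 J v \<longleftrightarrow>
     v s = v0 \<and> (\<forall>t\<in>J. ((\<lambda>r. g r (v r)) has_integral (v t - v0)) {s..t})"

definition fwd_ival :: "real \<Rightarrow> ereal \<Rightarrow> real set" where
  "fwd_ival s \<omega> = {t. s \<le> t \<and> ereal t < \<omega>}"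

text \<open>\<open>v\<close> on \<open>[s, \<omega>)\<close> (with \<open>\<omega> = \<infinity>\<close> allowed) is the unique maximal forward solution:
  every forward solution lives on a subinterval and coincides with \<open>v\<close> there.\<close>

definition maximal_solution ::
  "(real \<Rightarrow> 'a::banach \<Rightarrow> 'a) \<Rightarrow> real \<Rightarrow> 'a \<Rightarrow> ereal \<Rightarrow> (real \<Rightarrow> 'a) \<Rightarrow> bool" where
  "maximal_solution g s v0 \<omega> v \<longleftrightarrow>
     ereal s < \<omega> \<and> solves g s v0 (fwd_ival s \<omega>) v \<and>
     (\<forall>\<omega>' w. ereal s < \<omega>' \<and> solves g s v0 (fwd_ival s \<omega>') w \<longrightarrow>
        \<omega>' \<le> \<omega> \<and> (\<forall>t\<in>fwd_ival s \<omega>'. w t = v t))"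

definition sol_defined :: "(real \<Rightarrow> 'a::banach \<Rightarrow> 'a) \<Rightarrow> real \<Rightarrow> 'a \<Rightarrow> real \<Rightarrow> bool" where
  "sol_defined g s v0 t \<longleftrightarrow> (\<exists>\<omega> v. maximal_solution g s v0 \<omega> v \<and> t \<in> fwd_ival s \<omega>)"

definition sol :: "(real \<Rightarrow> 'a::banach \<Rightarrow> 'a) \<Rightarrow> real \<Rightarrow> 'a \<Rightarrow> real \<Rightarrow> 'a" where
  "sol g s v0 t = (THE x. \<exists>\<omega> v. maximal_solution g s v0 \<omega> v \<and> t \<in> fwd_ival s \<omega> \<and> x = v t)"

definition perturbed_rhs ::
  "(real \<Rightarrow> 'a::banach \<Rightarrow>\<^sub>L 'a) \<Rightarrow> (real \<Rightarrow> 'a \<Rightarrow> 'a) \<Rightarrow> real \<Rightarrow> 'a \<Rightarrow> 'a" where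
  "perturbed_rhs A f t v = A t v + f t v"

lemma solves_iff_classical:
  fixes g :: "real \<Rightarrow> 'a::banach \<Rightarrow> 'a"
  assumes cont: "continuous_on ({0..} \<times> UNIV) (\<lambda>(t, u). g t u)" and s: "0 \<le> s" "ereal s < \<omega>"
  shows "solves g s v0 (fwd_ival s \<omega>) v \<longleftrightarrow>
    v s = v0 \<and> (\<forall>t\<in>fwd_ival s \<omega>. (v has_vector_derivative g t (v t)) (at t within fwd_ival s \<omega>))"
proof (intro iffI conjI ballI)
  assume sv: "solves g s v0 (fwd_ival s \<omega>) v"
  then show v0: "v s = v0" by (simp add: solves_def)
  fix t assume t: "t \<in> fwd_ival s \<omega>"
  then obtain u where u: "t < u" "ereal u < \<omega>"
    using ereal_dense2[of "ereal t" \<omega>] by (auto simp: fwd_ival_def)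
  have st: "s \<le> t" using t by (simp add: fwd_ival_def)
  have int: "((\<lambda>r. g r (v r)) has_integral (v x - v0)) {s..x}" if "s \<le> x" "x \<le> u" for x
  proof -
    have "ereal x < \<omega>" using that u by (meson ereal_less_eq(3) le_less_trans)
    then show ?thesis using sv that by (auto simp: solves_def fwd_ival_def)
  qed
  have veq: "v x = v0 + integral {s..x} (\<lambda>r. g r (v r))" if "x \<in> {s..u}" for x
    using int[of x] that by (auto simp: integral_unique)
  have "(\<lambda>r. g r (v r)) integrable_on {s..u}" using int[of u] u st by (auto intro: has_integral_integrable)
  then have "continuous_on {s..u} (\<lambda>x. integral {s..x} (\<lambda>r. g r (v r)))"
    by (rule indefinite_integral_continuous_1)
  then have "continuous_on {s..u} (\<lambda>x. v0 + integral {s..x} (\<lambda>r. g r (v r)))"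
    by (intro continuous_intros)
  then have cv: "continuous_on {s..u} v"
    by (rule continuous_on_eq) (simp add: veq)
  have "continuous_on {s..u} (\<lambda>r. (\<lambda>(t, u). g t u) (r, v r))"
    by (rule continuous_on_compose2[OF cont]) (use cv s in \<open>auto intro!: continuous_intros\<close>)
  then have cg: "continuous_on {s..u} (\<lambda>r. g r (v r))" by simp
  have "((\<lambda>x. v0 + integral {s..x} (\<lambda>r. g r (v r))) has_vector_derivative 0 + g t (v t))
      (at t within {s..u})"
    by (intro has_vector_derivative_add has_vector_derivative_const
        integral_has_vector_derivative[OF cg]) (use st u in auto)
  then have "(v has_vector_derivative g t (v t)) (at t within {s..u})"
    using has_vector_derivative_transform[of t "{s..u}" v] st u by (auto simp: veq)
  moreover have "at t within {s..u} = at t within fwd_ival s \<omega>"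
  proof (rule at_within_nhd[of t "{..<u}"])
    show "{s..u} \<inter> {..<u} - {t} = fwd_ival s \<omega> \<inter> {..<u} - {t}"
      using u by (auto simp: fwd_ival_def) (meson ereal_less(2) ereal_less_eq(3) le_less_trans less_imp_le)
  qed (use u in auto)
  ultimately show "(v has_vector_derivative g t (v t)) (at t within fwd_ival s \<omega>)" by simp
next
  assume r: "v s = v0 \<and>
    (\<forall>t\<in>fwd_ival s \<omega>. (v has_vector_derivative g t (v t)) (at t within fwd_ival s \<omega>))"
  show "solves g s v0 (fwd_ival s \<omega>) v" unfolding solves_def
  proof (intro conjI ballI)
    show "v s = v0" using r by simp
    fix t assume t: "t \<in> fwd_ival s \<omega>"
    then have st: "s \<le> t" by (simp add: fwd_ival_def)
    have sub: "{s..t} \<subseteq> fwd_ival s \<omega>"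
      using t by (auto simp: fwd_ival_def) (meson ereal_less_eq(3) le_less_trans)
    have "((\<lambda>r. g r (v r)) has_integral (v t - v s)) {s..t}"
      by (rule fundamental_theorem_of_calculus[OF st])
         (use r sub in \<open>blast intro: has_vector_derivative_within_subset\<close>)
    then show "((\<lambda>r. g r (v r)) has_integral (v t - v0)) {s..t}" using r by simp
  qed
qed

section \<open>The semiflow and the function spaces\<close>

text \<open>Points are triples \<open>(s, \<xi>, \<eta>)\<close>, where \<open>(\<xi>, \<eta>) \<in> E(s) \<times> F(s)\<close> stands for \<open>\<xi> + \<eta> \<in> X\<close>.\<close>

definition Psi_defined ::
  "(real \<Rightarrow> 'a::banach \<Rightarrow>\<^sub>L 'a) \<Rightarrow> (real \<Rightarrow> 'a \<Rightarrow> 'a) \<Rightarrow> real \<Rightarrow> real \<times> 'a \<times> 'a \<Rightarrow> bool" where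
  "Psi_defined A f \<tau> p = (case p of (s, \<xi>, \<eta>) \<Rightarrow> sol_defined (perturbed_rhs A f) s (\<xi> + \<eta>) (s + \<tau>))"

definition Psi ::
  "(real \<Rightarrow> 'a::banach \<Rightarrow>\<^sub>L 'a) \<Rightarrow> (real \<Rightarrow> 'a \<Rightarrow> 'a) \<Rightarrow> (real \<Rightarrow> 'a \<Rightarrow>\<^sub>L 'a) \<Rightarrow>
   real \<Rightarrow> real \<times> 'a \<times> 'a \<Rightarrow> real \<times> 'a \<times> 'a" where
  "Psi A f P \<tau> p = (case p of (s, \<xi>, \<eta>) \<Rightarrow>
     let v = sol (perturbed_rhs A f) s (\<xi> + \<eta>) (s + \<tau>)
     in (s + \<tau>, P (s + \<tau>) v, compl_proj (P (s + \<tau>)) v))"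

definition X_dist :: "real \<times> 'a::real_normed_vector \<times> 'a \<Rightarrow> real \<times> 'a \<times> 'a \<Rightarrow> real" where
  "X_dist p p' = (case p of (t, x, y) \<Rightarrow> case p' of (t', x', y') \<Rightarrow> norm ((x + y) - (x' + y')))"

definition B_ball ::
  "(real \<Rightarrow> 'a::real_normed_vector \<Rightarrow>\<^sub>L 'a) \<Rightarrow> real \<Rightarrow> (real \<Rightarrow> real) \<Rightarrow> real \<Rightarrow> 'a set" where
  "B_ball P \<delta> \<beta> s = {\<xi> \<in> range (blinfun_apply (P s)). norm \<xi> < \<delta> * \<beta> s}"

definition G_dom ::
  "(real \<Rightarrow> 'a::real_normed_vector \<Rightarrow>\<^sub>L 'a) \<Rightarrow> real \<Rightarrow> (real \<Rightarrow> real) \<Rightarrow> (real \<times> 'a) set" where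
  "G_dom P \<delta> \<beta> = (SIGMA s:{0..}. B_ball P \<delta> \<beta> s)"

text \<open>Members are total functions; only their values on \<open>G_dom P \<delta> \<beta>\<close> are constrained.\<close>

definition X_space ::
  "(real \<Rightarrow> 'a::real_normed_vector \<Rightarrow>\<^sub>L 'a) \<Rightarrow> real \<Rightarrow> (real \<Rightarrow> real) \<Rightarrow> (real \<times> 'a \<Rightarrow> 'a) set" where
  "X_space P \<delta> \<beta> = {\<phi>. \<forall>s \<xi> \<xi>'. (s, \<xi>) \<in> G_dom P \<delta> \<beta> \<and> (s, \<xi>') \<in> G_dom P \<delta> \<beta> \<longrightarrow>
     \<phi> (s, \<xi>) \<in> range (blinfun_apply (compl_proj (P s))) \<and> \<phi> (s, 0) = 0 \<and>
     norm (\<phi> (s, \<xi>) - \<phi> (s, \<xi>')) \<le> norm (\<xi> - \<xi>')}"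

definition V_graph ::
  "(real \<Rightarrow> 'a::real_normed_vector \<Rightarrow>\<^sub>L 'a) \<Rightarrow> (real \<times> 'a \<Rightarrow> 'a) \<Rightarrow> real \<Rightarrow> (real \<Rightarrow> real) \<Rightarrow>
   (real \<times> 'a \<times> 'a) set" where
  "V_graph P \<phi> \<delta> \<beta> = (\<lambda>(s, \<xi>). (s, \<xi>, \<phi> (s, \<xi>))) ` G_dom P \<delta> \<beta>"

text \<open>
  This constrains \<open>\<phi>\<close> only on \<open>G_dom P (\<delta> / C) \<beta>'\<close> and along the forward orbits issuing from
  the graph over it. No such orbit meets, for instance, a point \<open>(0, \<xi>)\<close> of \<open>G_dom P \<delta> \<beta>\<close>
  outside \<open>G_dom P (\<delta> / C) \<beta>'\<close>. Hence an invariant \<open>\<phi>\<close> can be unique only as a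
  function on \<open>G_dom P (\<delta> / C) \<beta>'\<close>, i.e. through \<open>V_graph P \<phi> (\<delta> / C) \<beta>'\<close>.
\<close>

definition invariant_graph ::
  "(real \<Rightarrow> 'a::banach \<Rightarrow>\<^sub>L 'a) \<Rightarrow> (real \<Rightarrow> 'a \<Rightarrow> 'a) \<Rightarrow> (real \<Rightarrow> 'a \<Rightarrow>\<^sub>L 'a) \<Rightarrow>
   real \<Rightarrow> real \<Rightarrow> (real \<Rightarrow> real) \<Rightarrow> (real \<Rightarrow> real) \<Rightarrow> (real \<times> 'a \<Rightarrow> 'a) \<Rightarrow> bool" where
  "invariant_graph A f P C \<delta> \<beta> \<beta>' \<phi> \<longleftrightarrow>
     (\<forall>\<tau>\<ge>0. (\<forall>p\<in>V_graph P \<phi> (\<delta> / C) \<beta>'. Psi_defined A f \<tau> p) \<and>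
            Psi A f P \<tau> ` V_graph P \<phi> (\<delta> / C) \<beta>' \<subseteq> V_graph P \<phi> \<delta> \<beta>)"

definition beta ::
  "(real \<Rightarrow> real) \<Rightarrow> (real \<Rightarrow> real) \<Rightarrow> real \<Rightarrow> real \<Rightarrow> real \<Rightarrow> real \<Rightarrow> real" where
  "beta \<mu> \<nu> a \<epsilon> q t = \<mu> t powr a /
     (\<nu> t powr (\<epsilon> * (1 + 1 / q)) *
      (integral {t..} (\<lambda>r. \<mu> r powr (a * q) * \<nu> r powr \<epsilon>)) powr (1 / q))"

definition beta_tilde ::
  "(real \<Rightarrow> real) \<Rightarrow> (real \<Rightarrow> real) \<Rightarrow> real \<Rightarrow> real \<Rightarrow> real \<Rightarrow> real \<Rightarrow> real" where
  "beta_tilde \<mu> \<nu> a \<epsilon> q t = beta \<mu> \<nu> a \<epsilon> q t * \<nu> t powr (- \<epsilon>)"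

end

theory Submission imports Defs begin

text \<open>
  For \<open>\<xi>\<close> in the stable space at time \<open>s\<close>, the orbit through \<open>(s, \<xi>, \<phi> (s, \<xi>))\<close> is the fixed point
  of the Lyapunov--Perron operator
  \<open>u(t) = T(t,s) \<xi> + \<integral>\<^bsub>[s,t]\<^esub> T(t,r) P(r) f(r, u(r)) dr - \<integral>\<^bsub>[t,\<infinity>)\<^esub> T(t,r) Q(r) f(r, u(r)) dr\<close>
  among functions bounded by a multiple of \<open>\<delta> \<beta>(s) \<nu>(s)\<^sup>\<epsilon> (\<mu>(t) / \<mu>(s))\<^sup>a\<close>; the choice of \<open>\<beta>\<close> makes the
  contraction constant of order \<open>\<delta>\<^sup>q\<close>, uniformly in \<open>s\<close>. Put \<open>\<phi> (s, \<xi>) = Q(s) u(s)\<close>. Uniqueness of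
  fixed points yields invariance, because an orbit restricted to \<open>[t,\<infinity>)\<close> is again a fixed point.
  Conversely, on an orbit in the graph of some invariant \<open>\<psi>\<close> the stable component controls the
  whole solution, hence (bootstrap) it decays like \<open>\<mu>(t)\<^sup>a\<close>; the condition on
  \<open>\<mu>\<^sup>a\<^sup>-\<^sup>b \<nu>\<^sup>\<epsilon>\<close> then forces the solution to be a fixed point.

  As \<open>f\<close> need not be measurable in time, the integrability of \<open>r \<mapsto> f(r, u(r))\<close> for continuous \<open>u\<close>
  has to be extracted from the existence of solutions: the solution starting at \<open>(x, u(x))\<close> stays
  close to \<open>u\<close> just after time \<open>x\<close>, so \<open>f(r, u(r))\<close> is approximated, to the right of every point, by
  integrable functions.
\<close>

section \<open>Henstock--Kurzweil integrals of Banach-valued functions\<close>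

text \<open>The constants follow one bookkeeping. An orbit issuing from radius
  \<open>\<delta> * \<beta> s\<close> has size of order \<open>\<delta> * m s * w s t\<close>, where
  \<open>m s = \<beta> s * \<nu> s powr \<epsilon>\<close> already contains the factor lost in the
  dichotomy. The superlinearity of \<open>f\<close> puts the power \<open>q\<close> of this size in
  front of each integral, and integration against \<open>\<nu> r powr \<epsilon>\<close> leaves
  \<open>\<Theta> R * \<nu> s powr (- \<epsilon>)\<close>. The negative power pays for the
  \<open>\<nu> s powr \<epsilon>\<close> in the dependence of orbits on the initial point, which is
  why the graph has slope at most 1. A second loss remains: an orbit may first grow by
  \<open>C * \<nu> s powr \<epsilon>\<close>. The passage from \<open>\<beta>\<close> to
  \<open>beta_tilde\<close> and from \<open>\<delta>\<close> to \<open>\<delta> / C\<close>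
  compensates exactly this, and the monotonicity of \<open>\<mu> t powr a / \<beta> t\<close> then
  keeps the stable component in the balls at all later times. The monotonicity of
  \<open>\<beta>\<close> itself supplies the a priori bound on the orbits of a competing invariant
  graph.\<close>

lemma integrable_real_subinterval:
  fixes g :: "real \<Rightarrow> 'a::banach"
  assumes "g integrable_on {a..b}" "a \<le> c" "d \<le> b"
  shows "g integrable_on {c..d}"
  using assms by (intro integrable_on_subinterval[OF assms(1)]) auto

lemma norm_integral_le_real:
  fixes g :: "real \<Rightarrow> 'a::banach"
  assumes "g integrable_on {a..b}" "a \<le> b" "\<And>x. x \<in> {a..b} \<Longrightarrow> norm (g x) \<le> K"
  shows "norm (integral {a..b} g) \<le> K * (b - a)"
proof -
  have "norm (integral {a..b} g) \<le> integral {a..b} (\<lambda>x. K)"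
    by (rule integral_norm_bound_integral) (use assms in auto)
  then show ?thesis using assms(2) by (simp add: mult.commute)
qed

text \<open>Hake's theorem for a bounded integrand. Such a function need not be strongly measurable, so there
  is no dominated convergence theorem to appeal to: on an exhausting sequence of intervals the Henstock
  lemma gives gauges with summable errors, which are glued along the tags.\<close>

lemma integrable_bounded_right_open:
  fixes g :: "real \<Rightarrow> 'a::banach"
  assumes sw: "s < \<omega>"
    and int: "\<And>x. s \<le> x \<Longrightarrow> x < \<omega> \<Longrightarrow> g integrable_on {s..x}"
    and bd: "\<And>x. x \<in> {s..\<omega>} \<Longrightarrow> norm (g x) \<le> K"
  shows "g integrable_on {s..\<omega>}"
proof -
  have K0: "K \<ge> 0" using bd[of s] sw norm_ge_zero[of "g s"] by (simp del: norm_ge_zero)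
  define F where "F x = integral {s..x} g" for x
  define y where "y n = \<omega> - (\<omega> - s) / real (n + 1)" for n :: nat
  have F_sub: "integral {c..d} g = F d - F c" if "s \<le> c" "c \<le> d" "d < \<omega>" for c d
    using Henstock_Kurzweil_Integration.integral_combine[where a=s and c=c and b=d and f=g] int[of d] that unfolding F_def by (simp add: algebra_simps)
  have F_lip: "norm (F d - F c) \<le> K * (d - c)" if "s \<le> c" "c \<le> d" "d < \<omega>" for c d
    unfolding F_sub[OF that, symmetric]
    by (rule norm_integral_le_real) (use that bd int[of d] in \<open>auto intro: integrable_real_subinterval\<close>)
  have y_s: "s \<le> y n" and y_w: "y n < \<omega>" for n
  proof -
    have "(\<omega> - s) / real (n + 1) \<le> (\<omega> - s) / 1" using sw by (intro divide_left_mono) auto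
    then show "s \<le> y n" by (simp add: y_def)
    show "y n < \<omega>" using sw by (simp add: y_def)
  qed
  have y_lim: "y \<longlonglongrightarrow> \<omega>"
  proof -
    have "(\<lambda>n. (\<omega> - s) * (1 / real (Suc n))) \<longlonglongrightarrow> (\<omega> - s) * 0"
      by (intro tendsto_mult tendsto_const) (rule LIMSEQ_Suc[OF lim_1_over_n])
    then have "(\<lambda>n. \<omega> - (\<omega> - s) * (1 / real (Suc n))) \<longlonglongrightarrow> \<omega> - 0"
      by (intro tendsto_diff tendsto_const) simp
    then show ?thesis by (simp add: y_def[abs_def])
  qed
  have "Cauchy (\<lambda>n. F (y n))"
  proof (rule metric_CauchyI)
    fix e :: real assume "e > 0"
    then have "e / (K + 1) > 0" using K0 by simp
    then obtain M where M: "\<And>m n. m \<ge> M \<Longrightarrow> n \<ge> M \<Longrightarrow> dist (y m) (y n) < e / (K + 1)"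
      using LIMSEQ_imp_Cauchy[OF y_lim] unfolding Cauchy_def by blast
    have "dist (F (y m)) (F (y n)) < e" if "m \<ge> M" "n \<ge> M" for m n
    proof -
      have "dist (F (y m)) (F (y n)) \<le> K * dist (y m) (y n)"
        using F_lip[of "y m" "y n"] F_lip[of "y n" "y m"] y_s y_w
        by (cases "y m \<le> y n") (auto simp: dist_norm norm_minus_commute)
      also have "\<dots> \<le> (K + 1) * dist (y m) (y n)" by (simp add: mult_right_mono)
      also have "\<dots> < e" using M[OF that] K0 by (simp add: field_simps)
      finally show ?thesis .
    qed
    then show "\<exists>M. \<forall>m\<ge>M. \<forall>n\<ge>M. dist (F (y m)) (F (y n)) < e" by blast
  qed
  then obtain L where L: "(\<lambda>n. F (y n)) \<longlonglongrightarrow> L"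
    using Cauchy_convergent convergent_def by blast
  define G where "G x = (if x < \<omega> then F x else L)" for x
  have L_lip: "norm (L - F c) \<le> K * (\<omega> - c)" if "s \<le> c" "c < \<omega>" for c
  proof (rule tendsto_le[OF sequentially_bot])
    show "(\<lambda>n. K * (y n - c)) \<longlonglongrightarrow> K * (\<omega> - c)" by (intro tendsto_intros y_lim)
    show "(\<lambda>n. norm (F (y n) - F c)) \<longlonglongrightarrow> norm (L - F c)" by (intro tendsto_intros L)
    have "\<forall>\<^sub>F n in sequentially. y n > c" using order_tendstoD(1)[OF y_lim that(2)] .
    then show "\<forall>\<^sub>F n in sequentially. norm (F (y n) - F c) \<le> K * (y n - c)"
      by eventually_elim (use F_lip that y_w in auto)
  qed
  have G_lip: "norm (G d - G c) \<le> K * (d - c)" if "s \<le> c" "c \<le> d" "d \<le> \<omega>" for c d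
    using F_lip[of c d] L_lip[of c] that by (auto simp: G_def)
  have "(g has_integral L) {s..\<omega>}"
    unfolding has_integral_real
  proof (intro allI impI)
    fix e :: real assume e: "e > 0"
    \<comment> \<open>The errors \<open>en n\<close> add up to \<open>e / 4\<close>; another
      \<open>e / 4\<close> is reserved for the cells tagged at \<open>\<omega>\<close>, whence the
      choice of \<open>\<eta>\<close> below.\<close>
    define en where "en n = e / 4 * (1/2)^(n+1)" for n :: nat
    have en: "en n > 0" for n using e by (simp add: en_def)
    have "\<exists>\<gamma>. gauge \<gamma> \<and> (\<forall>\<D>. \<D> tagged_division_of {s..y n} \<and> \<gamma> fine \<D> \<longrightarrow>
        norm (sum (\<lambda>(x,k). measure lborel k *\<^sub>R g x) \<D> - integral {s..y n} g) < en n)" for n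
      using has_integral_real[THEN iffD1, rule_format, OF integrable_integral[OF int[OF y_s y_w]] en[of n]]
      by simp
    then obtain \<gamma> where \<gamma>: "\<And>n. gauge (\<gamma> n)"
      "\<And>n \<D>. \<D> tagged_division_of {s..y n} \<Longrightarrow> \<gamma> n fine \<D> \<Longrightarrow>
        norm (sum (\<lambda>(x,k). measure lborel k *\<^sub>R g x) \<D> - integral {s..y n} g) < en n"
      by metis
    define N where "N x = (LEAST n. x < y n)" for x
    have N: "x < y (N x)" if "x < \<omega>" for x
    proof -
      have "\<forall>\<^sub>F n in sequentially. x < y n" using order_tendstoD(1)[OF y_lim that] .
      then have "\<exists>n. x < y n" using eventually_happens sequentially_bot by blast
      then show ?thesis unfolding N_def by (rule LeastI_ex)
    qed
    define \<eta> where "\<eta> = e / (4 * (2 * K + 1))"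
    have \<eta>: "\<eta> > 0" using e K0 by (simp add: \<eta>_def)
    \<comment> \<open>Cutting \<open>\<Gamma> x\<close> at \<open>y (N x)\<close> forces every cell
      tagged at \<open>x < \<omega>\<close> to lie below \<open>y (N x)\<close>, where
      \<open>\<gamma> (N x)\<close> controls the Riemann sums. A cell tagged at
      \<open>\<omega>\<close> is only required to be short.\<close>
    define \<Gamma> where "\<Gamma> x = (if x < \<omega> then \<gamma> (N x) x \<inter> {..<y (N x)} else ball x \<eta>)" for x
    have gauge: "gauge \<Gamma>"
    proof (rule gaugeI)
      fix x
      show "x \<in> \<Gamma> x" using \<gamma>(1) N \<eta> by (auto simp: \<Gamma>_def gauge_def)
      show "open (\<Gamma> x)" using \<gamma>(1) by (auto simp: \<Gamma>_def gauge_def)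
    qed
    show "\<exists>\<gamma>. gauge \<gamma> \<and> (\<forall>\<D>. \<D> tagged_division_of {s..\<omega>} \<and> \<gamma> fine \<D> \<longrightarrow>
        norm ((\<Sum>(x,k)\<in>\<D>. measure lborel k *\<^sub>R g x) - L) < e)"
    proof (rule exI[of _ \<Gamma>], rule conjI[OF gauge], intro allI impI, elim conjE)
      fix p assume p: "p tagged_division_of {s..\<omega>}" and fine: "\<Gamma> fine p"
      have fin: "finite p" using p by auto
      have cell: "\<exists>c d. k = {c..d} \<and> c \<le> d \<and> s \<le> c \<and> d \<le> \<omega> \<and> c \<le> x \<and> x \<le> d" if xk: "(x, k) \<in> p" for x k
      proof -
        obtain c d where "k = cbox c d" using tagged_division_ofD(4)[OF p xk] by auto
        moreover have "x \<in> k" "k \<subseteq> {s..\<omega>}" using tagged_division_ofD(2,3)[OF p xk] by auto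
        ultimately show ?thesis by (intro exI[of _ c] exI[of _ d]) auto
      qed
      \<comment> \<open>The increments of \<open>G\<close> telescope to \<open>L\<close>, so
        subtracting them cell by cell turns the total error into a sum of local ones.\<close>
      define \<Delta> where "\<Delta> = (\<lambda>(x, k). measure lborel k *\<^sub>R g x - (G (Sup k) - G (Inf k)))"
      have sumG: "(\<Sum>(x,k)\<in>p. G (Sup k) - G (Inf k)) = L"
        using additive_tagged_division_1[OF less_imp_le[OF sw] p, of G] sw by (simp add: G_def F_def)
      have tot: "(\<Sum>(x,k)\<in>p. measure lborel k *\<^sub>R g x) - L = sum \<Delta> p"
        unfolding sumG[symmetric] sum_subtractf[symmetric] \<Delta>_def by (rule sum.cong) auto
      define p1 where "p1 = {z\<in>p. fst z < \<omega>}"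
      define p2 where "p2 = {z\<in>p. \<not> fst z < \<omega>}"
      have p12: "p = p1 \<union> p2" "p1 \<inter> p2 = {}" by (auto simp: p1_def p2_def)
      have fin1: "finite p1" and fin2: "finite p2" using fin by (auto simp: p1_def p2_def)
      have "sum \<Delta> p1 = (\<Sum>n\<in>(N \<circ> fst) ` p1. \<Sum>z\<in>{z\<in>p1. (N \<circ> fst) z = n}. \<Delta> z)"
        by (rule sum.image_gen[OF fin1])
      also have "norm \<dots> \<le> (\<Sum>n\<in>(N \<circ> fst) ` p1. en n)"
      proof (rule sum_norm_le)
        fix n assume "n \<in> (N \<circ> fst) ` p1"
        define r where "r = {z\<in>p1. (N \<circ> fst) z = n}"
        have in_n: "k \<subseteq> \<gamma> n x" "k \<subseteq> {..<y n}" if "(x, k) \<in> r" for x k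
          using fineD[OF fine, of x k] that by (auto simp: r_def p1_def \<Gamma>_def)
        have part: "r tagged_partial_division_of cbox s (y n)"
          unfolding tagged_partial_division_of_def
        proof (intro conjI allI impI)
          show "finite r" using fin1 by (simp add: r_def)
          fix x k assume xk: "(x, k) \<in> r"
          then have xkp: "(x, k) \<in> p" by (auto simp: r_def p1_def)
          show "x \<in> k" using tagged_division_ofD(2)[OF p xkp] .
          show "k \<subseteq> cbox s (y n)" using tagged_division_ofD(3)[OF p xkp] in_n[OF xk] by force
          show "\<exists>a b. k = cbox a b" using tagged_division_ofD(4)[OF p xkp] .
        next
          fix x1 k1 x2 k2 assume "(x1, k1) \<in> r \<and> (x2, k2) \<in> r \<and> (x1, k1) \<noteq> (x2, k2)"
          then show "interior k1 \<inter> interior k2 = {}"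
            using tagged_division_ofD(5)[OF p, of x1 k1 x2 k2] by (auto simp: r_def p1_def)
        qed
        have fine_r: "\<gamma> n fine r" using in_n by (auto simp: fine_def)
        have "norm (\<Sum>(x,k)\<in>r. measure lborel k *\<^sub>R g x - integral k g) \<le> en n"
          by (rule Henstock_lemma_part1[OF _ en \<gamma>(1)[of n] _ part fine_r])
             (use int[OF y_s y_w] \<gamma>(2)[of _ n] in \<open>auto simp: box_real\<close>)
        also have "(\<Sum>(x,k)\<in>r. measure lborel k *\<^sub>R g x - integral k g) = sum \<Delta> r"
        proof (rule sum.cong[OF refl], clarify)
          fix x k assume xk: "(x, k) \<in> r"
          then obtain c d where cd: "k = {c..d}" "c \<le> d" "s \<le> c" "c \<le> x" "x \<le> d"
            using cell[of x k] by (auto simp: r_def p1_def)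
          then have "d < \<omega>" using in_n(2)[OF xk] y_w[of n] by force
          then show "measure lborel k *\<^sub>R g x - integral k g = \<Delta> (x, k)"
            using cd F_sub[of c d] by (simp add: \<Delta>_def G_def)
        qed
        finally show "norm (\<Sum>z\<in>{z\<in>p1. (N \<circ> fst) z = n}. \<Delta> z) \<le> en n" by (simp add: r_def)
      qed
      also have "\<dots> \<le> (\<Sum>n. en n)"
      proof (rule sum_le_suminf)
        have "summable (\<lambda>n. (e / 8) * (1/2::real)^n)" by (intro summable_mult summable_geometric) simp
        then show "summable en" by (simp add: en_def[abs_def])
      qed (use fin1 en in \<open>auto intro: less_imp_le\<close>)
      also have "(\<Sum>n. en n) = e / 4"
      proof -
        have "(\<Sum>n. en n) = (\<Sum>n. (e / 8) * (1/2)^n)" by (simp add: en_def[abs_def])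
        also have "\<dots> = (e / 8) * (\<Sum>n. (1/2)^n)" by (rule suminf_mult) (simp add: summable_geometric)
        also have "\<dots> = e / 4" by (simp add: suminf_geometric)
        finally show ?thesis .
      qed
      finally have n1: "norm (sum \<Delta> p1) \<le> e / 4" .
      \<comment> \<open>The cells tagged at \<open>\<omega>\<close> are not counted: their lengths
        are read off from the clamp \<open>cl\<close>, whose increments over the entire division
        telescope to at most \<open>\<eta>\<close>.\<close>
      define cl where "cl x = max x (\<omega> - \<eta>)" for x :: real
      have "norm (sum \<Delta> p2) \<le> (\<Sum>(x,k)\<in>p2. 2 * K * (cl (Sup k) - cl (Inf k)))"
      proof (rule sum_norm_le, clarify)
        fix x k assume xk: "(x, k) \<in> p2"
        then have xkp: "(x, k) \<in> p" "\<not> x < \<omega>" by (auto simp: p2_def)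
        obtain c d where cd: "k = {c..d}" "c \<le> d" "s \<le> c" "d \<le> \<omega>" "c \<le> x" "x \<le> d"
          using cell[OF xkp(1)] by auto
        have [simp]: "x = \<omega>" "d = \<omega>" using cd xkp by auto
        have "k \<subseteq> ball \<omega> \<eta>" using fineD[OF fine xkp(1)] by (simp add: \<Gamma>_def)
        then have "c \<in> ball \<omega> \<eta>" using cd by auto
        then have c: "c > \<omega> - \<eta>" by (auto simp: dist_real_def)
        have "norm (\<Delta> (x, k)) \<le> norm (measure lborel k *\<^sub>R g x) + norm (G (Sup k) - G (Inf k))"
          using norm_triangle_ineq4[of "measure lborel k *\<^sub>R g x" "G (Sup k) - G (Inf k)"]
          by (simp add: \<Delta>_def)
        also have "\<dots> \<le> (\<omega> - c) * K + K * (\<omega> - c)"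
          using bd[of \<omega>] G_lip[of c \<omega>] cd sw by (intro add_mono) (auto intro: mult_left_mono)
        also have "\<dots> = 2 * K * (cl (Sup k) - cl (Inf k))"
          using cd c \<eta> by (simp add: cl_def)
        finally show "norm (\<Delta> (x, k)) \<le> 2 * K * (cl (Sup k) - cl (Inf k))" .
      qed
      also have "\<dots> \<le> (\<Sum>(x,k)\<in>p. 2 * K * (cl (Sup k) - cl (Inf k)))"
      proof (rule sum_mono2[OF fin])
        show "p2 \<subseteq> p" using p12 by auto
        fix z assume z: "z \<in> p - p2"
        obtain x k where [simp]: "z = (x, k)" by (cases z)
        obtain c d where "k = {c..d}" "c \<le> d" using cell[of x k] z by auto
        then show "0 \<le> (case z of (x, k) \<Rightarrow> 2 * K * (cl (Sup k) - cl (Inf k)))"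
          using K0 by (auto simp: cl_def)
      qed
      also have "\<dots> = 2 * K * (\<Sum>(x,k)\<in>p. cl (Sup k) - cl (Inf k))"
        by (simp add: sum_distrib_left case_prod_unfold)
      also have "(\<Sum>(x,k)\<in>p. cl (Sup k) - cl (Inf k)) = cl \<omega> - cl s"
        by (rule additive_tagged_division_1[OF less_imp_le[OF sw] p])
      also have "2 * K * (cl \<omega> - cl s) \<le> 2 * K * \<eta>"
        using K0 \<eta> by (intro mult_left_mono) (auto simp: cl_def)
      also have "\<dots> \<le> e / 4" using e K0 by (simp add: \<eta>_def divide_simps)
      finally have n2: "norm (sum \<Delta> p2) \<le> e / 4" .
      have "norm (sum \<Delta> p) \<le> norm (sum \<Delta> p1) + norm (sum \<Delta> p2)"
        unfolding p12(1) sum.union_disjoint[OF fin1 fin2 p12(2)] by (rule norm_triangle_ineq)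
      then show "norm ((\<Sum>(x,k)\<in>p. measure lborel k *\<^sub>R g x) - L) < e"
        unfolding tot using n1 n2 e by linarith
    qed
  qed
  then show ?thesis by auto
qed

text \<open>One-sided approximation is all that is available later, as solutions are only known to exist
  forward in time.\<close>

lemma integrable_of_local_right_approximations:
  fixes h :: "real \<Rightarrow> 'a::banach"
  assumes st: "s \<le> t"
    and bd: "\<And>x. x \<in> {s..t} \<Longrightarrow> norm (h x) \<le> K"
    and approx: "\<And>e x. e > 0 \<Longrightarrow> x \<in> {s..<t} \<Longrightarrow>
      \<exists>d>0. \<exists>g. g integrable_on {x..x+d} \<and> (\<forall>r\<in>{x..x+d}. norm (h r - g r) \<le> e)"
  shows "h integrable_on {s..t}"
proof -
  have "h integrable_on cbox s t"
  proof (rule integrable_uniform_limit)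
    fix e :: real assume e: "e > 0"
    \<comment> \<open>A supremum argument at fixed tolerance \<open>e\<close>: \<open>Ap\<close>
      restricts, concatenates and passes to left limits, and \<open>approx\<close> pushes it past
      any point reached. Integrability of \<open>h\<close> then follows by uniform
      approximation.\<close>
    define Ap where "Ap x y \<longleftrightarrow> (\<exists>g. g integrable_on {x..y} \<and> (\<forall>r\<in>{x..y}. norm (h r - g r) \<le> e))" for x y
    have Ap_sub: "Ap x' y'" if "Ap x y" "x \<le> x'" "y' \<le> y" for x y x' y'
      using that unfolding Ap_def by (force intro: integrable_real_subinterval)
    have Ap_refl: "Ap x x" for x
      unfolding Ap_def by (intro exI[of _ h]) (use e integrable_on_refl[of h x] in auto)
    have Ap_trans: "Ap x z" if xyz: "Ap x y" "Ap y z" "x \<le> y" "y \<le> z" for x y z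
    proof -
      obtain g1 where g1: "g1 integrable_on {x..y}" "\<forall>r\<in>{x..y}. norm (h r - g1 r) \<le> e"
        using xyz(1) unfolding Ap_def by blast
      obtain g2 where g2: "g2 integrable_on {y..z}" "\<forall>r\<in>{y..z}. norm (h r - g2 r) \<le> e"
        using xyz(2) unfolding Ap_def by blast
      define g where "g r = (if r \<le> y then g1 r else g2 r)" for r
      have "g integrable_on {x..y}" using g1(1) by (rule integrable_eq) (auto simp: g_def)
      moreover have "g integrable_on {y..z}"
        by (rule integrable_spike_finite[of "{y}" _ _ g2]) (use g2(1) in \<open>auto simp: g_def\<close>)
      ultimately have "g integrable_on {x..z}"
        using Henstock_Kurzweil_Integration.integrable_combine[where a=x and c=y and b=z and f=g] xyz by simp
      then show ?thesis unfolding Ap_def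
        by (intro exI[of _ g]) (use g1(2) g2(2) in \<open>auto simp: g_def\<close>)
    qed
    \<comment> \<open>The approximants on different \<open>{s..y}\<close> need not be compatible.
      One is picked on each of the consecutive intervals \<open>{y n..y (Suc n)}\<close>; the glued
      function is integrable below \<open>\<omega>\<close> and bounded by \<open>K + e\<close>, so
      Hake's theorem carries it up to \<open>\<omega>\<close>.\<close>
    have Ap_limit: "Ap s \<omega>" if sw: "s < \<omega>" "\<omega> \<le> t" and all: "\<And>y. s \<le> y \<Longrightarrow> y < \<omega> \<Longrightarrow> Ap s y" for \<omega>
    proof -
      define y where "y n = \<omega> - (\<omega> - s) / real (n + 1)" for n :: nat
      have y_mono: "y m \<le> y n" if "m \<le> n" for m n
        using that sw by (auto simp: y_def intro!: divide_left_mono)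
      have y0: "y 0 = s" by (simp add: y_def)
      have y_s: "s \<le> y n" for n using y_mono[of 0 n] y0 by simp
      have y_w: "y n < \<omega>" for n using sw by (simp add: y_def)
      have y_lim: "\<exists>n. x < y n" if "x < \<omega>" for x
      proof -
        obtain n where "(\<omega> - s) / (\<omega> - x) < real n" using reals_Archimedean2 by blast
        then have "\<omega> - s < real n * (\<omega> - x)" using that by (simp add: pos_divide_less_eq)
        also have "\<dots> \<le> real (n + 1) * (\<omega> - x)" using that by (intro mult_right_mono) auto
        finally have "(\<omega> - s) / real (n + 1) < \<omega> - x" by (simp add: pos_divide_less_eq mult.commute)
        then show ?thesis by (intro exI[of _ n]) (simp add: y_def)
      qed
      have "Ap (y n) (y (Suc n))" for n
        by (rule Ap_sub[OF all[OF y_s y_w, of "Suc n"]]) (use y_s in auto)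
      then obtain G where G: "\<And>n. G n integrable_on {y n..y (Suc n)}"
        "\<And>n r. r \<in> {y n..y (Suc n)} \<Longrightarrow> norm (h r - G n r) \<le> e"
        unfolding Ap_def by metis
      define N where "N r = (LEAST n. r < y (Suc n))" for r
      have N_eq: "N r = n" if "y n \<le> r" "r < y (Suc n)" for r n
        unfolding N_def
      proof (rule Least_equality)
        show "r < y (Suc n)" by fact
        fix m assume "r < y (Suc m)"
        show "n \<le> m"
        proof (rule ccontr)
          assume "\<not> n \<le> m"
          then have "y (Suc m) \<le> y n" by (intro y_mono) auto
          then show False using \<open>r < y (Suc m)\<close> that by linarith
        qed
      qed
      have N_in: "r \<in> {y (N r)..y (Suc (N r))}" if r: "s \<le> r" "r < \<omega>" for r
      proof -
        have "\<exists>n. r < y (Suc n)"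
        proof -
          obtain n where "r < y n" using y_lim[OF r(2)] by blast
          then show ?thesis using y_mono[of n "Suc n"] by (intro exI[of _ n]) auto
        qed
        then have 1: "r < y (Suc (N r))" unfolding N_def by (rule LeastI_ex)
        have "y (N r) \<le> r"
        proof (cases "N r")
          case 0
          then show ?thesis using y0 r by simp
        next
          case (Suc m)
          then have "\<not> r < y (Suc m)" using not_less_Least[of m "\<lambda>n. r < y (Suc n)"] by (simp add: N_def)
          then show ?thesis using Suc by simp
        qed
        then show ?thesis using 1 by simp
      qed
      define g where "g r = (if r < \<omega> then G (N r) r else h r)" for r
      have g_close: "norm (h r - g r) \<le> e" if "r \<in> {s..\<omega>}" for r
        using that e G(2)[OF N_in, of r] by (auto simp: g_def)
      have "g integrable_on {s..y n}" for n
      proof (induction n)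
        case 0
        then show ?case using integrable_on_refl[of g s] by (simp add: y0)
      next
        case (Suc n)
        have "g integrable_on {y n..y (Suc n)}"
        proof (rule integrable_spike_finite[of "{y (Suc n)}" _ _ "G n"])
          fix r assume r: "r \<in> {y n..y (Suc n)} - {y (Suc n)}"
          then have "N r = n" by (intro N_eq) auto
          moreover have "r < \<omega>" using r y_w[of "Suc n"] by simp
          ultimately show "g r = G n r" by (simp add: g_def)
        qed (use G(1) in auto)
        then show ?case using Suc y_s y_mono[of n "Suc n"]
            Henstock_Kurzweil_Integration.integrable_combine[where a=s and c="y n" and b="y (Suc n)" and f=g]
          by simp
      qed
      then have int_x: "g integrable_on {s..x}" if "x < \<omega>" for x
        using y_lim[OF that] by (meson integrable_real_subinterval less_imp_le order_refl)
      have "g integrable_on {s..\<omega>}"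
      proof (rule integrable_bounded_right_open[where K = "K + e"])
        fix x assume x: "x \<in> {s..\<omega>}"
        have "norm (g x) \<le> norm (h x) + norm (h x - g x)"
          using norm_triangle_ineq4[of "h x" "h x - g x"] by simp
        also have "\<dots> \<le> K + e" using x sw bd[of x] g_close[of x] by (intro add_mono) auto
        finally show "norm (g x) \<le> K + e" .
      qed (use sw int_x in auto)
      then show ?thesis using g_close unfolding Ap_def by blast
    qed
    define S where "S = {y\<in>{s..t}. Ap s y}"
    have sS: "s \<in> S" using st Ap_refl by (simp add: S_def)
    have bS: "bdd_above S" by (intro bdd_aboveI[of _ t]) (auto simp: S_def)
    define \<omega> where "\<omega> = Sup S"
    have w: "s \<le> \<omega>" "\<omega> \<le> t"
    proof -
      show "s \<le> \<omega>" unfolding \<omega>_def by (rule cSup_upper[OF sS bS])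
      show "\<omega> \<le> t" unfolding \<omega>_def by (rule cSup_least) (use sS in \<open>auto simp: S_def\<close>)
    qed
    have below: "Ap s y" if y: "s \<le> y" "y < \<omega>" for y
    proof -
      have "\<exists>z\<in>S. y < z"
        by (rule less_cSupD) (use sS y(2) in \<open>auto simp: \<omega>_def\<close>)
      then obtain z where "z \<in> S" "y < z" by blast
      then show ?thesis using Ap_sub[of s z s y] by (auto simp: S_def)
    qed
    have Apw: "Ap s \<omega>"
      using Ap_limit[of \<omega>] below w Ap_refl by (cases "s = \<omega>") auto
    have "\<omega> = t"
    proof (rule ccontr)
      assume "\<omega> \<noteq> t"
      then obtain d where d: "d > 0" "Ap \<omega> (\<omega> + d)"
        using approx[OF e, of \<omega>] w unfolding Ap_def by auto
      define z where "z = min t (\<omega> + d)"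
      have z: "\<omega> < z" "z \<le> t" using \<open>\<omega> \<noteq> t\<close> w d by (auto simp: z_def)
      have "Ap \<omega> z" using d by (rule_tac Ap_sub[of \<omega> "\<omega> + d"]) (auto simp: z_def)
      then have "z \<in> S" using Ap_trans[OF Apw, of z] w z by (auto simp: S_def)
      then show False using cSup_upper[OF _ bS, of z] z by (simp add: \<omega>_def)
    qed
    then show "\<exists>g. (\<forall>x\<in>cbox s t. norm (h x - g x) \<le> e) \<and> g integrable_on cbox s t"
      using Apw unfolding Ap_def by auto
  qed
  then show ?thesis by simp
qed

text \<open>Just to the right of \<open>x\<close> the operator can be frozen:
  \<open>B x (h r)\<close> is integrable as a bounded linear image of \<open>h\<close>, and the
  bound on \<open>h\<close> makes the error at most \<open>norm (B r - B x) * K\<close>.\<close>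

lemma integrable_blinfun_apply:
  fixes h :: "real \<Rightarrow> 'a::banach" and B :: "real \<Rightarrow> 'a \<Rightarrow>\<^sub>L 'b::banach"
  assumes cont: "continuous_on {s..t} B" and int: "h integrable_on {s..t}"
    and bd: "\<And>x. x \<in> {s..t} \<Longrightarrow> norm (h x) \<le> K"
  shows "(\<lambda>r. B r (h r)) integrable_on {s..t}"
proof (cases "s \<le> t")
  case True
  have K0: "K \<ge> 0" using bd[of s] True norm_ge_zero[of "h s"] by (simp del: norm_ge_zero)
  have "compact (B ` {s..t})" using cont by (intro compact_continuous_image) auto
  then have "bounded (B ` {s..t})" by (rule compact_imp_bounded)
  then obtain M where M: "\<And>x. x \<in> {s..t} \<Longrightarrow> norm (B x) \<le> M"
    unfolding bounded_iff by blast
  show ?thesis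
  proof (rule integrable_of_local_right_approximations[OF True])
    show "norm (B x (h x)) \<le> M * K" if "x \<in> {s..t}" for x
      using M[OF that] bd[OF that]
      by (intro order_trans[OF norm_blinfun] mult_mono) (auto intro: order_trans[OF norm_ge_zero])
    fix e x :: real assume e: "e > 0" and x: "x \<in> {s..<t}"
    have "e / (K + 1) > 0" using e K0 by simp
    then obtain d where d: "d > 0" "\<And>r. r \<in> {s..t} \<Longrightarrow> dist r x < d \<Longrightarrow> dist (B r) (B x) < e / (K + 1)"
      using cont[unfolded continuous_on_iff, rule_format, of x "e / (K + 1)"] x by auto
    define d' where "d' = min (d / 2) (t - x)"
    have d': "d' > 0" "d' < d" "x + d' \<le> t" using d x by (auto simp: d'_def)
    show "\<exists>d>0. \<exists>g. g integrable_on {x..x+d} \<and> (\<forall>r\<in>{x..x+d}. norm (B r (h r) - g r) \<le> e)"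
    proof (intro exI conjI ballI)
      show "d' > 0" by fact
      have "h integrable_on {x..x+d'}" using int x d' by (intro integrable_real_subinterval[OF int]) auto
      then show "(\<lambda>r. B x (h r)) integrable_on {x..x+d'}"
        using integrable_linear[OF _ blinfun.bounded_linear_right, of h _ "B x"] by (simp add: o_def)
      fix r assume r: "r \<in> {x..x+d'}"
      have "norm (B r (h r) - B x (h r)) = norm ((B r - B x) (h r))" by (simp add: blinfun.diff_left)
      also have "\<dots> \<le> norm (B r - B x) * norm (h r)" by (rule norm_blinfun)
      also have "\<dots> \<le> (e / (K + 1)) * K"
        using d(2)[of r] r d' x bd[of r] K0 e by (intro mult_mono) (auto simp: dist_norm)
      also have "\<dots> \<le> e" using K0 e by (simp add: field_simps)
      finally show "norm (B r (h r) - B x (h r)) \<le> e" .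
    qed
  qed
qed (simp add: integrable_on_empty)

section \<open>Improper integrals over half-lines\<close>

lemma has_integral_IciI:
  fixes g :: "real \<Rightarrow> 'a::banach"
  assumes int: "\<And>t. s \<le> t \<Longrightarrow> g integrable_on {s..t}"
    and lim: "((\<lambda>t. integral {s..t} g) \<longlongrightarrow> L) at_top"
  shows "(g has_integral L) {s..}"
  unfolding has_integral_alt'
proof (intro conjI allI impI)
  have Int: "{s..} \<inter> {a..b} = {max s a..b}" for a b :: real by auto
  fix a b :: real
  have "g integrable_on {max s a..b}"
  proof (cases "s \<le> b")
    case True
    then show ?thesis by (intro integrable_real_subinterval[OF int]) auto
  qed (simp add: integrable_on_empty)
  then show "(\<lambda>x. if x \<in> {s..} then g x else 0) integrable_on cbox a b"
    unfolding integrable_restrict_Int box_real Int .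
next
  fix e :: real assume "e > 0"
  then obtain N where N: "\<And>t. t \<ge> N \<Longrightarrow> dist (integral {s..t} g) L < e"
    using tendstoD[OF lim] unfolding eventually_at_top_linorder by metis
  define B where "B = \<bar>N\<bar> + \<bar>s\<bar> + 1"
  show "\<exists>B>0. \<forall>a b. ball 0 B \<subseteq> cbox a b \<longrightarrow>
      norm (integral (cbox a b) (\<lambda>x. if x \<in> {s..} then g x else 0) - L) < e"
  proof (intro exI[of _ B] conjI allI impI)
    show "B > 0" by (simp add: B_def)
    fix a b :: real assume ab: "ball 0 B \<subseteq> cbox a b"
    have "s \<in> ball 0 B" "N \<in> ball 0 B" by (auto simp: B_def)
    then have "a \<le> s" "N \<le> b" using ab by force+
    moreover from this have "{s..} \<inter> {a..b} = {s..b}" by auto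
    ultimately show "norm (integral (cbox a b) (\<lambda>x. if x \<in> {s..} then g x else 0) - L) < e"
      using N[of b] unfolding integral_restrict_Int box_real by (simp add: dist_norm)
  qed
qed

lemma integral_Ici_tendsto:
  fixes g :: "real \<Rightarrow> 'a::banach"
  assumes g: "g integrable_on {s..}"
  shows "((\<lambda>t. integral {s..t} g) \<longlongrightarrow> integral {s..} g) at_top"
proof (rule tendstoI)
  fix e :: real assume "e > 0"
  with integrable_integral[OF g] obtain B where B: "B > 0"
    "\<And>a b. ball 0 B \<subseteq> cbox a b \<Longrightarrow>
      norm (integral (cbox a b) (\<lambda>x. if x \<in> {s..} then g x else 0) - integral {s..} g) < e"
    unfolding has_integral_alt' by metis
  have "dist (integral {s..t} g) (integral {s..} g) < e" if "t \<ge> B" for t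
  proof -
    have "ball 0 B \<subseteq> cbox (min s (- B)) t" using that by auto
    moreover have "{s..} \<inter> {min s (- B)..t} = {s..t}" by auto
    ultimately show ?thesis using B(2)[of "min s (- B)" t]
      unfolding integral_restrict_Int box_real by (simp add: dist_norm)
  qed
  then show "\<forall>\<^sub>F t in at_top. dist (integral {s..t} g) (integral {s..} g) < e"
    unfolding eventually_at_top_linorder by blast
qed

lemma integral_Ici_split:
  fixes g :: "real \<Rightarrow> 'a::banach"
  assumes g: "g integrable_on {s..}" and st: "s \<le> t"
  shows "g integrable_on {s..t}" "g integrable_on {t..}"
    "integral {s..} g = integral {s..t} g + integral {t..} g"
proof -
  have int: "g integrable_on {s..x}" for x by (rule integrable_on_subinterval[OF g]) auto
  show 1: "g integrable_on {s..t}" by (rule int)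
  have "((\<lambda>x. integral {s..x} g - integral {s..t} g) \<longlongrightarrow> integral {s..} g - integral {s..t} g) at_top"
    by (intro tendsto_intros integral_Ici_tendsto[OF g])
  moreover have "\<forall>\<^sub>F x in at_top. integral {s..x} g - integral {s..t} g = integral {t..x} g"
    using eventually_ge_at_top[of t]
  proof eventually_elim
    case (elim x)
    then show ?case
      using Henstock_Kurzweil_Integration.integral_combine[where a=s and c=t and b=x and f=g] int st
      by (simp add: algebra_simps)
  qed
  ultimately have "((\<lambda>x. integral {t..x} g) \<longlongrightarrow> integral {s..} g - integral {s..t} g) at_top"
    by (rule Lim_transform_eventually)
  then have "(g has_integral (integral {s..} g - integral {s..t} g)) {t..}"
    using int st by (intro has_integral_IciI) (auto intro: integrable_real_subinterval)
  then show "g integrable_on {t..}" "integral {s..} g = integral {s..t} g + integral {t..} g"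
    by (auto simp: has_integral_iff)
qed

text \<open>Domination alone does not give integrability of a vector-valued function, so
  integrability on bounded intervals is assumed. The limit at infinity exists because increments of
  the integral of \<open>g\<close> are bounded by those of the convergent integral of
  \<open>k\<close>.\<close>

lemma integrable_on_Ici_dominated:
  fixes g :: "real \<Rightarrow> 'a::banach"
  assumes int: "\<And>t. s \<le> t \<Longrightarrow> g integrable_on {s..t}"
    and k: "k integrable_on {s..}" and le: "\<And>x. s \<le> x \<Longrightarrow> norm (g x) \<le> k x"
  shows "g integrable_on {s..}"
proof -
  have bound: "norm (integral {s..v} g - integral {s..u} g) \<le> integral {s..v} k - integral {s..u} k"
    if "s \<le> u" "u \<le> v" for u v
  proof -
    note comb = Henstock_Kurzweil_Integration.integral_combine[where a=s and c=u and b=v, OF that]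
    have kv: "k integrable_on {s..v}" using that integral_Ici_split(1)[OF k, of v] by simp
    have "norm (integral {u..v} g) \<le> integral {u..v} k"
      by (rule integral_norm_bound_integral)
         (use that int[of v] kv le in \<open>auto intro: integrable_real_subinterval\<close>)
    moreover have "integral {u..v} g = integral {s..v} g - integral {s..u} g"
      "integral {u..v} k = integral {s..v} k - integral {s..u} k"
      using comb[of g] comb[of k] int[of v] kv that by (auto simp: algebra_simps)
    ultimately show ?thesis by simp
  qed
  define F where "F t = integral {s..t} g" for t
  define H where "H t = integral {s..t} k" for t
  have FH: "norm (F v - F u) \<le> H v - H u" if "s \<le> u" "u \<le> v" for u v
    using bound[OF that] by (simp add: F_def H_def)
  have H_lim: "(H \<longlongrightarrow> integral {s..} k) at_top"
    unfolding H_def by (rule integral_Ici_tendsto[OF k])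
  define y where "y n = s + real n" for n :: nat
  have y_lim: "filterlim y at_top sequentially" unfolding y_def
    by (intro filterlim_tendsto_add_at_top[OF tendsto_const] filterlim_real_sequentially)
  have Hy: "(\<lambda>n. H (y n)) \<longlonglongrightarrow> integral {s..} k" by (rule filterlim_compose[OF H_lim y_lim])
  have "Cauchy (\<lambda>n. F (y n))"
  proof (rule metric_CauchyI)
    fix e :: real assume "e > 0"
    then obtain M where M: "\<And>m n. m \<ge> M \<Longrightarrow> n \<ge> M \<Longrightarrow> dist (H (y m)) (H (y n)) < e"
      using LIMSEQ_imp_Cauchy[OF Hy] unfolding Cauchy_def by blast
    have "dist (F (y m)) (F (y n)) < e" if "m \<ge> M" "n \<ge> M" for m n
      using FH[of "y m" "y n"] FH[of "y n" "y m"] M[OF that] 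
      by (cases "m \<le> n") (auto simp: y_def dist_norm norm_minus_commute)
    then show "\<exists>M. \<forall>m\<ge>M. \<forall>n\<ge>M. dist (F (y m)) (F (y n)) < e" by blast
  qed
  then obtain L where L: "(\<lambda>n. F (y n)) \<longlonglongrightarrow> L"
    using Cauchy_convergent convergent_def by blast
  have FL: "norm (F t - L) \<le> integral {s..} k - H t" if "s \<le> t" for t
  proof (rule tendsto_le[OF sequentially_bot])
    show "(\<lambda>n. H (y n) - H t) \<longlonglongrightarrow> integral {s..} k - H t" by (intro tendsto_intros Hy)
    show "(\<lambda>n. norm (F t - F (y n))) \<longlonglongrightarrow> norm (F t - L)" by (intro tendsto_intros L)
    have "\<forall>\<^sub>F n in sequentially. y n \<ge> t" using y_lim by (simp add: filterlim_at_top)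
    then show "\<forall>\<^sub>F n in sequentially. norm (F t - F (y n)) \<le> H (y n) - H t"
      by eventually_elim (use FH that in \<open>simp add: norm_minus_commute\<close>)
  qed
  have "((\<lambda>t. F t - L) \<longlongrightarrow> 0) at_top"
  proof (rule Lim_null_comparison)
    show "\<forall>\<^sub>F t in at_top. norm (F t - L) \<le> integral {s..} k - H t"
      using eventually_ge_at_top[of s] by eventually_elim (rule FL)
    show "((\<lambda>t. integral {s..} k - H t) \<longlongrightarrow> 0) at_top"
      using tendsto_diff[OF tendsto_const[of "integral {s..} k"] H_lim] by simp
  qed
  then have "(F \<longlongrightarrow> L) at_top" by (simp add: LIM_zero_iff)
  then have "(g has_integral L) {s..}" using has_integral_IciI[of s g L] int by (simp add: F_def[abs_def])
  then show ?thesis by (rule has_integral_integrable)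
qed

section \<open>Linear evolution operators\<close>

text \<open>The norm of \<open>d\<close> need not be differentiable. The argument runs through its
  integral majorant \<open>G\<close>, for which \<open>G' = K * N \<le> K * G\<close>, so that
  \<open>exp (- K * (x - s)) * G x\<close> cannot increase.\<close>

lemma gronwall_forward:
  fixes d :: "real \<Rightarrow> 'a::banach"
  assumes st: "s \<le> t"
    and der: "\<And>x. x \<in> {s..t} \<Longrightarrow> (d has_vector_derivative d' x) (at x within {s..t})"
    and le: "\<And>x. x \<in> {s..t} \<Longrightarrow> norm (d' x) \<le> K * norm (d x)"
    and K: "K \<ge> 0"
  shows "norm (d t) \<le> exp (K * (t - s)) * norm (d s)"
proof -
  define N where "N x = norm (d x)" for x
  have cd: "continuous_on {s..t} d"
    by (rule continuous_on_vector_derivative[OF der])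
  then have cN: "continuous_on {s..t} N" unfolding N_def by (intro continuous_intros)
  define G where "G x = N s + K * integral {s..x} N" for x
  have NG: "N x \<le> G x" if x: "x \<in> {s..t}" for x
  proof -
    have ftc: "(d' has_integral (d x - d s)) {s..x}"
      by (rule fundamental_theorem_of_calculus)
        (use x in \<open>auto intro!: has_vector_derivative_within_subset[OF der]\<close>)
    have "N integrable_on {s..x}"
      using cN x by (intro integrable_continuous_real) (auto intro: continuous_on_subset)
    then have KN: "(\<lambda>r. K * N r) integrable_on {s..x}" using integrable_cmul[of N "{s..x}" K] by simp
    have "norm (integral {s..x} d') \<le> integral {s..x} (\<lambda>r. K * N r)"
      by (rule integral_norm_bound_integral) (use ftc KN le x in \<open>auto simp: N_def\<close>)
    then have "norm (d x - d s) \<le> K * integral {s..x} N"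
      using ftc by (simp add: integral_unique)
    then show ?thesis using norm_triangle_sub[of "d x" "d s"] by (simp add: G_def N_def)
  qed
  have dG: "(G has_real_derivative K * N x) (at x within {s..t})" if "x \<in> {s..t}" for x
    unfolding G_def has_real_derivative_iff_has_vector_derivative
    by (rule derivative_eq_intros integral_has_vector_derivative[OF cN that] refl | simp)+
  define E where "E x = exp (- K * (x - s)) * G x" for x
  have "E t \<le> E s"
  proof (rule DERIV_nonpos_imp_decreasing_open[OF st])
    have "continuous_on {s..t} G" by (rule DERIV_continuous_on[OF dG])
    then show "continuous_on {s..t} E" unfolding E_def by (intro continuous_intros)
    fix x assume x: "s < x" "x < t"
    then have "(G has_real_derivative K * N x) (at x)"
      using dG[of x] at_within_Icc_at[of s x t] by simp
    then have "(E has_real_derivative exp (- K * (x - s)) * (K * N x - K * G x)) (at x)"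
      unfolding E_def by (auto intro!: derivative_eq_intros simp: algebra_simps)
    moreover have "exp (- K * (x - s)) * (K * N x - K * G x) \<le> 0"
      using NG[of x] x K by (intro mult_nonneg_nonpos) (auto simp: mult_left_mono)
    ultimately show "\<exists>y. (E has_real_derivative y) (at x) \<and> y \<le> 0" by blast
  qed
  then have "exp (- K * (t - s)) * G t \<le> N s" by (simp add: E_def G_def)
  then have "exp (K * (t - s)) * (exp (- K * (t - s)) * G t) \<le> exp (K * (t - s)) * N s"
    by (intro mult_left_mono) auto
  then have "G t \<le> exp (K * (t - s)) * N s"
    by (simp add: mult.assoc[symmetric] exp_add[symmetric])
  then show ?thesis using NG[of t] st by (simp add: N_def)
qed

text \<open>Time reversal covers \<open>t < s\<close>, which matters because the evolution operator
  is also used backwards in time.\<close>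

lemma gronwall:
  fixes d :: "real \<Rightarrow> 'a::banach"
  assumes S: "s \<in> S" "t \<in> S" and iv: "is_interval S"
    and der: "\<And>x. x \<in> S \<Longrightarrow> (d has_vector_derivative d' x) (at x within S)"
    and le: "\<And>x. x \<in> S \<Longrightarrow> norm (d' x) \<le> K * norm (d x)"
    and K: "K \<ge> 0"
  shows "norm (d t) \<le> exp (K * \<bar>t - s\<bar>) * norm (d s)"
proof (cases "s \<le> t")
  case True
  have sub: "{s..t} \<subseteq> S" using mem_is_interval_1_I[OF iv S] by auto
  have "norm (d t) \<le> exp (K * (t - s)) * norm (d s)"
    by (rule gronwall_forward[OF True, of d d'])
       (use sub le K in \<open>auto intro!: has_vector_derivative_within_subset[OF der]\<close>)
  then show ?thesis using True by simp
next
  case False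
  have sub: "{t..s} \<subseteq> S" using mem_is_interval_1_I[OF iv S(2,1)] by auto
  have im: "uminus ` {-s..-t} = {t..s}" by simp
  have "norm ((d \<circ> uminus) (-t)) \<le> exp (K * (-t - -s)) * norm ((d \<circ> uminus) (-s))"
  proof (rule gronwall_forward[where d = "d \<circ> uminus" and s = "- s" and t = "- t" and K = K and d' = "\<lambda>x. (- 1) *\<^sub>R d' (- x)"])
    fix x assume x: "x \<in> {-s..-t}"
    have "(d has_vector_derivative d' (- x)) (at (- x) within uminus ` {-s..-t})"
      unfolding im by (rule has_vector_derivative_within_subset[OF der sub]) (use x sub in auto)
    then show "(d \<circ> uminus has_vector_derivative (- 1) *\<^sub>R d' (- x)) (at x within {-s..-t})"
      using vector_diff_chain_within[OF has_vector_derivative_minus[OF has_vector_derivative_id],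
        of d "d' (- x)" x "{-s..-t}"] by simp
    show "norm ((- 1) *\<^sub>R d' (- x)) \<le> K * norm ((d \<circ> uminus) x)"
      using le[of "- x"] x sub by (simp add: subset_iff)
  qed (use False K in auto)
  then show ?thesis using False by simp
qed

lemma has_vector_derivative_zero_of_quadratic_bound:
  fixes f :: "real \<Rightarrow> 'a::real_normed_vector"
  assumes "\<And>y. y \<in> S \<Longrightarrow> norm (f y - f x) \<le> C * (y - x)\<^sup>2" "x \<in> S"
  shows "(f has_vector_derivative 0) (at x within S)"
proof -
  have "((\<lambda>y. norm (f y - f x) / norm (y - x)) \<longlongrightarrow> 0) (at x within S)"
  proof (rule Lim_null_comparison)
    show "\<forall>\<^sub>F y in at x within S. norm (norm (f y - f x) / norm (y - x)) \<le> C * \<bar>y - x\<bar>"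
      unfolding eventually_at
    proof (intro exI[of _ 1] conjI ballI impI)
      fix y assume y: "y \<in> S" "y \<noteq> x \<and> dist y x < 1"
      have "norm (f y - f x) \<le> C * \<bar>y - x\<bar> * \<bar>y - x\<bar>"
        using assms(1)[OF y(1)] by (simp add: power2_eq_square mult.assoc)
      then show "norm (norm (f y - f x) / norm (y - x)) \<le> C * \<bar>y - x\<bar>"
        using y(2) by (simp add: divide_le_eq)
    qed simp
    have "((\<lambda>y. C * \<bar>y - x\<bar>) \<longlongrightarrow> C * \<bar>x - x\<bar>) (at x within S)" by (intro tendsto_intros)
    then show "((\<lambda>y. C * \<bar>y - x\<bar>) \<longlongrightarrow> 0) (at x within S)" by simp
  qed
  then show ?thesis
    unfolding has_vector_derivative_def has_derivative_iff_norm by (simp add: bounded_linear_zero)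
qed

lemma continuous_on_of_Lipschitz_on_Icc:
  fixes g :: "real \<Rightarrow> 'a::real_normed_vector"
  assumes "\<And>R. \<exists>C. \<forall>x\<in>{0..R}. \<forall>y\<in>{0..R}. norm (g x - g y) \<le> C * \<bar>x - y\<bar>"
  shows "continuous_on {0..} g"
  unfolding continuous_on_def
proof
  fix x :: real assume x: "x \<in> {0..}"
  obtain C where C: "\<forall>y\<in>{0..x+1}. \<forall>z\<in>{0..x+1}. norm (g y - g z) \<le> C * \<bar>y - z\<bar>" using assms by blast
  have "((\<lambda>y. g y - g x) \<longlongrightarrow> 0) (at x within {0..})"
  proof (rule Lim_null_comparison)
    show "\<forall>\<^sub>F y in at x within {0..}. norm (g y - g x) \<le> C * \<bar>y - x\<bar>"
      unfolding eventually_at using x C by (intro exI[of _ 1]) (auto simp: dist_real_def)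
    have "((\<lambda>y. C * \<bar>y - x\<bar>) \<longlongrightarrow> C * \<bar>x - x\<bar>) (at x within {0..})" by (intro tendsto_intros)
    then show "((\<lambda>y. C * \<bar>y - x\<bar>) \<longlongrightarrow> 0) (at x within {0..})" by simp
  qed
  then show "(g \<longlongrightarrow> g x) (at x within {0..})" by (simp add: LIM_zero_iff)
qed

lemma continuous_on_Ici:
  fixes v :: "real \<Rightarrow> 'a::topological_space"
  assumes "\<And>t. continuous_on {s..t} v"
  shows "continuous_on {s..} v"
  unfolding continuous_on_def
proof
  fix x assume x: "x \<in> {s..}"
  have "(v \<longlongrightarrow> v x) (at x within {s..x+1})" using assms[of "x+1"] x by (auto simp: continuous_on_def)
  moreover have "at x within {s..x+1} = at x within {s..}"
    by (rule at_within_nhd[of x "{..<x+1}"]) auto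
  ultimately show "(v \<longlongrightarrow> v x) (at x within {s..})" by simp
qed

section \<open>Cocycle property, local bounds and continuity of the evolution operator\<close>

locale linear_evolution =
  fixes A :: "real \<Rightarrow> 'a::banach \<Rightarrow>\<^sub>L 'a" and T :: "real \<Rightarrow> real \<Rightarrow> 'a \<Rightarrow>\<^sub>L 'a"
  assumes A_cont: "continuous_on {0..} A" and evol: "evolution_operator A T"
begin

lemma T_self: "s \<ge> 0 \<Longrightarrow> T s s v = v"
  using evol by (simp add: evolution_operator_def)

lemma T_deriv:
  "s \<ge> 0 \<Longrightarrow> t \<ge> 0 \<Longrightarrow> ((\<lambda>t. T t s v) has_vector_derivative A t (T t s v)) (at t within {0..})"
  using evol by (simp add: evolution_operator_def)

lemma A_bounded:
  obtains K where "K \<ge> 0" "\<And>r. r \<in> {0..R} \<Longrightarrow> norm (A r) \<le> K"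
proof -
  have "compact (A ` {0..R})"
    by (intro compact_continuous_image continuous_on_subset[OF A_cont]) auto
  then have "bounded (A ` {0..R})" by (rule compact_imp_bounded)
  then obtain K where "\<forall>x\<in>A ` {0..R}. norm x \<le> K" unfolding bounded_iff by blast
  then show thesis by (intro that[of "max K 0"]) (auto intro: max.coboundedI1)
qed

lemma linear_growth:
  assumes "\<And>r. r \<in> {0..R} \<Longrightarrow> norm (A r) \<le> K" "K \<ge> 0" "s \<in> S" "t \<in> S" "is_interval S" "S \<subseteq> {0..R}"
    and "\<And>x. x \<in> S \<Longrightarrow> (d has_vector_derivative A x (d x)) (at x within S)"
  shows "norm (d t) \<le> exp (K * \<bar>t - s\<bar>) * norm (d s)"
proof (rule gronwall[where S = S and d' = "\<lambda>x. A x (d x)"])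
  fix x assume "x \<in> S"
  then show "norm (A x (d x)) \<le> K * norm (d x)"
    using assms(1)[of x] assms(6) by (intro order_trans[OF norm_blinfun] mult_right_mono) auto
qed (use assms in auto)

text \<open>As functions of \<open>t\<close>, both sides solve the linear equation and agree at
  \<open>t = r\<close>; Gronwall on an interval containing both times makes their difference
  vanish.\<close>

lemma T_cocycle:
  assumes "t \<ge> 0" "r \<ge> 0" "s \<ge> 0"
  shows "T t r (T r s v) = T t s v"
proof -
  define R where "R = max t r"
  obtain K where K: "K \<ge> 0" "\<And>x. x \<in> {0..R} \<Longrightarrow> norm (A x) \<le> K" using A_bounded by blast
  define d where "d x = T x r (T r s v) - T x s v" for x
  have "norm (d t) \<le> exp (K * \<bar>t - r\<bar>) * norm (d r)"
  proof (rule linear_growth[OF K(2) K(1), where S = "{0..R}"])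
    fix x assume x: "x \<in> {0..R}"
    have "(d has_vector_derivative A x (d x)) (at x within {0..})"
      unfolding d_def blinfun.diff_right using x assms
      by (intro has_vector_derivative_diff T_deriv) auto
    then show "(d has_vector_derivative A x (d x)) (at x within {0..R})"
      by (rule has_vector_derivative_within_subset) auto
  qed (use assms in \<open>auto simp: R_def is_interval_cc\<close>)
  then show ?thesis using assms by (simp add: d_def T_self)
qed

lemma T_inverse: "t \<ge> 0 \<Longrightarrow> s \<ge> 0 \<Longrightarrow> T s t (T t s v) = v"
  by (simp add: T_cocycle T_self)

text \<open>Turns the \<open>inv\<close> in the definition of the dichotomy into evolution backwards
  in time.\<close>

lemma inv_T: "t \<ge> 0 \<Longrightarrow> s \<ge> 0 \<Longrightarrow> inv (blinfun_apply (T t s)) = blinfun_apply (T s t)"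
  by (intro inv_unique_comp ext) (auto simp: T_inverse)

text \<open>The definition of \<open>T\<close> gives differentiability only for each fixed vector.
  Gronwall and the mean value inequality, both uniform in the vector, upgrade this to estimates in
  operator norm on compact time intervals.\<close>

lemma T_bounds:
  obtains M L where "M \<ge> 0" "L \<ge> 0" "\<And>s t. s \<in> {0..R} \<Longrightarrow> t \<in> {0..R} \<Longrightarrow> norm (T t s) \<le> M"
    "\<And>s t. s \<in> {0..R} \<Longrightarrow> t \<in> {0..R} \<Longrightarrow> norm (T t s - id_blinfun) \<le> L * \<bar>t - s\<bar>"
proof -
  obtain K where K: "K \<ge> 0" "\<And>x. x \<in> {0..R} \<Longrightarrow> norm (A x) \<le> K" using A_bounded by blast
  define M where "M = exp (K * R)"
  have der: "((\<lambda>t. T t s v) has_vector_derivative A t (T t s v)) (at t within {0..R})"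
    if "s \<in> {0..R}" "t \<in> {0..R}" for s t v
    using T_deriv[of s t v] that by (auto intro: has_vector_derivative_within_subset)
  have M: "norm (T t s v) \<le> M * norm v" if "s \<in> {0..R}" "t \<in> {0..R}" for s t v
  proof -
    have "norm (T t s v) \<le> exp (K * \<bar>t - s\<bar>) * norm (T s s v)"
      by (rule linear_growth[OF K(2) K(1), where S = "{0..R}"])
         (use that der in \<open>auto simp: is_interval_cc\<close>)
    also have "\<dots> \<le> M * norm v"
      unfolding M_def using that K(1) by (intro mult_mono) (auto simp: T_self intro!: mult_left_mono)
    finally show ?thesis .
  qed
  have L: "norm (T t s v - v) \<le> K * M * \<bar>t - s\<bar> * norm v" if "s \<in> {0..R}" "t \<in> {0..R}" for s t v
  proof -
    have "norm (T t s v - T s s v) \<le> (K * M * norm v) * norm (t - s)"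
    proof (rule differentiable_bound[where S = "{0..R}" and f = "\<lambda>t. T t s v"])
      fix x assume x: "x \<in> {0..R}"
      show "((\<lambda>t. T t s v) has_derivative (\<lambda>h. h *\<^sub>R A x (T x s v))) (at x within {0..R})"
        using der[OF that(1) x] by (simp add: has_vector_derivative_def)
      have "norm (A x (T x s v)) \<le> K * (M * norm v)"
      proof (rule order_trans[OF norm_blinfun mult_mono])
        show "norm (T x s v) \<le> M * norm v" using M[OF that(1) x] .
      qed (use K x in auto)
      then have "norm (h *\<^sub>R A x (T x s v)) \<le> K * (M * norm v) * norm h" for h
        using mult_right_mono[of "norm (A x (T x s v))" "K * (M * norm v)" "norm h"]
        by (simp add: mult.commute[of "\<bar>h\<bar>"])
      then show "onorm (\<lambda>h. h *\<^sub>R A x (T x s v)) \<le> K * M * norm v"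
        using K(1) by (intro onorm_bound) (simp_all add: M_def mult.assoc)
    qed (use that in auto)
    then show ?thesis using that by (simp add: T_self mult_ac)
  qed
  have M0: "M \<ge> 0" by (simp add: M_def)
  show thesis
  proof (rule that[of M "K * M"])
    fix s t assume st: "s \<in> {0..R}" "t \<in> {0..R}"
    show "norm (T t s) \<le> M" using M[OF st] M0 by (intro norm_blinfun_bound) auto
    show "norm (T t s - id_blinfun) \<le> K * M * \<bar>t - s\<bar>"
      using L[OF st] M0 K(1) by (intro norm_blinfun_bound) (auto simp: blinfun.diff_left)
  qed (use M0 K(1) in auto)
qed

lemma T_continuous_left: assumes s: "s \<ge> 0" shows "continuous_on {0..} (\<lambda>t. T t s)"
proof (rule continuous_on_of_Lipschitz_on_Icc)
  fix R
  obtain M L where Tb: "M \<ge> 0" "L \<ge> 0"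
    "\<And>s' t. s' \<in> {0..max R s} \<Longrightarrow> t \<in> {0..max R s} \<Longrightarrow> norm (T t s') \<le> M"
    "\<And>s' t. s' \<in> {0..max R s} \<Longrightarrow> t \<in> {0..max R s} \<Longrightarrow> norm (T t s' - id_blinfun) \<le> L * \<bar>t - s'\<bar>"
    by (rule T_bounds[of "max R s"]) (rule that)
  show "\<exists>C. \<forall>x\<in>{0..R}. \<forall>y\<in>{0..R}. norm (T x s - T y s) \<le> C * \<bar>x - y\<bar>"
  proof (intro exI ballI)
    fix x y assume xy: "x \<in> {0..R}" "y \<in> {0..R}"
    have "T x s - T y s = (T x y - id_blinfun) o\<^sub>L T y s"
      by (rule blinfun_eqI) (use xy s in \<open>simp add: blinfun.diff_left T_cocycle\<close>)
    also have "norm \<dots> \<le> norm (T x y - id_blinfun) * norm (T y s)" by (rule norm_blinfun_compose)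
    also have "\<dots> \<le> (L * \<bar>x - y\<bar>) * M" using xy s Tb by (intro mult_mono) auto
    finally show "norm (T x s - T y s) \<le> (L * M) * \<bar>x - y\<bar>" by (simp add: mult_ac)
  qed
qed

text \<open>Continuity in the initial time is what allows \<open>\<lambda>r. T s r (h r)\<close> to
  be integrated; the cocycle property reduces it to \<open>T x y\<close> being near the
  identity.\<close>

lemma T_continuous_right: assumes s: "s \<ge> 0" shows "continuous_on {0..} (\<lambda>r. T s r)"
proof (rule continuous_on_of_Lipschitz_on_Icc)
  fix R
  obtain M L where Tb: "M \<ge> 0" "L \<ge> 0"
    "\<And>s' t. s' \<in> {0..max R s} \<Longrightarrow> t \<in> {0..max R s} \<Longrightarrow> norm (T t s') \<le> M"
    "\<And>s' t. s' \<in> {0..max R s} \<Longrightarrow> t \<in> {0..max R s} \<Longrightarrow> norm (T t s' - id_blinfun) \<le> L * \<bar>t - s'\<bar>"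
    by (rule T_bounds[of "max R s"]) (rule that)
  show "\<exists>C. \<forall>x\<in>{0..R}. \<forall>y\<in>{0..R}. norm (T s x - T s y) \<le> C * \<bar>x - y\<bar>"
  proof (intro exI ballI)
    fix x y assume xy: "x \<in> {0..R}" "y \<in> {0..R}"
    have "T s x - T s y = - (T s x o\<^sub>L (T x y - id_blinfun))"
      by (rule blinfun_eqI) (use xy s in \<open>simp add: blinfun.diff_left blinfun.diff_right blinfun.minus_left T_cocycle\<close>)
    also have "norm \<dots> \<le> norm (T s x) * norm (T x y - id_blinfun)" 
      by (simp add: norm_blinfun_compose)
    also have "\<dots> \<le> M * (L * \<bar>x - y\<bar>)" using xy s Tb by (intro mult_mono) auto
    finally show "norm (T s x - T s y) \<le> (M * L) * \<bar>x - y\<bar>" by (simp add: mult_ac)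
  qed
qed

section \<open>Variation of constants for bounded integrable forcing\<close>

lemma T_integrable:
  assumes s: "s \<ge> 0" and u: "u \<ge> 0" and int: "h integrable_on {s..t}"
    and bd: "\<And>r. r \<in> {s..t} \<Longrightarrow> norm (h r) \<le> K"
  shows "(\<lambda>r. T u r (h r)) integrable_on {s..t}"
  by (rule integrable_blinfun_apply[OF _ int bd])
     (use s in \<open>auto intro: continuous_on_subset[OF T_continuous_right[OF u]]\<close>)

lemma T_integral:
  assumes "t \<ge> 0" "r \<ge> 0" "S \<subseteq> {0..}" "(\<lambda>x. T r x (h x)) integrable_on S"
  shows "(\<lambda>x. T t x (h x)) integrable_on S"
    "T t r (integral S (\<lambda>x. T r x (h x))) = integral S (\<lambda>x. T t x (h x))"
proof -
  have eq: "T t r (T r x (h x)) = T t x (h x)" if "x \<in> S" for x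
    using that assms by (auto intro: T_cocycle)
  have "(\<lambda>x. T t r (T r x (h x))) integrable_on S"
    using integrable_linear[OF assms(4) blinfun.bounded_linear_right, of "T t r"] by (simp add: o_def)
  then show "(\<lambda>x. T t x (h x)) integrable_on S" by (rule integrable_eq) (rule eq)
  have "T t r (integral S (\<lambda>x. T r x (h x))) = integral S (\<lambda>x. T t r (T r x (h x)))"
    using integral_linear[OF assms(4) blinfun.bounded_linear_right, of "T t r"] by (simp add: o_def)
  also have "\<dots> = integral S (\<lambda>x. T t x (h x))" by (rule integral_cong) (rule eq)
  finally show "T t r (integral S (\<lambda>x. T r x (h x))) = integral S (\<lambda>x. T t x (h x))" .
qed

text \<open>The forcing \<open>h\<close> has no pointwise meaning as a derivative; but \<open>u\<close> minus the indefinite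
  integral of \<open>h\<close> is differentiable, because \<open>T(y,r) - 1\<close> is of order \<open>y - r\<close>.\<close>

lemma variation_of_constants_solves:
  assumes s: "s \<ge> 0" and st: "s \<le> t" and int: "h integrable_on {s..t}"
    and bd: "\<And>r. r \<in> {s..t} \<Longrightarrow> norm (h r) \<le> K"
    and u: "\<And>x. x \<in> {s..t} \<Longrightarrow> u x = T x s (v0 + integral {s..x} (\<lambda>r. T s r (h r)))"
  shows "((\<lambda>r. A r (u r) + h r) has_integral (u t - v0)) {s..t}"
proof -
  obtain M L where Tb: "M \<ge> 0" "L \<ge> 0"
    "\<And>s' x. s' \<in> {0..t} \<Longrightarrow> x \<in> {0..t} \<Longrightarrow> norm (T x s') \<le> M"
    "\<And>s' x. s' \<in> {0..t} \<Longrightarrow> x \<in> {0..t} \<Longrightarrow> norm (T x s' - id_blinfun) \<le> L * \<bar>x - s'\<bar>"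
    by (rule T_bounds[of t]) (rule that)
  have K0: "K \<ge> 0" using bd[of s] st norm_ge_zero[of "h s"] by (simp del: norm_ge_zero)
  have Ti: "(\<lambda>r. T y r (h r)) integrable_on {s..x}" if "x \<in> {s..t}" "y \<in> {s..t}" for x y
    by (rule T_integrable[where K = K, OF s]) (use that s bd in \<open>auto intro: integrable_real_subinterval[OF int]\<close>)
  have hi: "h integrable_on {s..x}" if "x \<in> {s..t}" for x
    by (rule integrable_real_subinterval[OF int]) (use that in auto)
  define W where "W x = v0 + integral {s..x} (\<lambda>r. T s r (h r))" for x
  define H where "H x = integral {s..x} h" for x
  have quad: "norm (T y s (W d - W c) - (H d - H c)) \<le> L * K * (d - c)\<^sup>2"
    if "s \<le> c" "c \<le> d" "d \<le> t" "y \<in> {c..d}" for c d y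
  proof -
    note comb = Henstock_Kurzweil_Integration.integral_combine[where a=s and c=c and b=d, OF that(1,2)]
    have cd: "(\<lambda>r. T s r (h r)) integrable_on {c..d}" "h integrable_on {c..d}" "(\<lambda>r. T y r (h r)) integrable_on {c..d}"
      using Ti[of d s] Ti[of d y] hi[of d] that st by (auto intro: integrable_real_subinterval)
    have "W d - W c = integral {c..d} (\<lambda>r. T s r (h r))"
      using comb[of "\<lambda>r. T s r (h r)"] Ti[of d s] that st by (simp add: W_def algebra_simps)
    then have "T y s (W d - W c) = integral {c..d} (\<lambda>r. T y r (h r))"
      using T_integral(2)[OF _ s _ cd(1), of y] that s by (auto simp: subset_iff)
    moreover have "H d - H c = integral {c..d} h"
      using comb[of h] hi[of d] that by (simp add: H_def algebra_simps)
    ultimately have "T y s (W d - W c) - (H d - H c) = integral {c..d} (\<lambda>r. T y r (h r) - h r)"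
      using Henstock_Kurzweil_Integration.integral_diff[OF cd(3,2)] by simp
    also have "norm \<dots> \<le> (L * (d - c) * K) * (d - c)"
    proof (rule norm_integral_le_real)
      show "(\<lambda>r. T y r (h r) - h r) integrable_on {c..d}" by (rule integrable_diff[OF cd(3,2)])
      fix r assume r: "r \<in> {c..d}"
      have "T y r (h r) - h r = (T y r - id_blinfun) (h r)" by (simp add: blinfun.diff_left)
      also have "norm \<dots> \<le> norm (T y r - id_blinfun) * norm (h r)" by (rule norm_blinfun)
      also have "\<dots> \<le> (L * (d - c)) * K"
      proof (rule mult_mono)
        have "norm (T y r - id_blinfun) \<le> L * \<bar>y - r\<bar>" using Tb(4)[of r y] r that s by auto
        also have "\<dots> \<le> L * (d - c)" using r that Tb(2) by (intro mult_left_mono) auto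
        finally show "norm (T y r - id_blinfun) \<le> L * (d - c)" .
      qed (use r that bd[of r] Tb(2) in auto)
      finally show "norm (T y r (h r) - h r) \<le> L * (d - c) * K" .
    qed (use that in auto)
    finally show ?thesis by (simp add: power2_eq_square mult_ac)
  qed
  \<comment> \<open>\<open>u y - H y\<close> is split into \<open>T y s (W x)\<close> with
    \<open>W\<close> frozen at \<open>x\<close>, which carries the derivative, the quadratically
    small bracket estimated in \<open>quad\<close>, and the constant \<open>- H x\<close>.\<close>
  have der: "((\<lambda>y. u y - H y) has_vector_derivative A x (u x)) (at x within {s..t})" if x: "x \<in> {s..t}" for x
  proof -
    have "((\<lambda>y. T y s (W x)) has_vector_derivative A x (T x s (W x))) (at x within {s..t})"
      by (rule has_vector_derivative_within_subset[OF T_deriv]) (use s x in auto)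
    moreover have "((\<lambda>y. T y s (W y - W x) - (H y - H x)) has_vector_derivative 0) (at x within {s..t})"
    proof (rule has_vector_derivative_zero_of_quadratic_bound[OF _ x])
      fix y assume y: "y \<in> {s..t}"
      show "norm (T y s (W y - W x) - (H y - H x) - (T x s (W x - W x) - (H x - H x))) \<le> L * K * (y - x)\<^sup>2"
      proof (cases "x \<le> y")
        case True
        then show ?thesis using quad[of x y y] x y by simp
      next
        case False
        have "norm (T y s (W y - W x) - (H y - H x)) = norm (T y s (W x - W y) - (H x - H y))"
          by (subst norm_minus_cancel[symmetric]) (simp add: blinfun.diff_right algebra_simps)
        also have "\<dots> \<le> L * K * (x - y)\<^sup>2" using quad[of y x y] x y False by simp
        finally show ?thesis by (simp add: power2_commute[of x y])
      qed
    qed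
    ultimately have "((\<lambda>y. T y s (W x) + (T y s (W y - W x) - (H y - H x)))
        has_vector_derivative A x (T x s (W x)) + 0) (at x within {s..t})"
      by (rule has_vector_derivative_add)
    then have "((\<lambda>y. T y s (W x) + (T y s (W y - W x) - (H y - H x)) - H x)
        has_vector_derivative A x (T x s (W x)) + 0 - 0) (at x within {s..t})"
      by (intro has_vector_derivative_diff has_vector_derivative_const)
    then have "((\<lambda>y. T y s (W y) - H y) has_vector_derivative A x (u x)) (at x within {s..t})"
      using u[OF x] by (simp add: blinfun.diff_right W_def[symmetric] algebra_simps)
    then show ?thesis
      by (rule has_vector_derivative_transform[OF x, rotated]) (simp add: u W_def)
  qed
  have "((\<lambda>r. A r (u r)) has_integral (u t - H t) - (u s - H s)) {s..t}"
    by (rule fundamental_theorem_of_calculus[OF st der])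
  from has_integral_add[OF this integrable_integral[OF int]]
  show ?thesis using u[of s] st s by (simp add: H_def T_self)
qed

text \<open>The forcing cancels in the difference of \<open>v\<close> and the explicit formula. What
  remains satisfies the homogeneous integral equation, hence is continuous, then differentiable,
  then zero by Gronwall.\<close>

lemma variation_of_constants:
  assumes s: "s \<ge> 0" and st: "s \<le> t" and int: "h integrable_on {s..t}"
    and bd: "\<And>r. r \<in> {s..t} \<Longrightarrow> norm (h r) \<le> K"
    and v: "\<And>x. x \<in> {s..t} \<Longrightarrow> ((\<lambda>r. A r (v r) + h r) has_integral (v x - v0)) {s..x}"
  shows "v t = T t s (v0 + integral {s..t} (\<lambda>r. T s r (h r)))"
proof -
  define u where "u x = T x s (v0 + integral {s..x} (\<lambda>r. T s r (h r)))" for x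
  have u_int: "((\<lambda>r. A r (u r) + h r) has_integral (u x - v0)) {s..x}" if x: "x \<in> {s..t}" for x
    by (rule variation_of_constants_solves[OF s, of x h K])
       (use x bd u_def in \<open>auto intro: integrable_real_subinterval[OF int]\<close>)
  define d where "d x = v x - u x" for x
  have d_int: "((\<lambda>r. A r (d r)) has_integral d x) {s..x}" if x: "x \<in> {s..t}" for x
    using has_integral_diff[OF v[OF x] u_int[OF x]]
    by (simp add: d_def blinfun.diff_right algebra_simps)
  have Ad: "(\<lambda>r. A r (d r)) integrable_on {s..t}" using d_int[of t] st by auto
  have d_eq: "d x = integral {s..x} (\<lambda>r. A r (d r))" if "x \<in> {s..t}" for x
    using d_int[OF that] by (simp add: integral_unique)
  have "continuous_on {s..t} (\<lambda>x. integral {s..x} (\<lambda>r. A r (d r)))"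
    by (rule indefinite_integral_continuous_1[OF Ad])
  then have cd: "continuous_on {s..t} d" by (rule continuous_on_eq) (simp add: d_eq)
  have cAd: "continuous_on {s..t} (\<lambda>r. A r (d r))"
    by (intro blinfun.continuous_on cd continuous_on_subset[OF A_cont]) (use s in auto)
  obtain K where K: "K \<ge> 0" "\<And>x. x \<in> {0..t} \<Longrightarrow> norm (A x) \<le> K" using A_bounded by blast
  have "norm (d t) \<le> exp (K * \<bar>t - s\<bar>) * norm (d s)"
  proof (rule linear_growth[OF K(2) K(1), where S = "{s..t}"])
    fix x assume x: "x \<in> {s..t}"
    have "((\<lambda>x. integral {s..x} (\<lambda>r. A r (d r))) has_vector_derivative A x (d x)) (at x within {s..t})"
      by (rule integral_has_vector_derivative[OF cAd x])
    then show "(d has_vector_derivative A x (d x)) (at x within {s..t})"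
      by (rule has_vector_derivative_transform[OF x, rotated]) (simp add: d_eq)
  qed (use s st in \<open>auto simp: is_interval_cc\<close>)
  moreover have "d s = 0" using d_eq[of s] st by simp
  ultimately have "d t = 0" by simp
  then show ?thesis by (simp add: d_def u_def)
qed

end

section \<open>The perturbed equation\<close>

lemma maximal_solution_unique:
  assumes "maximal_solution g s v0 \<omega> v" "maximal_solution g s v0 \<omega>' v'"
  shows "\<omega> = \<omega>'" "\<And>t. t \<in> fwd_ival s \<omega> \<Longrightarrow> v t = v' t"
  using assms unfolding maximal_solution_def by (metis order_antisym)+

lemma sol_eq_maximal:
  assumes "maximal_solution g s v0 \<omega> v" "t \<in> fwd_ival s \<omega>"
  shows "sol g s v0 t = v t"
  unfolding sol_def
proof (rule the_equality)
  show "\<exists>\<omega> w. maximal_solution g s v0 \<omega> w \<and> t \<in> fwd_ival s \<omega> \<and> v t = w t" using assms by blast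
  fix x assume "\<exists>\<omega> w. maximal_solution g s v0 \<omega> w \<and> t \<in> fwd_ival s \<omega> \<and> x = w t"
  then obtain \<omega>' w where w: "maximal_solution g s v0 \<omega>' w" "x = w t" by blast
  show "x = v t" using maximal_solution_unique(2)[OF assms(1) w(1) assms(2)] w(2) by simp
qed

text \<open>A solution on \<open>{s..}\<close> competes with right endpoint infinity, so maximality
  makes the maximal interval infinite and identifies the two.\<close>

lemma sol_of_global_solution:
  assumes max: "maximal_solution g s v0 \<omega> v" and u: "solves g s v0 {s..} u" and t: "s \<le> t"
  shows "sol_defined g s v0 t" "sol g s v0 t = u t"
proof -
  have "fwd_ival s \<infinity> = {s..}" by (auto simp: fwd_ival_def)
  then have w: "\<infinity> \<le> \<omega>" "\<forall>t\<in>{s..}. u t = v t"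
    using max u unfolding maximal_solution_def by (metis ereal_infty_less(1) ereal.distinct(1) PInfty_neq_ereal(1))+
  then have "t \<in> fwd_ival s \<omega>" using t by (simp add: fwd_ival_def)
  then show "sol_defined g s v0 t" "sol g s v0 t = u t"
    using max sol_eq_maximal[OF max] w(2) t unfolding sol_defined_def by auto
qed

lemma solves_sol:
  assumes "\<And>t. s \<le> t \<Longrightarrow> sol_defined g s v0 t"
  shows "solves g s v0 {s..} (sol g s v0)"
  unfolding solves_def
proof (intro conjI ballI)
  have v: "\<exists>\<omega> v. maximal_solution g s v0 \<omega> v \<and> t \<in> fwd_ival s \<omega>" if "s \<le> t" for t
    using assms[OF that] by (simp add: sol_defined_def)
  show "sol g s v0 s = v0"
  proof -
    obtain \<omega> v where m: "maximal_solution g s v0 \<omega> v" "s \<in> fwd_ival s \<omega>" using v[of s] by auto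
    have "v s = v0" using m(1) by (simp add: maximal_solution_def solves_def)
    then show ?thesis using sol_eq_maximal[OF m] by simp
  qed
  fix t assume "t \<in> {s..}"
  then obtain \<omega> v where m: "maximal_solution g s v0 \<omega> v" "t \<in> fwd_ival s \<omega>" using v[of t] by auto
  have sub: "r \<in> fwd_ival s \<omega>" if "r \<in> {s..t}" for r
    using m(2) that unfolding fwd_ival_def by (auto intro: le_less_trans[of "ereal r" "ereal t"])
  have "((\<lambda>r. g r (v r)) has_integral (v t - v0)) {s..t}"
    using m by (simp add: maximal_solution_def solves_def)
  then have "((\<lambda>r. g r (sol g s v0 r)) has_integral (v t - v0)) {s..t}"
    by (rule has_integral_eq[rotated]) (simp add: sol_eq_maximal[OF m(1) sub])
  then show "((\<lambda>r. g r (sol g s v0 r)) has_integral (sol g s v0 t - v0)) {s..t}"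
    using sol_eq_maximal[OF m] by simp
qed

lemma solves_continuous:
  assumes "solves g s v0 J v" "{s..t} \<subseteq> J" "s \<le> t"
  shows "continuous_on {s..t} v"
proof -
  have i: "((\<lambda>r. g r (v r)) has_integral (v x - v0)) {s..x}" if "x \<in> {s..t}" for x
    using assms(1,2) that by (auto simp: solves_def)
  have "continuous_on {s..t} (\<lambda>x. integral {s..x} (\<lambda>r. g r (v r)))"
    by (rule indefinite_integral_continuous_1) (use i[of t] assms(3) in auto)
  then have "continuous_on {s..t} (\<lambda>x. v0 + integral {s..x} (\<lambda>r. g r (v r)))"
    by (intro continuous_intros)
  then show ?thesis by (rule continuous_on_eq) (simp add: integral_unique[OF i])
qed

section \<open>Integrability along continuous curves, and mild solutions\<close>

locale perturbed_equation = linear_evolution A T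
  for A :: "real \<Rightarrow> 'a::banach \<Rightarrow>\<^sub>L 'a" and T +
  fixes f :: "real \<Rightarrow> 'a \<Rightarrow> 'a" and c q :: real
  assumes c: "c > 0" and q: "q > 0"
    and f_zero: "\<And>t. t \<ge> 0 \<Longrightarrow> f t 0 = 0"
    and f_lip: "\<And>t u v. t \<ge> 0 \<Longrightarrow>
      norm (f t u - f t v) \<le> c * norm (u - v) * (norm u + norm v) powr q"
    and wellposed: "\<And>s v0. s \<ge> 0 \<Longrightarrow> \<exists>\<omega> v. maximal_solution (perturbed_rhs A f) s v0 \<omega> v"
begin

lemma f_lip_le:
  assumes "t \<ge> 0" "norm (u - v) \<le> d" "norm u + norm v \<le> B"
  shows "norm (f t u - f t v) \<le> c * d * B powr q"
proof -
  have "norm (f t u - f t v) \<le> c * norm (u - v) * (norm u + norm v) powr q" by (rule f_lip[OF assms(1)])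
  also have "\<dots> \<le> c * d * B powr q"
    using assms c q order_trans[OF norm_ge_zero assms(2)] by (intro mult_mono powr_mono2) auto
  finally show ?thesis .
qed

lemma f_norm_le:
  assumes "t \<ge> 0" "norm u \<le> B"
  shows "norm (f t u) \<le> c * B * B powr q"
  using f_lip_le[of t u 0 B B] f_zero assms by simp

lemma f_integrable:
  assumes s: "s \<ge> 0" and u: "continuous_on {s..t} u"
  shows "(\<lambda>r. f r (u r)) integrable_on {s..t}"
proof (cases "s \<le> t")
  case st: True
  have "bounded (u ` {s..t})"
    by (intro compact_imp_bounded compact_continuous_image u) auto
  then obtain B where B: "\<forall>x\<in>u ` {s..t}. norm x \<le> B" unfolding bounded_iff by blast
  have B0: "B \<ge> 0" using B st by (auto intro: order_trans[OF norm_ge_zero])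
  show ?thesis
  proof (rule integrable_of_local_right_approximations[OF st])
    show "norm (f x (u x)) \<le> c * B * B powr q" if "x \<in> {s..t}" for x
      using that s B by (intro f_norm_le) auto
    fix e x :: real assume e: "e > 0" and x: "x \<in> {s..<t}"
    obtain \<omega> v where max: "maximal_solution (perturbed_rhs A f) x (u x) \<omega> v"
      using wellposed[of x "u x"] x s by auto
    then have xw: "ereal x < \<omega>" and sv: "solves (perturbed_rhs A f) x (u x) (fwd_ival x \<omega>) v"
      by (auto simp: maximal_solution_def)
    obtain y0 where y0: "x < y0" "ereal y0 < \<omega>" using ereal_dense2[OF xw] by auto
    define y where "y = min y0 t"
    have xy: "x < y" "y \<le> t" "ereal y < \<omega>"
      using y0 x by (auto simp: y_def min_def intro: le_less_trans[of "ereal t" "ereal y0"])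
    have ival: "{x..y} \<subseteq> fwd_ival x \<omega>"
      using xy(3) by (auto simp: fwd_ival_def intro: le_less_trans[of _ "ereal y"])
    have cv: "continuous_on {x..y} v" by (rule solves_continuous[OF sv ival]) (use xy in simp)
    have vx: "v x = u x" using sv by (simp add: solves_def)
    have cu: "continuous_on {x..y} u" using u xy x by (auto intro: continuous_on_subset)
    \<comment> \<open>\<open>Lc\<close> is a Lipschitz constant of \<open>f r\<close> on the ball of
      radius \<open>B + 1\<close>: there \<open>u\<close> has norm at most \<open>B\<close>, and
      \<open>v\<close> stays in the ball because \<open>\<eta> \<le> 1\<close>.\<close>
    define Lc where "Lc = c * (2 * (B + 1)) powr q"
    have Lc: "Lc \<ge> 0" using c by (simp add: Lc_def)
    define \<eta> where "\<eta> = min 1 (e / (Lc + 1))"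
    have eta: "\<eta> > 0" "\<eta> \<le> 1" "\<eta> * Lc \<le> e"
    proof -
      show "\<eta> > 0" "\<eta> \<le> 1" using e Lc by (auto simp: \<eta>_def)
      have "\<eta> * Lc \<le> (e / (Lc + 1)) * Lc" using Lc by (intro mult_right_mono) (auto simp: \<eta>_def)
      also have "\<dots> \<le> e" using e Lc by (simp add: field_simps)
      finally show "\<eta> * Lc \<le> e" .
    qed
    have "continuous_on {x..y} (\<lambda>r. u r - v r)" by (intro continuous_intros cu cv)
    then obtain d where d: "d > 0" "\<And>r. r \<in> {x..y} \<Longrightarrow> dist r x < d \<Longrightarrow> dist (u r - v r) (u x - v x) < \<eta>"
      unfolding continuous_on_iff using xy(1) eta(1) by (metis atLeastAtMost_iff order_refl less_imp_le)
    define d' where "d' = min (d / 2) (y - x)"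
    have d': "d' > 0" "d' < d" "x + d' \<le> y" using d xy by (auto simp: d'_def)
    \<comment> \<open>Only the sum of the linear part and \<open>f\<close> along \<open>v\<close> is
      integrable by the notion of solution; the linear part is continuous and can be
      subtracted.\<close>
    have intg: "(\<lambda>r. f r (v r)) integrable_on {x..x+d'}"
    proof -
      have "(\<lambda>r. A r (v r) + f r (v r)) integrable_on {x..x+d'}"
        using sv ival d' by (auto simp: solves_def perturbed_rhs_def subset_iff)
      moreover have "(\<lambda>r. A r (v r)) integrable_on {x..x+d'}"
        by (intro integrable_continuous_real blinfun.continuous_on continuous_on_subset[OF A_cont]
            continuous_on_subset[OF cv]) (use x s d' in auto)
      ultimately have "(\<lambda>r. (A r (v r) + f r (v r)) - A r (v r)) integrable_on {x..x+d'}"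
        by (rule integrable_diff)
      then show ?thesis by simp
    qed
    show "\<exists>d>0. \<exists>g. g integrable_on {x..x+d} \<and> (\<forall>r\<in>{x..x+d}. norm (f r (u r) - g r) \<le> e)"
    proof (intro exI conjI ballI)
      show "d' > 0" by fact
      show "(\<lambda>r. f r (v r)) integrable_on {x..x+d'}" by fact
      fix r assume r: "r \<in> {x..x+d'}"
      have uv: "norm (u r - v r) \<le> \<eta>" using d(2)[of r] r d' vx by (auto simp: dist_norm)
      have ur: "norm (u r) \<le> B" using B r x d' xy by auto
      have "norm (v r) \<le> norm (u r) + norm (u r - v r)"
        using norm_triangle_ineq4[of "u r" "u r - v r"] by simp
      then have "norm (v r) \<le> B + 1" using uv ur eta(2) by linarith
      then have "norm (u r) + norm (v r) \<le> 2 * (B + 1)" using ur by simp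
      then have "norm (f r (u r) - f r (v r)) \<le> c * \<eta> * (2 * (B + 1)) powr q"
        by (intro f_lip_le uv) (use r x s in auto)
      also have "\<dots> = \<eta> * Lc" by (simp add: Lc_def mult_ac)
      also have "\<dots> \<le> e" by (rule eta(3))
      finally show "norm (f r (u r) - f r (v r)) \<le> e" .
    qed
  qed
qed (simp add: integrable_on_empty)

lemma f_locally_bounded:
  assumes "s \<ge> 0" "continuous_on {s..t} u"
  obtains K where "\<And>r. r \<in> {s..t} \<Longrightarrow> norm (f r (u r)) \<le> K"
proof -
  have "bounded (u ` {s..t})"
    by (intro compact_imp_bounded compact_continuous_image assms) auto
  then obtain B where B: "\<forall>x\<in>u ` {s..t}. norm x \<le> B" unfolding bounded_iff by blast
  show thesis
    by (rule that[of "c * B * B powr q"], rule f_norm_le) (use B assms in auto)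
qed

lemma T_f_integrable:
  assumes "s \<ge> 0" "x \<ge> 0" "continuous_on {s..t} u"
  shows "(\<lambda>r. T x r (f r (u r))) integrable_on {s..t}"
proof -
  obtain K where "\<And>r. r \<in> {s..t} \<Longrightarrow> norm (f r (u r)) \<le> K"
    by (rule f_locally_bounded[OF assms(1,3)]) (rule that)
  then show ?thesis using T_integrable[OF assms(1,2) f_integrable[OF assms(1,3)]] by blast
qed

text \<open>Together with the converse \<open>global_sol_mild\<close>, this lets the rest of the
  proof work with fixed point equations instead of \<open>sol\<close>.\<close>

lemma mild_solution_is_sol:
  assumes s: "s \<ge> 0" and u: "continuous_on {s..} u"
    and mild: "\<And>t. t \<ge> s \<Longrightarrow> u t = T t s (v0 + integral {s..t} (\<lambda>r. T s r (f r (u r))))"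
    and t: "t \<ge> s"
  shows "sol_defined (perturbed_rhs A f) s v0 t" "sol (perturbed_rhs A f) s v0 t = u t"
proof -
  have "solves (perturbed_rhs A f) s v0 {s..} u"
    unfolding solves_def perturbed_rhs_def
  proof (intro conjI ballI)
    show "u s = v0" using mild[of s] s by (simp add: T_self)
    fix t assume t: "t \<in> {s..}"
    have u': "continuous_on {s..t} u" by (rule continuous_on_subset[OF u]) auto
    obtain K where "\<And>r. r \<in> {s..t} \<Longrightarrow> norm (f r (u r)) \<le> K"
      by (rule f_locally_bounded[OF s u']) (rule that)
    then show "((\<lambda>r. A r (u r) + f r (u r)) has_integral (u t - v0)) {s..t}"
      using t mild by (intro variation_of_constants_solves[OF s _ f_integrable[OF s u']]) auto
  qed
  then show "sol_defined (perturbed_rhs A f) s v0 t" "sol (perturbed_rhs A f) s v0 t = u t"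
    using wellposed[OF s, of v0] sol_of_global_solution t by blast+
qed

lemma global_sol_mild:
  assumes s: "s \<ge> 0" and def: "\<And>t. t \<ge> s \<Longrightarrow> sol_defined (perturbed_rhs A f) s v0 t"
  defines "v \<equiv> sol (perturbed_rhs A f) s v0"
  shows "continuous_on {s..} v" "v s = v0"
    "\<And>t. t \<ge> s \<Longrightarrow> v t = T t s (v0 + integral {s..t} (\<lambda>r. T s r (f r (v r))))"
proof -
  have sv: "solves (perturbed_rhs A f) s v0 {s..} v" unfolding v_def by (rule solves_sol[OF def])
  have cv: "continuous_on {s..t} v" for t
  proof (cases "s \<le> t")
    case True
    then show ?thesis by (intro solves_continuous[OF sv]) auto
  qed simp
  show "continuous_on {s..} v" by (rule continuous_on_Ici[OF cv])
  show "v s = v0" using sv by (simp add: solves_def)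
  fix t assume t: "t \<ge> s"
  obtain K where K: "\<And>r. r \<in> {s..t} \<Longrightarrow> norm (f r (v r)) \<le> K"
    by (rule f_locally_bounded[OF s cv]) (rule that)
  show "v t = T t s (v0 + integral {s..t} (\<lambda>r. T s r (f r (v r))))"
    by (rule variation_of_constants[OF s t f_integrable[OF s cv] K])
       (use sv in \<open>auto simp: solves_def perturbed_rhs_def\<close>)
qed

end

section \<open>The Lyapunov--Perron operator\<close>

locale dichotomy_equation = perturbed_equation A T f c q
  for A :: "real \<Rightarrow> 'a::banach \<Rightarrow>\<^sub>L 'a" and T f c q +
  fixes P :: "real \<Rightarrow> 'a \<Rightarrow>\<^sub>L 'a" and \<mu> \<nu> :: "real \<Rightarrow> real" and D a b \<epsilon> :: real
  assumes \<mu>: "growth_rate \<mu>" and \<nu>: "growth_rate \<nu>"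
    and dich: "nonuniform_dichotomy T \<mu> \<nu> P D a b \<epsilon>"
    and int: "(\<lambda>r. \<mu> r powr (a * q) * \<nu> r powr \<epsilon>) integrable_on {0..}"
begin

abbreviation Q where "Q s \<equiv> compl_proj (P s)"

section \<open>Growth rates and the two dichotomy estimates\<close>

lemma mu_mono: "0 \<le> s \<Longrightarrow> s \<le> t \<Longrightarrow> \<mu> s \<le> \<mu> t"
  using \<mu> unfolding growth_rate_def by (auto intro: mono_onD)

lemma nu_mono: "0 \<le> s \<Longrightarrow> s \<le> t \<Longrightarrow> \<nu> s \<le> \<nu> t"
  using \<nu> unfolding growth_rate_def by (auto intro: mono_onD)

lemma mu_ge_1: "0 \<le> s \<Longrightarrow> 1 \<le> \<mu> s"
  using mu_mono[of 0 s] \<mu> by (simp add: growth_rate_def)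

lemma nu_ge_1: "0 \<le> s \<Longrightarrow> 1 \<le> \<nu> s"
  using nu_mono[of 0 s] \<nu> by (simp add: growth_rate_def)

lemma D: "1 \<le> D" and a: "a < 0" and b: "0 \<le> b" and \<epsilon>: "0 \<le> \<epsilon>"
  using dich by (auto simp: nonuniform_dichotomy_def)

lemma P_idem: "0 \<le> s \<Longrightarrow> P s (P s v) = P s v"
  using dich blinfun_apply_blinfun_compose[of "P s" "P s" v] by (simp add: nonuniform_dichotomy_def)

lemma P_T: "0 \<le> s \<Longrightarrow> 0 \<le> t \<Longrightarrow> P t (T t s v) = T t s (P s v)"
  using dich blinfun_apply_blinfun_compose[of "P t" "T t s" v] blinfun_apply_blinfun_compose[of "T t s" "P s" v]
  by (simp add: nonuniform_dichotomy_def)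

lemma Q_apply: "Q s v = v - P s v"
  by (simp add: compl_proj_def blinfun.diff_left)

lemma Q_T: "0 \<le> s \<Longrightarrow> 0 \<le> t \<Longrightarrow> Q t (T t s v) = T t s (Q s v)"
  by (simp add: Q_apply P_T blinfun.diff_right)

lemma P_Q: "0 \<le> s \<Longrightarrow> P s (Q s v) = 0" and Q_P: "0 \<le> s \<Longrightarrow> Q s (P s v) = 0"
  and Q_Q: "0 \<le> s \<Longrightarrow> Q s (Q s v) = Q s v"
  by (auto simp: Q_apply P_idem blinfun.diff_right)

definition w :: "real \<Rightarrow> real \<Rightarrow> real" where "w s t = (\<mu> t / \<mu> s) powr a"

lemma w_pos: "0 \<le> s \<Longrightarrow> s \<le> t \<Longrightarrow> 0 < w s t"
  using mu_ge_1[of s] mu_ge_1[of t] by (simp add: w_def)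

lemma w_self: "0 \<le> s \<Longrightarrow> w s s = 1"
  using mu_ge_1[of s] by (simp add: w_def)

lemma w_trans: "0 \<le> s \<Longrightarrow> s \<le> r \<Longrightarrow> r \<le> t \<Longrightarrow> w s r * w r t = w s t"
  using mu_ge_1[of s] mu_ge_1[of r] mu_ge_1[of t] by (simp add: w_def powr_divide)

lemma w_antimono: "0 \<le> s \<Longrightarrow> s \<le> r \<Longrightarrow> r \<le> t \<Longrightarrow> w s t \<le> w s r"
  unfolding w_def using mu_ge_1[of s] mu_ge_1[of r] mu_mono[of r t] a
  by (intro powr_mono2') (auto intro: divide_right_mono)

lemma w_le_1: "0 \<le> s \<Longrightarrow> s \<le> t \<Longrightarrow> w s t \<le> 1"
  using w_antimono[of s s t] w_self[of s] by simp

lemma norm_P_T: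
  assumes "0 \<le> r" "r \<le> t"
  shows "norm (P t (T t r v)) \<le> D * w r t * \<nu> r powr \<epsilon> * norm v"
proof -
  have "norm (T t r o\<^sub>L P r) \<le> D * w r t * \<nu> r powr \<epsilon>"
    using dich assms by (simp add: nonuniform_dichotomy_def w_def)
  then have "norm ((T t r o\<^sub>L P r) v) \<le> D * w r t * \<nu> r powr \<epsilon> * norm v"
    by (intro order_trans[OF norm_blinfun] mult_right_mono) auto
  then show ?thesis using assms by (simp add: P_T)
qed

lemma norm_Q_T:
  assumes "0 \<le> t" "t \<le> r"
  shows "norm (Q t (T t r v)) \<le> D * (\<mu> r / \<mu> t) powr (- b) * \<nu> r powr \<epsilon> * norm v"
proof -
  have "onorm (\<lambda>x. inv (blinfun_apply (T r t)) (Q r x)) \<le> D * (\<mu> r / \<mu> t) powr (- b) * \<nu> r powr \<epsilon>"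
    using dich assms by (simp add: nonuniform_dichotomy_def)
  then have "onorm (\<lambda>x. T t r (Q r x)) \<le> D * (\<mu> r / \<mu> t) powr (- b) * \<nu> r powr \<epsilon>"
    using assms by (simp add: inv_T)
  moreover have "norm (T t r (Q r v)) \<le> onorm (\<lambda>x. T t r (Q r x)) * norm v"
    by (rule onorm) (intro bounded_linear_intros)
  ultimately have "norm (T t r (Q r v)) \<le> D * (\<mu> r / \<mu> t) powr (- b) * \<nu> r powr \<epsilon> * norm v"
    by (meson mult_right_mono norm_ge_zero order_trans)
  then show ?thesis using assms by (simp add: Q_T)
qed

text \<open>The decay at rate \<open>b\<close> is dropped: the unstable integrals converge thanks to
  the power \<open>q\<close> of \<open>w\<close>. The full estimate returns in
  \<open>unstable_part_limit\<close>.\<close>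

lemma norm_Q_T_le:
  assumes "0 \<le> t" "t \<le> r"
  shows "norm (Q t (T t r v)) \<le> D * \<nu> r powr \<epsilon> * norm v"
proof -
  have "(\<mu> r / \<mu> t) powr (- b) \<le> 1 powr (- b)"
    using b mu_ge_1[of t] mu_mono[of t r] assms by (intro powr_mono2') auto
  then have "D * (\<mu> r / \<mu> t) powr (- b) * \<nu> r powr \<epsilon> * norm v \<le> D * 1 * \<nu> r powr \<epsilon> * norm v"
    using D by (intro mult_right_mono mult_left_mono) auto
  then show ?thesis using norm_Q_T[OF assms, of v] by simp
qed

abbreviation \<beta> where "\<beta> \<equiv> beta \<mu> \<nu> a \<epsilon> q"

text \<open>The natural size of orbits starting within radius \<open>\<beta> s\<close>: the
  dichotomy multiplies that radius by \<open>\<nu> s powr \<epsilon>\<close>.\<close>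

definition m :: "real \<Rightarrow> real" where "m s = \<beta> s * \<nu> s powr \<epsilon>"

text \<open>What remains of the integrands of both Lyapunov-Perron integrals once the constants and
  the weight are taken out: one dichotomy loss at time \<open>r\<close>, and the power of the decay
  that the superlinearity of \<open>f\<close> contributes.\<close>

definition kern :: "real \<Rightarrow> real \<Rightarrow> real" where "kern s r = \<nu> r powr \<epsilon> * w s r powr q"

lemma kern_eq:
  assumes "0 \<le> s" "s \<le> r"
  shows "kern s r = \<mu> s powr (- (a * q)) * (\<mu> r powr (a * q) * \<nu> r powr \<epsilon>)"
  using mu_ge_1[of s] mu_ge_1[of r] assms
  by (simp add: kern_def w_def powr_powr powr_divide powr_minus_divide)

lemma tail_integrable: "0 \<le> s \<Longrightarrow> (\<lambda>r. \<mu> r powr (a * q) * \<nu> r powr \<epsilon>) integrable_on {s..}"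
  using integral_Ici_split(2)[OF int] by simp

lemma kern_integrable: assumes "0 \<le> s" shows "kern s integrable_on {s..}"
proof -
  have "(\<lambda>r. \<mu> s powr (- (a * q)) * (\<mu> r powr (a * q) * \<nu> r powr \<epsilon>)) integrable_on {s..}"
    using integrable_cmul[OF tail_integrable[OF assms], of "\<mu> s powr (- (a * q))"] by simp
  then show ?thesis by (rule integrable_eq) (use assms in \<open>simp add: kern_eq\<close>)
qed

lemma kern_nonneg: "0 \<le> kern s r"
  by (simp add: kern_def)

text \<open>Without this, division by zero would make \<open>\<beta> s\<close> equal to 0 and the
  balls empty. A unit interval suffices: on it the integrand is at least
  \<open>\<mu> (s + 1) powr (a * q)\<close>.\<close>

lemma tail_pos:
  assumes "0 \<le> s"
  shows "0 < integral {s..} (\<lambda>r. \<mu> r powr (a * q) * \<nu> r powr \<epsilon>)"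
proof -
  let ?k = "\<lambda>r. \<mu> r powr (a * q) * \<nu> r powr \<epsilon>"
  note split = integral_Ici_split[OF tail_integrable[OF assms], of "s + 1"]
  have 1: "integral {s..s+1} (\<lambda>r. \<mu> (s + 1) powr (a * q)) \<le> integral {s..s+1} ?k"
  proof (rule integral_le)
    fix r assume r: "r \<in> {s..s+1}"
    have "\<mu> (s + 1) powr (a * q) \<le> \<mu> r powr (a * q)"
      using mu_mono[of r "s + 1"] mu_ge_1[of r] a q r assms
      by (intro powr_mono2') (auto simp: mult_nonpos_nonneg)
    moreover have "1 \<le> \<nu> r powr \<epsilon>" using nu_ge_1[of r] r assms \<epsilon> by (intro ge_one_powr_ge_zero) auto
    ultimately show "\<mu> (s + 1) powr (a * q) \<le> ?k r"
      using mult_mono[of "\<mu> (s + 1) powr (a * q)" "\<mu> r powr (a * q)" 1 "\<nu> r powr \<epsilon>"] by simp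
  qed (use split in auto)
  have "0 < \<mu> (s + 1) powr (a * q)" using mu_ge_1[of "s + 1"] assms by simp
  also have "\<dots> \<le> integral {s..s+1} ?k" using 1 by simp
  also have "\<dots> \<le> integral {s..s+1} ?k + integral {s+1..} ?k"
    using Henstock_Kurzweil_Integration.integral_nonneg[of ?k "{s+1..}"] split by simp
  also have "\<dots> = integral {s..} ?k" using split by simp
  finally show ?thesis .
qed

lemma beta_pos: assumes "0 \<le> s" shows "0 < \<beta> s"
  using tail_pos[OF assms] mu_ge_1[OF assms] nu_ge_1[OF assms] unfolding beta_def
  by (intro divide_pos_pos mult_pos_pos) auto

lemma m_pos: "0 \<le> s \<Longrightarrow> 0 < m s"
  using beta_pos[of s] nu_ge_1[of s] by (simp add: m_def)

lemma beta_le_m: assumes "0 \<le> s" shows "\<beta> s \<le> m s"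
  using mult_left_mono[of 1 "\<nu> s powr \<epsilon>" "\<beta> s"] beta_pos[OF assms] nu_ge_1[OF assms] \<epsilon>
  by (simp add: m_def ge_one_powr_ge_zero)

text \<open>The powers of \<open>\<nu>\<close> in \<open>\<beta>\<close> are exactly those for which the factor \<open>\<nu>(s)\<^sup>\<epsilon>\<close> lost in the dichotomy
  estimates is regained here.\<close>

lemma m_kern: assumes s: "0 \<le> s" shows "m s powr q * integral {s..} (kern s) = \<nu> s powr (- \<epsilon>)"
proof -
  define \<kappa> where "\<kappa> = integral {s..} (\<lambda>r. \<mu> r powr (a * q) * \<nu> r powr \<epsilon>)"
  have pos: "\<kappa> > 0" "\<mu> s > 0" "\<nu> s > 0"
    using tail_pos[OF s] mu_ge_1[OF s] nu_ge_1[OF s] by (auto simp: \<kappa>_def)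
  have "integral {s..} (kern s) = integral {s..} (\<lambda>r. \<mu> s powr (- (a * q)) * (\<mu> r powr (a * q) * \<nu> r powr \<epsilon>))"
    by (rule integral_cong) (use s in \<open>simp add: kern_eq\<close>)
  also have "\<dots> = \<mu> s powr (- (a * q)) * \<kappa>" by (simp add: \<kappa>_def)
  finally have 1: "integral {s..} (kern s) = \<mu> s powr (- (a * q)) * \<kappa>" .
  have "m s = \<mu> s powr a * \<nu> s powr (- (\<epsilon> / q)) * \<kappa> powr (- (1 / q))"
  proof -
    have "\<nu> s powr (\<epsilon> * (1 + 1 / q)) = \<nu> s powr \<epsilon> * \<nu> s powr (\<epsilon> / q)"
      by (simp add: powr_add[symmetric] distrib_left)
    then show ?thesis
      using pos by (simp add: m_def beta_def \<kappa>_def[symmetric] powr_minus divide_simps)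
  qed
  then have "m s powr q = \<mu> s powr (a * q) * \<nu> s powr (- \<epsilon>) * \<kappa> powr (- 1)"
    using pos q by (simp add: powr_mult powr_powr)
  then show ?thesis unfolding 1 using pos by (simp add: powr_minus divide_simps mult_ac)
qed

text \<open>The two instances in use are \<open>W = w s\<close> and \<open>W = 1\<close>: the former gives the decay of orbits, the
  latter makes the Lyapunov--Perron operator a contraction in the unweighted supremum norm.\<close>

definition weight :: "real \<Rightarrow> (real \<Rightarrow> real) \<Rightarrow> bool" where
  "weight s W \<longleftrightarrow> (\<forall>r\<ge>s. 0 \<le> W r) \<and> (\<forall>r\<ge>s. \<forall>t\<ge>r. w r t * W r \<le> W t \<and> W t \<le> W r)"

lemma weight_w: "0 \<le> s \<Longrightarrow> weight s (w s)"
  unfolding weight_def using w_pos w_antimono w_trans[of s] by (auto simp: mult.commute less_imp_le)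

lemma weight_const: "0 \<le> s \<Longrightarrow> weight s (\<lambda>_. 1)"
  unfolding weight_def using w_le_1 by auto

text \<open>The factor gained in one integral: \<open>D\<close> from the dichotomy and
  \<open>c * R powr q\<close> from the Lipschitz bound of \<open>f\<close>, when sums of norms are
  at most \<open>R * m s * w s r\<close>.\<close>

definition \<Theta> :: "real \<Rightarrow> real" where "\<Theta> R = D * c * R powr q"

text \<open>The bound that the hypothesis on \<open>f\<close> yields for
  \<open>f r (u r) - f r (v r)\<close> if the difference of the curves is at most
  \<open>N * W r\<close> and the sum of their norms at most \<open>R * m s * w s r\<close>. The set
  \<open>S\<close> stays free because the bootstrap knows such bounds only up to a time.\<close>

definition dominated :: "real \<Rightarrow> (real \<Rightarrow> real) \<Rightarrow> real \<Rightarrow> real \<Rightarrow> real set \<Rightarrow> (real \<Rightarrow> 'a) \<Rightarrow> bool" where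
  "dominated s W N R S h \<longleftrightarrow> (\<forall>r\<in>S. norm (h r) \<le> c * N * W r * (R * m s * w s r) powr q)"

lemma dominated_eq:
  assumes "0 \<le> s" "s \<le> r" "0 \<le> R"
  shows "D * \<nu> r powr \<epsilon> * (c * N * W r * (R * m s * w s r) powr q)
    = \<Theta> R * N * m s powr q * W r * kern s r"
  using m_pos[OF assms(1)] w_pos[OF assms(1,2)] assms(3)
  by (simp add: \<Theta>_def kern_def powr_mult mult_ac)

lemma integral_kern_le:
  assumes s: "0 \<le> s" and S: "S \<subseteq> {s..}" "kern s integrable_on S" and M: "0 \<le> M"
  shows "M * m s powr q * integral S (kern s) \<le> M * \<nu> s powr (- \<epsilon>)"
proof -
  have "integral S (kern s) \<le> integral {s..} (kern s)"
    by (rule integral_subset_le[OF S(1,2) kern_integrable[OF s]]) (simp add: kern_nonneg)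
  then have "m s powr q * integral S (kern s) \<le> \<nu> s powr (- \<epsilon>)"
    unfolding m_kern[OF s, symmetric] by (intro mult_left_mono) auto
  then show ?thesis using M by (simp add: mult.assoc mult_left_mono)
qed

section \<open>Estimates of the stable and the unstable integral\<close>

lemma Theta_nonneg: "0 \<le> \<Theta> R"
  using D c by (simp add: \<Theta>_def)

text \<open>The end \<open>\<tau>\<close> is separated from the evaluation time \<open>t\<close>,
  and nothing is asked of \<open>h\<close> at \<open>\<tau>\<close>, because the bootstrap
  integrates up to a first failure and evaluates slightly later.\<close>

lemma P_T_integral_bound:
  assumes s: "0 \<le> s" "s \<le> \<tau>" "\<tau> \<le> t" and W: "weight s W" and NR: "0 \<le> N" "0 \<le> R"
    and int: "(\<lambda>r. T s r (h r)) integrable_on {s..\<tau>}" and dom: "dominated s W N R {s..<\<tau>} h"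
  shows "norm (integral {s..\<tau>} (\<lambda>r. P t (T t r (h r)))) \<le> \<Theta> R * N * \<nu> s powr (- \<epsilon>) * W t"
proof -
  have Tint: "(\<lambda>r. T t r (h r)) integrable_on {s..\<tau>}"
    by (rule T_integral(1)[OF _ _ _ int]) (use s in auto)
  then have Pint: "(\<lambda>r. P t (T t r (h r))) integrable_on {s..\<tau>}"
    using integrable_linear[OF Tint blinfun.bounded_linear_right, of "P t"] by (simp add: o_def)
  let ?M = "\<Theta> R * N * W t"
  have M: "0 \<le> ?M" using W s NR Theta_nonneg by (auto simp: weight_def)
  let ?k = "\<lambda>r. ?M * m s powr q * kern s r"
  have kint: "kern s integrable_on {s..\<tau>}"
    using integral_Ici_split(1)[OF kern_integrable[OF s(1)] s(2)] .
  \<comment> \<open>The majorant is altered at the single point \<open>\<tau>\<close>, where no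
    domination is known; its integral does not change.\<close>
  define k where "k r = (if r = \<tau> then norm (P t (T t r (h r))) else ?k r)" for r
  have k_int: "?k integrable_on {s..\<tau>}" using integrable_cmul[OF kint, of "?M * m s powr q"] by simp
  have "k integrable_on {s..\<tau>}"
    by (rule integrable_spike_finite[of "{\<tau>}", OF _ _ k_int]) (auto simp: k_def)
  then have "norm (integral {s..\<tau>} (\<lambda>r. P t (T t r (h r)))) \<le> integral {s..\<tau>} k"
  proof (rule integral_norm_bound_integral[OF Pint])
    fix r assume r: "r \<in> {s..\<tau>}"
    show "norm (P t (T t r (h r))) \<le> k r"
    proof (cases "r = \<tau>")
      case False
      then have r': "r \<in> {s..<\<tau>}" "0 \<le> r" "s \<le> r" "r \<le> t" using r s by auto
      have "norm (P t (T t r (h r))) \<le> D * w r t * \<nu> r powr \<epsilon> * norm (h r)"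
        by (rule norm_P_T) (use r' in auto)
      also have "\<dots> \<le> D * w r t * \<nu> r powr \<epsilon> * (c * N * W r * (R * m s * w s r) powr q)"
        using dom r' D w_pos[of r t] by (intro mult_left_mono) (auto simp: dominated_def)
      also have "\<dots> = w r t * (D * \<nu> r powr \<epsilon> * (c * N * W r * (R * m s * w s r) powr q))"
        by (simp add: mult_ac)
      also have "\<dots> = (w r t * W r) * (\<Theta> R * N * m s powr q * kern s r)"
        unfolding dominated_eq[OF s(1) r'(3) NR(2)] by (simp add: mult_ac)
      \<comment> \<open>Forward integrals use the first half of \<open>weight\<close>, that
        \<open>W\<close> decays no faster than \<open>w\<close>.\<close>
      also have "\<dots> \<le> W t * (\<Theta> R * N * m s powr q * kern s r)"
        using W r' NR Theta_nonneg kern_nonneg by (intro mult_right_mono) (auto simp: weight_def)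
      finally show ?thesis using False by (simp add: k_def mult_ac)
    qed (simp add: k_def)
  qed
  also have "integral {s..\<tau>} k = integral {s..\<tau>} ?k"
    by (rule integral_spike[of "{\<tau>}"]) (auto simp: k_def)
  also have "\<dots> = ?M * m s powr q * integral {s..\<tau>} (kern s)" by simp
  also have "\<dots> \<le> ?M * \<nu> s powr (- \<epsilon>)" by (rule integral_kern_le[OF s(1) _ kint M]) auto
  finally show ?thesis by (simp add: mult_ac)
qed

lemma Q_T_integral_bound:
  assumes s: "0 \<le> s" "s \<le> t" and W: "weight s W" and NR: "0 \<le> N" "0 \<le> R"
    and int: "\<And>x. s \<le> x \<Longrightarrow> (\<lambda>r. T s r (h r)) integrable_on {s..x}" and dom: "dominated s W N R {t..} h"
  shows "(\<lambda>r. Q t (T t r (h r))) integrable_on {t..}"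
    "norm (integral {t..} (\<lambda>r. Q t (T t r (h r)))) \<le> \<Theta> R * N * \<nu> s powr (- \<epsilon>) * W t"
proof -
  have Qint: "(\<lambda>r. Q t (T t r (h r))) integrable_on {t..x}" if "t \<le> x" for x
  proof -
    have "(\<lambda>r. T t r (h r)) integrable_on {t..x}"
      using T_integral(1)[of t s "{t..x}" h] int[of x] s that
      by (auto intro: integrable_real_subinterval)
    then show ?thesis
      using integrable_linear[OF _ blinfun.bounded_linear_right, of _ _ "Q t"] by (fastforce simp: o_def)
  qed
  let ?M = "\<Theta> R * N * W t"
  have M: "0 \<le> ?M" using W s NR Theta_nonneg by (auto simp: weight_def)
  let ?k = "\<lambda>r. ?M * m s powr q * kern s r"
  have kint: "kern s integrable_on {t..}"
    using integral_Ici_split(2)[OF kern_integrable[OF s(1)] s(2)] .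
  have k_int: "?k integrable_on {t..}" using integrable_cmul[OF kint, of "?M * m s powr q"] by simp
  have le: "norm (Q t (T t r (h r))) \<le> ?k r" if r: "t \<le> r" for r
  proof -
    have r': "0 \<le> r" "s \<le> r" using r s by auto
    have "norm (Q t (T t r (h r))) \<le> D * \<nu> r powr \<epsilon> * norm (h r)"
      by (rule norm_Q_T_le) (use s r in auto)
    also have "\<dots> \<le> D * \<nu> r powr \<epsilon> * (c * N * W r * (R * m s * w s r) powr q)"
      using dom r D by (intro mult_left_mono) (auto simp: dominated_def)
    also have "\<dots> = W r * (\<Theta> R * N * m s powr q * kern s r)"
      unfolding dominated_eq[OF s(1) r'(2) NR(2)] by (simp add: mult_ac)
    \<comment> \<open>Backward integrals use the other half, that \<open>W\<close>
      decreases.\<close>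
    also have "\<dots> \<le> W t * (\<Theta> R * N * m s powr q * kern s r)"
      using W r s NR Theta_nonneg kern_nonneg by (intro mult_right_mono) (auto simp: weight_def)
    finally show ?thesis by (simp add: mult_ac)
  qed
  show Qi: "(\<lambda>r. Q t (T t r (h r))) integrable_on {t..}"
    by (rule integrable_on_Ici_dominated[OF Qint k_int le])
  have "norm (integral {t..} (\<lambda>r. Q t (T t r (h r)))) \<le> integral {t..} ?k"
    by (rule integral_norm_bound_integral[OF Qi k_int]) (use le in auto)
  also have "\<dots> = ?M * m s powr q * integral {t..} (kern s)" by simp
  also have "\<dots> \<le> ?M * \<nu> s powr (- \<epsilon>)" by (rule integral_kern_le[OF s(1) _ kint M]) (use s in auto)
  finally show "norm (integral {t..} (\<lambda>r. Q t (T t r (h r)))) \<le> \<Theta> R * N * \<nu> s powr (- \<epsilon>) * W t"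
    by (simp add: mult_ac)
qed

text \<open>Guards \<open>LP\<close> against the default value 0 of integrals that do not exist.
  Conditions at time \<open>s\<close> are enough, as \<open>T t s\<close> carries them to later
  times.\<close>

definition admissible :: "real \<Rightarrow> (real \<Rightarrow> 'a) \<Rightarrow> bool" where
  "admissible s h \<longleftrightarrow> (\<forall>x\<ge>s. (\<lambda>r. T s r (h r)) integrable_on {s..x}) \<and>
     (\<lambda>r. Q s (T s r (h r))) integrable_on {s..}"

text \<open>Everything is pulled back to time \<open>s\<close>, so that \<open>LP\<close> visibly
  has the form of a mild solution with initial value \<open>\<xi>\<close> minus the unstable
  integral; \<open>LP_split\<close> recovers the usual form. Taking a forcing \<open>h\<close>
  instead of a curve keeps it linear.\<close>

definition LP :: "real \<Rightarrow> 'a \<Rightarrow> (real \<Rightarrow> 'a) \<Rightarrow> real \<Rightarrow> 'a" where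
  "LP s \<xi> h t = T t s (\<xi> - integral {s..} (\<lambda>r. Q s (T s r (h r))) + integral {s..t} (\<lambda>r. T s r (h r)))"

lemma dominated_admissible:
  assumes "0 \<le> s" "weight s W" "0 \<le> N" "0 \<le> R" "\<And>x. s \<le> x \<Longrightarrow> (\<lambda>r. T s r (h r)) integrable_on {s..x}"
    "dominated s W N R {s..} h"
  shows "admissible s h"
  using Q_T_integral_bound(1)[OF assms(1) order_refl assms(2-6)] assms(5) by (simp add: admissible_def)

section \<open>Algebra of the Lyapunov-Perron operator\<close>

lemma LP_diff:
  assumes "admissible s h" "admissible s h'" "s \<le> t"
  shows "LP s \<xi> h t - LP s \<xi>' h' t = LP s (\<xi> - \<xi>') (\<lambda>r. h r - h' r) t"
proof -
  have "integral {s..} (\<lambda>r. Q s (T s r (h r - h' r))) =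
      integral {s..} (\<lambda>r. Q s (T s r (h r))) - integral {s..} (\<lambda>r. Q s (T s r (h' r)))"
    using Henstock_Kurzweil_Integration.integral_diff[of "\<lambda>r. Q s (T s r (h r))" "{s..}" "\<lambda>r. Q s (T s r (h' r))"] assms
    by (simp add: admissible_def blinfun.diff_right)
  moreover have "integral {s..t} (\<lambda>r. T s r (h r - h' r)) =
      integral {s..t} (\<lambda>r. T s r (h r)) - integral {s..t} (\<lambda>r. T s r (h' r))"
    using Henstock_Kurzweil_Integration.integral_diff[of "\<lambda>r. T s r (h r)" "{s..t}" "\<lambda>r. T s r (h' r)"] assms
    by (simp add: admissible_def blinfun.diff_right)
  ultimately have "LP s (\<xi> - \<xi>') (\<lambda>r. h r - h' r) t = T t s ((\<xi> - \<xi>')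
      - (integral {s..} (\<lambda>r. Q s (T s r (h r))) - integral {s..} (\<lambda>r. Q s (T s r (h' r))))
      + (integral {s..t} (\<lambda>r. T s r (h r)) - integral {s..t} (\<lambda>r. T s r (h' r))))"
    by (simp only: LP_def)
  then show ?thesis
    by (simp only: LP_def blinfun.diff_right[of "T t s", symmetric]) (simp add: algebra_simps)
qed

text \<open>Moved to time \<open>t\<close>, the unstable integral over \<open>{s..}\<close> splits
  at \<open>t\<close>; its part over \<open>{s..t}\<close> cancels the unstable part of the forward
  integral.\<close>

lemma LP_split:
  assumes s: "0 \<le> s" "s \<le> t" and adm: "admissible s h"
  shows "LP s \<xi> h t = T t s \<xi> + integral {s..t} (\<lambda>r. P t (T t r (h r))) - integral {t..} (\<lambda>r. Q t (T t r (h r)))"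
proof -
  have t: "0 \<le> t" using s by simp
  have Ts: "(\<lambda>r. T s r (h r)) integrable_on {s..t}" and Qs: "(\<lambda>r. Q s (T s r (h r))) integrable_on {s..}"
    using adm s by (auto simp: admissible_def)
  note TT = T_integral[OF t s(1) _ Ts]
  have eq: "T t s (Q s (T s r (h r))) = Q t (T t r (h r))" if "s \<le> r" for r
    using that s by (simp add: Q_T[symmetric] T_cocycle)
  have TQ: "(\<lambda>r. T t s (Q s (T s r (h r)))) integrable_on {s..}"
    "T t s (integral {s..} (\<lambda>r. Q s (T s r (h r)))) = integral {s..} (\<lambda>r. T t s (Q s (T s r (h r))))"
    using integrable_linear[OF Qs blinfun.bounded_linear_right, of "T t s"]
      integral_linear[OF Qs blinfun.bounded_linear_right, of "T t s"] by (simp_all add: o_def)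
  have Qt: "(\<lambda>r. Q t (T t r (h r))) integrable_on {s..}"
    by (rule integrable_eq[OF TQ(1)]) (simp add: eq)
  have "T t s (integral {s..} (\<lambda>r. Q s (T s r (h r)))) = integral {s..} (\<lambda>r. Q t (T t r (h r)))"
    unfolding TQ(2) by (rule integral_cong) (simp add: eq)
  also have "\<dots> = integral {s..t} (\<lambda>r. Q t (T t r (h r))) + integral {t..} (\<lambda>r. Q t (T t r (h r)))"
    by (rule integral_Ici_split(3)[OF Qt s(2)])
  finally have J: "T t s (integral {s..} (\<lambda>r. Q s (T s r (h r)))) =
    integral {s..t} (\<lambda>r. Q t (T t r (h r))) + integral {t..} (\<lambda>r. Q t (T t r (h r)))" .
  have Tt: "(\<lambda>r. T t r (h r)) integrable_on {s..t}" using TT(1) s by auto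
  have "integral {s..t} (\<lambda>r. P t (T t r (h r))) = integral {s..t} (\<lambda>r. T t r (h r) - Q t (T t r (h r)))"
    by (simp add: Q_apply)
  also have "\<dots> = integral {s..t} (\<lambda>r. T t r (h r)) - integral {s..t} (\<lambda>r. Q t (T t r (h r)))"
    by (rule Henstock_Kurzweil_Integration.integral_diff[OF Tt integral_Ici_split(1)[OF Qt s(2)]])
  finally show ?thesis using J TT(2) s by (simp add: LP_def blinfun.diff_right blinfun.add_right)
qed

lemma admissible_P_integrable:
  assumes s: "0 \<le> s" "s \<le> t" and adm: "admissible s h"
  shows "(\<lambda>r. P t (T t r (h r))) integrable_on {s..t}" "admissible t h"
proof -
  have Ts: "(\<lambda>r. T s r (h r)) integrable_on {s..x}" if "s \<le> x" for x
    using adm that by (auto simp: admissible_def)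
  have Tt: "(\<lambda>r. T t r (h r)) integrable_on {s..x}" if "s \<le> x" for x
    using T_integral(1)[of t s "{s..x}" h] Ts[OF that] s by auto
  show "(\<lambda>r. P t (T t r (h r))) integrable_on {s..t}"
    using integrable_linear[OF Tt[OF s(2)] blinfun.bounded_linear_right, of "P t"] by (simp add: o_def)
  have "(\<lambda>r. T t s (Q s (T s r (h r)))) integrable_on {s..}"
    using adm integrable_linear[OF _ blinfun.bounded_linear_right, of "\<lambda>r. Q s (T s r (h r))" "{s..}" "T t s"]
    by (simp add: admissible_def o_def)
  then have "(\<lambda>r. Q t (T t r (h r))) integrable_on {s..}"
    by (rule integrable_eq) (use s in \<open>simp add: Q_T[symmetric] T_cocycle\<close>)
  then have "(\<lambda>r. Q t (T t r (h r))) integrable_on {t..}" using s(2) by (rule integral_Ici_split(2))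
  moreover have "(\<lambda>r. T t r (h r)) integrable_on {t..x}" if "t \<le> x" for x
    using s(2) that by (auto intro: integrable_real_subinterval[OF Tt[of x]])
  ultimately show "admissible t h" by (simp add: admissible_def)
qed

lemma P_LP:
  assumes s: "0 \<le> s" "s \<le> t" and adm: "admissible s h" and \<xi>: "P s \<xi> = \<xi>"
  shows "P t (LP s \<xi> h t) = T t s \<xi> + integral {s..t} (\<lambda>r. P t (T t r (h r)))"
    "Q t (LP s \<xi> h t) = - integral {t..} (\<lambda>r. Q t (T t r (h r)))"
proof -
  have t: "0 \<le> t" using s by simp
  have Pi: "(\<lambda>r. P t (T t r (h r))) integrable_on {s..t}" by (rule admissible_P_integrable(1)[OF s adm])
  have Qi: "(\<lambda>r. Q t (T t r (h r))) integrable_on {t..}"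
    using admissible_P_integrable(2)[OF s adm] by (simp add: admissible_def)
  have "P t (integral {s..t} (\<lambda>r. P t (T t r (h r)))) = integral {s..t} (\<lambda>r. P t (T t r (h r)))"
    using integral_linear[OF Pi blinfun.bounded_linear_right, of "P t"] t by (simp add: o_def P_idem)
  moreover have "P t (integral {t..} (\<lambda>r. Q t (T t r (h r)))) = 0"
    using integral_linear[OF Qi blinfun.bounded_linear_right, of "P t"] t by (simp add: o_def P_Q)
  moreover have "P t (T t s \<xi>) = T t s \<xi>" using P_T[of s t \<xi>] s t \<xi> by simp
  ultimately show *: "P t (LP s \<xi> h t) = T t s \<xi> + integral {s..t} (\<lambda>r. P t (T t r (h r)))"
    unfolding LP_split[OF s adm] by (simp add: blinfun.diff_right blinfun.add_right)
  show "Q t (LP s \<xi> h t) = - integral {t..} (\<lambda>r. Q t (T t r (h r)))"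
    unfolding Q_apply * unfolding LP_split[OF s adm] by (simp add: Q_apply)
qed

text \<open>The unstable component at \<open>t\<close> is minus the tail integral over
  \<open>{t..}\<close>, so subtracting that integral from the stable component restores the full
  value at \<open>t\<close>; the cocycle property then merges the forward integrals. This is the
  source of invariance.\<close>

lemma LP_shift:
  assumes s: "0 \<le> s" "s \<le> t" "t \<le> r" and adm: "admissible s h" and \<xi>: "P s \<xi> = \<xi>"
  shows "LP s \<xi> h r = LP t (P t (LP s \<xi> h t)) h r"
proof -
  have Ts: "(\<lambda>x. T s x (h x)) integrable_on {s..r}" using adm s by (auto simp: admissible_def)
  have "P t (LP s \<xi> h t) = LP s \<xi> h t - Q t (LP s \<xi> h t)" by (simp add: Q_apply)
  then have "LP t (P t (LP s \<xi> h t)) h r =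
      T r t (LP s \<xi> h t + integral {t..r} (\<lambda>x. T t x (h x)))"
    unfolding LP_def[of t] P_LP(2)[OF s(1,2) adm \<xi>] by simp
  also have "\<dots> = T r s (\<xi> - integral {s..} (\<lambda>r. Q s (T s r (h r))) + integral {s..t} (\<lambda>r. T s r (h r)))
      + T r t (integral {t..r} (\<lambda>x. T t x (h x)))"
    unfolding LP_def using s by (simp add: blinfun.add_right T_cocycle)
  also have "integral {t..r} (\<lambda>x. T t x (h x)) = T t s (integral {t..r} (\<lambda>x. T s x (h x)))"
    using T_integral(2)[of t s "{t..r}" h] integrable_real_subinterval[OF Ts, of t r] s by auto
  also have "T r t (T t s (integral {t..r} (\<lambda>x. T s x (h x)))) = T r s (integral {t..r} (\<lambda>x. T s x (h x)))"
    using s by (simp add: T_cocycle)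
  also have "T r s (\<xi> - integral {s..} (\<lambda>r. Q s (T s r (h r))) + integral {s..t} (\<lambda>r. T s r (h r)))
      + T r s (integral {t..r} (\<lambda>x. T s x (h x))) = LP s \<xi> h r"
    using Henstock_Kurzweil_Integration.integral_combine[where a=s and c=t and b=r, OF s(2,3) Ts]
    by (simp add: LP_def blinfun.add_right[symmetric] add.assoc)
  finally show ?thesis by simp
qed

lemma LP_bound:
  assumes s: "0 \<le> s" "s \<le> t" and W: "weight s W" and NR: "0 \<le> N" "0 \<le> R"
    and int: "\<And>x. s \<le> x \<Longrightarrow> (\<lambda>r. T s r (h r)) integrable_on {s..x}" and dom: "dominated s W N R {s..} h"
  shows "norm (LP s \<xi> h t - T t s \<xi>) \<le> 2 * \<Theta> R * N * \<nu> s powr (- \<epsilon>) * W t"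
proof -
  have adm: "admissible s h" by (rule dominated_admissible[OF s(1) W NR int dom])
  have "norm (integral {s..t} (\<lambda>r. P t (T t r (h r)))) \<le> \<Theta> R * N * \<nu> s powr (- \<epsilon>) * W t"
    by (rule P_T_integral_bound[OF s order_refl W NR int[OF s(2)]])
       (use dom in \<open>auto simp: dominated_def\<close>)
  moreover have "norm (integral {t..} (\<lambda>r. Q t (T t r (h r)))) \<le> \<Theta> R * N * \<nu> s powr (- \<epsilon>) * W t"
    by (rule Q_T_integral_bound(2)[OF s W NR int]) (use dom s in \<open>auto simp: dominated_def\<close>)
  moreover have "LP s \<xi> h t - T t s \<xi> =
      integral {s..t} (\<lambda>r. P t (T t r (h r))) - integral {t..} (\<lambda>r. Q t (T t r (h r)))"
    unfolding LP_split[OF s adm] by simp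
  ultimately show ?thesis
    using norm_triangle_ineq4[of "integral {s..t} (\<lambda>r. P t (T t r (h r)))" "integral {t..} (\<lambda>r. Q t (T t r (h r)))"]
    by simp
qed

lemma norm_T_P:
  assumes "0 \<le> s" "s \<le> t" "P s \<xi> = \<xi>"
  shows "norm (T t s \<xi>) \<le> D * \<nu> s powr \<epsilon> * norm \<xi> * w s t"
  using norm_P_T[OF assms(1,2), of \<xi>] P_T[of s t \<xi>] assms by (simp add: mult_ac)

end

section \<open>Orbits and the invariant graph\<close>

text \<open>The best bound \<open>N\<close> satisfies \<open>N \<le> A + \<theta> * N\<close>, and
  \<open>\<theta> * N\<close> can be absorbed. The a priori bound \<open>K\<close> makes the
  supremum finite but does not enter the result.\<close>

lemma le_of_self_improving_bound:
  fixes g :: "'b \<Rightarrow> real"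
  assumes g: "\<And>t. t \<in> S \<Longrightarrow> 0 \<le> g t" "\<And>t. t \<in> S \<Longrightarrow> g t \<le> K" and \<theta>: "\<theta> < 1" and t: "t \<in> S"
    and improve: "\<And>N t. 0 \<le> N \<Longrightarrow> (\<And>r. r \<in> S \<Longrightarrow> g r \<le> N) \<Longrightarrow> t \<in> S \<Longrightarrow> g t \<le> A + \<theta> * N"
  shows "g t \<le> A / (1 - \<theta>)"
proof -
  define N where "N = (SUP r\<in>S. g r)"
  have bdd: "bdd_above (g ` S)" by (rule bdd_aboveI2[OF g(2)])
  have le: "g r \<le> N" if "r \<in> S" for r unfolding N_def by (rule cSUP_upper[OF that bdd])
  have "0 \<le> N" using g(1)[OF t] le[OF t] by simp
  have "N \<le> A + \<theta> * N"
    unfolding N_def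
  proof (rule cSUP_least)
    show "S \<noteq> {}" using t by auto
    show "g r \<le> A + \<theta> * (SUP r\<in>S. g r)" if "r \<in> S" for r
      using improve[OF \<open>0 \<le> N\<close> le that] by (simp add: N_def)
  qed
  then have "N * (1 - \<theta>) \<le> A" by (simp add: algebra_simps)
  then have "N \<le> A / (1 - \<theta>)" using \<theta> by (simp add: pos_le_divide_eq)
  then show ?thesis using le[OF t] by simp
qed

text \<open>The argument \<open>4 * C * \<delta>\<close> is twice the bound
  \<open>2 * C * \<delta>\<close> of \<open>orbit_class\<close>, since sums of two norms occur. The
  first condition in \<open>small\<close> absorbs the nonlinear terms into the gap between
  \<open>D\<close> and \<open>C\<close>, e.g. \<open>D \<le> C * (1 - 2 * \<theta>)\<close>; the
  second gives the contraction and the slope at most 1 of the graph.\<close>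

locale lyapunov_perron = dichotomy_equation A T f c q P \<mu> \<nu> D a b \<epsilon>
  for A :: "real \<Rightarrow> 'a::banach \<Rightarrow>\<^sub>L 'a" and T f c q P \<mu> \<nu> D a b \<epsilon> +
  fixes C \<delta> :: real
  assumes lim: "((\<lambda>t. \<mu> t powr (a - b) * \<nu> t powr \<epsilon>) \<longlongrightarrow> 0) at_top"
    and beta_dec: "antimono_on {0..} (beta \<mu> \<nu> a \<epsilon> q)"
    and quot_dec: "antimono_on {0..} (\<lambda>t. \<mu> t powr a * inverse (beta \<mu> \<nu> a \<epsilon> q t))"
    and C: "C > D" and \<delta>: "0 < \<delta>"
    and small: "4 * C * \<Theta> (4 * C * \<delta>) \<le> C - D" "4 * C * \<Theta> (4 * C * \<delta>) \<le> 1"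
begin

abbreviation \<theta> where "\<theta> \<equiv> \<Theta> (4 * C * \<delta>)"

lemma C_ge_1: "1 \<le> C" using C D by simp

lemma theta_nonneg: "0 \<le> \<theta>" by (rule Theta_nonneg)

lemma beta_antimono: "0 \<le> s \<Longrightarrow> s \<le> t \<Longrightarrow> \<beta> t \<le> \<beta> s"
  using beta_dec by (auto simp: monotone_on_def)

text \<open>The monotonicity of \<open>\<mu> t powr a / \<beta> t\<close> in usable form: the radius
  shrinks no faster than orbits decay.\<close>

lemma beta_w_le:
  assumes "0 \<le> s" "s \<le> t"
  shows "\<beta> s * w s t \<le> \<beta> t"
proof -
  have "\<mu> t powr a * inverse (\<beta> t) \<le> \<mu> s powr a * inverse (\<beta> s)"
    using quot_dec assms by (auto simp: monotone_on_def)
  then have "\<beta> s * \<mu> t powr a \<le> \<beta> t * \<mu> s powr a"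
    using beta_pos[of s] beta_pos[of t] assms by (simp add: divide_simps mult_ac)
  then show ?thesis
    using mu_ge_1[of s] mu_ge_1[of t] assms by (simp add: w_def powr_divide pos_divide_le_eq)
qed

lemma nu_powr_le_1: "0 \<le> s \<Longrightarrow> \<nu> s powr (- \<epsilon>) \<le> 1"
  using nu_ge_1[of s] \<epsilon> powr_mono2'[of "- \<epsilon>" 1 "\<nu> s"] by simp

lemma nu_powr_cancel: "0 \<le> s \<Longrightarrow> \<nu> s powr \<epsilon> * \<nu> s powr (- \<epsilon>) = 1"
  using nu_ge_1[of s] by (simp add: powr_add[symmetric])

text \<open>The factor \<open>2 * C\<close> leaves room for the operator to map the class into
  itself and for orbits restarted at later times or issuing from another invariant graph to belong
  to it.\<close>

definition orbit_class :: "real \<Rightarrow> (real \<Rightarrow> 'a) \<Rightarrow> bool" where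
  "orbit_class s u \<longleftrightarrow> continuous_on {s..} u \<and> (\<forall>t\<ge>s. norm (u t) \<le> 2 * C * \<delta> * m s * w s t)"

definition LP_orbit :: "real \<Rightarrow> 'a \<Rightarrow> (real \<Rightarrow> 'a) \<Rightarrow> bool" where
  "LP_orbit s \<xi> u \<longleftrightarrow> orbit_class s u \<and> (\<forall>t\<ge>s. u t = LP s \<xi> (\<lambda>r. f r (u r)) t)"

lemma LP_orbitD: "LP_orbit s \<xi> u \<Longrightarrow> s \<le> t \<Longrightarrow> u t = LP s \<xi> (\<lambda>r. f r (u r)) t"
  by (simp add: LP_orbit_def)

lemma orbit_class_continuous: "orbit_class s u \<Longrightarrow> continuous_on {s..t} u"
  by (auto simp: orbit_class_def intro: continuous_on_subset)

lemma orbit_class_zero: "0 \<le> s \<Longrightarrow> orbit_class s (\<lambda>_. 0)"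
  using C_ge_1 \<delta> m_pos w_pos by (auto simp: orbit_class_def intro!: mult_nonneg_nonneg less_imp_le)

lemma orbit_class_integrable:
  "0 \<le> s \<Longrightarrow> orbit_class s u \<Longrightarrow> (\<lambda>r. T s r (f r (u r))) integrable_on {s..x}"
  by (rule T_f_integrable) (auto intro: orbit_class_continuous)

lemma dominated_diff:
  assumes s: "0 \<le> s" and u: "orbit_class s u" "orbit_class s v" and S: "S \<subseteq> {s..}"
    and N: "\<And>r. r \<in> S \<Longrightarrow> norm (u r - v r) \<le> N * W r"
  shows "dominated s W N (4 * C * \<delta>) S (\<lambda>r. f r (u r) - f r (v r))"
  unfolding dominated_def
proof
  fix r assume r: "r \<in> S"
  have "norm (f r (u r) - f r (v r)) \<le> c * (N * W r) * (4 * C * \<delta> * m s * w s r) powr q"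
  proof (rule f_lip_le[OF _ N[OF r]])
    have "norm (u r) \<le> 2 * C * \<delta> * m s * w s r" "norm (v r) \<le> 2 * C * \<delta> * m s * w s r"
      using u r S by (auto simp: orbit_class_def)
    then show "norm (u r) + norm (v r) \<le> 4 * C * \<delta> * m s * w s r" by simp
  qed (use s r S in auto)
  then show "norm (f r (u r) - f r (v r)) \<le> c * N * W r * (4 * C * \<delta> * m s * w s r) powr q"
    by (simp add: mult_ac)
qed

lemma dominated_single:
  assumes s: "0 \<le> s" and u: "orbit_class s u" and S: "S \<subseteq> {s..}"
    and N: "\<And>r. r \<in> S \<Longrightarrow> norm (u r) \<le> N * W r"
  shows "dominated s W N (4 * C * \<delta>) S (\<lambda>r. f r (u r))"
proof -
  have "dominated s W N (4 * C * \<delta>) S (\<lambda>r. f r (u r) - f r 0)"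
    by (rule dominated_diff[OF s u orbit_class_zero[OF s] S]) (use N in simp)
  moreover have "f r 0 = 0" if "r \<in> S" for r using that s S by (intro f_zero) auto
  ultimately show ?thesis by (simp add: dominated_def)
qed

lemma orbit_class_admissible:
  assumes s: "0 \<le> s" and u: "orbit_class s u"
  shows "admissible s (\<lambda>r. f r (u r))"
proof (rule dominated_admissible[OF s weight_w[OF s]])
  show "dominated s (w s) (2 * C * \<delta> * m s) (4 * C * \<delta>) {s..} (\<lambda>r. f r (u r))"
    by (rule dominated_single[OF s u]) (use u in \<open>auto simp: orbit_class_def\<close>)
qed (use s C_ge_1 \<delta> m_pos[OF s] orbit_class_integrable[OF s u] in auto)

text \<open>One estimate with three uses: self-mapping (\<open>v = 0\<close>,
  \<open>W = w s\<close>), contraction (\<open>\<xi> = \<xi>'\<close>, \<open>W = 1\<close>) and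
  dependence of orbits on \<open>\<xi>\<close> (\<open>W = w s\<close>).\<close>

lemma LP_Lipschitz:
  assumes s: "0 \<le> s" "s \<le> t" and u: "orbit_class s u" "orbit_class s v" and W: "weight s W" and N: "0 \<le> N"
    and uv: "\<And>r. s \<le> r \<Longrightarrow> norm (u r - v r) \<le> N * W r"
  shows "norm (LP s \<xi> (\<lambda>r. f r (u r)) t - LP s \<xi>' (\<lambda>r. f r (v r)) t)
    \<le> norm (T t s (\<xi> - \<xi>')) + 2 * \<theta> * N * W t"
proof -
  let ?h = "\<lambda>r. f r (u r) - f r (v r)"
  have int: "(\<lambda>r. T s r (?h r)) integrable_on {s..x}" for x
    using integrable_diff[OF orbit_class_integrable[OF s(1) u(1)] orbit_class_integrable[OF s(1) u(2)], of x]
    by (simp add: blinfun.diff_right)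
  have dom: "dominated s W N (4 * C * \<delta>) {s..} ?h"
    by (rule dominated_diff[OF s(1) u]) (use uv in auto)
  have "norm (LP s (\<xi> - \<xi>') ?h t - T t s (\<xi> - \<xi>')) \<le> 2 * \<theta> * N * \<nu> s powr (- \<epsilon>) * W t"
    by (rule LP_bound[OF s W N _ int dom]) (use C_ge_1 \<delta> in auto)
  also have "\<dots> \<le> 2 * \<theta> * N * 1 * W t"
    using nu_powr_le_1[OF s(1)] theta_nonneg N W s(2)
    by (intro mult_right_mono mult_left_mono) (auto simp: weight_def)
  finally have "norm (LP s (\<xi> - \<xi>') ?h t - T t s (\<xi> - \<xi>')) \<le> 2 * \<theta> * N * W t" by simp
  moreover have "LP s \<xi> (\<lambda>r. f r (u r)) t - LP s \<xi>' (\<lambda>r. f r (v r)) t = LP s (\<xi> - \<xi>') ?h t"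
    by (rule LP_diff[OF orbit_class_admissible[OF s(1) u(1)] orbit_class_admissible[OF s(1) u(2)] s(2)])
  ultimately show ?thesis
    using norm_triangle_sub[of "LP s (\<xi> - \<xi>') ?h t" "T t s (\<xi> - \<xi>')"] by simp
qed

lemma LP_zero:
  assumes "0 \<le> s"
  shows "LP s 0 (\<lambda>r. f r 0) t = 0"
proof -
  have "integral {s..} (\<lambda>r. Q s (T s r (f r 0))) = integral {s..} (\<lambda>r. 0)"
    by (rule integral_cong) (use assms in \<open>simp add: f_zero\<close>)
  moreover have "integral {s..t} (\<lambda>r. T s r (f r 0)) = integral {s..t} (\<lambda>r. 0)"
    by (rule integral_cong) (use assms in \<open>simp add: f_zero\<close>)
  ultimately show ?thesis by (simp add: LP_def)
qed

lemma LP_orbit_zero: "0 \<le> s \<Longrightarrow> LP_orbit s 0 (\<lambda>_. 0)"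
  by (simp add: LP_orbit_def orbit_class_zero LP_zero)

text \<open>The quotient by \<open>w s\<close> improves its own bound with rate
  \<open>2 * \<theta>\<close>, starting from the crude bound of \<open>orbit_class\<close>;
  smallness gives \<open>D / (1 - 2 * \<theta>) \<le> C\<close>.\<close>

lemma LP_orbit_Lipschitz:
  assumes s: "0 \<le> s" "s \<le> t" and u: "LP_orbit s \<xi> u" "LP_orbit s \<xi>' u'"
    and \<xi>: "P s \<xi> = \<xi>" "P s \<xi>' = \<xi>'"
  shows "norm (u t - u' t) \<le> C * \<nu> s powr \<epsilon> * norm (\<xi> - \<xi>') * w s t"
proof -
  have cls: "orbit_class s u" "orbit_class s u'" using u by (auto simp: LP_orbit_def)
  let ?A = "D * \<nu> s powr \<epsilon> * norm (\<xi> - \<xi>')"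
  have wp: "0 < w s r" if "s \<le> r" for r using w_pos[OF s(1) that] .
  have "2 * (\<theta> * C) * 2 \<le> C - D" using small(1) by (simp add: mult_ac)
  then have DC: "D \<le> C * (1 - 2 * \<theta>)" using mult_nonneg_nonneg[OF theta_nonneg, of C] C_ge_1
    by (simp add: algebra_simps)
  have th: "2 * \<theta> < 1"
  proof (rule ccontr)
    assume "\<not> 2 * \<theta> < 1"
    then have "C * (1 - 2 * \<theta>) \<le> 0" using C_ge_1 by (intro mult_nonneg_nonpos) auto
    then show False using DC D by simp
  qed
  have "norm (u t - u' t) / w s t \<le> ?A / (1 - 2 * \<theta>)"
  proof (rule le_of_self_improving_bound[where S = "{s..}" and g = "\<lambda>r. norm (u r - u' r) / w s r"
        and K = "4 * C * \<delta> * m s", OF _ _ th])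
    fix r assume r: "r \<in> {s..}"
    then show "0 \<le> norm (u r - u' r) / w s r" using wp[of r] by simp
    have "norm (u r - u' r) \<le> norm (u r) + norm (u' r)" by (rule norm_triangle_ineq4)
    also have "\<dots> \<le> 4 * C * \<delta> * m s * w s r"
      using cls r unfolding orbit_class_def by (auto dest!: spec[of _ r])
    finally show "norm (u r - u' r) / w s r \<le> 4 * C * \<delta> * m s"
      using wp[of r] r by (simp add: pos_divide_le_eq)
  next
    fix N t assume N: "0 \<le> N" "\<And>r. r \<in> {s..} \<Longrightarrow> norm (u r - u' r) / w s r \<le> N" and t: "t \<in> {s..}"
    have le: "norm (u r - u' r) \<le> N * w s r" if "s \<le> r" for r
      using N(2)[of r] wp[OF that] that by (simp add: pos_divide_le_eq)
    have "norm (u t - u' t) \<le> norm (T t s (\<xi> - \<xi>')) + 2 * \<theta> * N * w s t"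
      using LP_Lipschitz[OF s(1) _ cls weight_w[OF s(1)] N(1) le, of t \<xi> \<xi>'] t u
      by (simp add: LP_orbit_def)
    also have "\<dots> \<le> ?A * w s t + 2 * \<theta> * N * w s t"
      using norm_T_P[of s t "\<xi> - \<xi>'"] s(1) t \<xi> by (simp add: blinfun.diff_right)
    finally show "norm (u t - u' t) / w s t \<le> ?A + 2 * \<theta> * N"
      using wp[of t] t by (simp add: pos_divide_le_eq algebra_simps)
  qed (use s in auto)
  also have "?A / (1 - 2 * \<theta>) \<le> C * \<nu> s powr \<epsilon> * norm (\<xi> - \<xi>')"
  proof -
    have "?A \<le> (C * (1 - 2 * \<theta>)) * (\<nu> s powr \<epsilon> * norm (\<xi> - \<xi>'))"
      using mult_right_mono[OF DC, of "\<nu> s powr \<epsilon> * norm (\<xi> - \<xi>')"] by (simp add: mult_ac)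
    then show ?thesis using th by (simp add: pos_divide_le_eq mult_ac)
  qed
  finally show ?thesis using wp[OF s(2)] by (simp add: pos_divide_le_eq)
qed

lemma LP_orbit_unique:
  assumes "0 \<le> s" "s \<le> t" "LP_orbit s \<xi> u" "LP_orbit s \<xi> u'" "P s \<xi> = \<xi>"
  shows "u t = u' t"
  using LP_orbit_Lipschitz[OF assms(1-4) assms(5,5)] by simp

text \<open>The dichotomy bounds \<open>norm (P t)\<close> only by
  \<open>D * \<nu> t powr \<epsilon>\<close>, so the second bound cannot be deduced from the first.
  It is read off from the stable equation, where a single integral occurs and
  \<open>D + \<theta> * C \<le> C\<close>.\<close>

lemma LP_orbit_bounds:
  assumes s: "0 \<le> s" "s \<le> t" and u: "LP_orbit s \<xi> u" and \<xi>: "P s \<xi> = \<xi>"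
  shows "norm (u t) \<le> C * \<nu> s powr \<epsilon> * norm \<xi> * w s t"
    "norm (P t (u t)) \<le> C * \<nu> s powr \<epsilon> * norm \<xi> * w s t"
proof -
  have bound: "norm (u r) \<le> C * \<nu> s powr \<epsilon> * norm \<xi> * w s r" if "s \<le> r" for r
    using LP_orbit_Lipschitz[OF s(1) that u LP_orbit_zero[OF s(1)] \<xi>] by (simp add: blinfun.zero_right)
  show "norm (u t) \<le> C * \<nu> s powr \<epsilon> * norm \<xi> * w s t" by (rule bound[OF s(2)])
  have cls: "orbit_class s u" using u by (simp add: LP_orbit_def)
  let ?h = "\<lambda>r. f r (u r)" let ?N = "C * \<nu> s powr \<epsilon> * norm \<xi>"
  have N: "0 \<le> ?N" using C_ge_1 by simp
  have dom: "dominated s (w s) ?N (4 * C * \<delta>) {s..<t} ?h"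
    by (rule dominated_single[OF s(1) cls]) (use bound in auto)
  have "norm (integral {s..t} (\<lambda>r. P t (T t r (?h r)))) \<le> \<theta> * ?N * \<nu> s powr (- \<epsilon>) * w s t"
    by (rule P_T_integral_bound[OF s order_refl weight_w[OF s(1)] N _ orbit_class_integrable[OF s(1) cls] dom])
       (use C_ge_1 \<delta> in auto)
  also have "\<dots> \<le> \<theta> * ?N * 1 * w s t"
    using nu_powr_le_1[OF s(1)] theta_nonneg N w_pos[OF s] C_ge_1
    by (intro mult_right_mono mult_left_mono mult_nonneg_nonneg) auto
  finally have I: "norm (integral {s..t} (\<lambda>r. P t (T t r (?h r)))) \<le> \<theta> * ?N * w s t" by simp
  have "P t (u t) = P t (LP s \<xi> ?h t)" using LP_orbitD[OF u s(2)] by (rule arg_cong)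
  also have "\<dots> = T t s \<xi> + integral {s..t} (\<lambda>r. P t (T t r (?h r)))"
    by (rule P_LP(1)[OF s orbit_class_admissible[OF s(1) cls] \<xi>])
  finally have "norm (P t (u t)) \<le> D * \<nu> s powr \<epsilon> * norm \<xi> * w s t + \<theta> * ?N * w s t"
    using norm_triangle_ineq[of "T t s \<xi>" "integral {s..t} (\<lambda>r. P t (T t r (?h r)))"] I norm_T_P[OF s \<xi>]
    by simp
  also have "\<dots> = (D + \<theta> * C) * (\<nu> s powr \<epsilon> * norm \<xi> * w s t)" by (simp add: algebra_simps)
  also have "\<dots> \<le> C * (\<nu> s powr \<epsilon> * norm \<xi> * w s t)"
  proof (rule mult_right_mono)
    have "0 \<le> C * \<theta>" using C_ge_1 theta_nonneg by simp
    then show "D + \<theta> * C \<le> C" using small(1) by (simp add: mult_ac)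
  qed (use w_pos[OF s] in auto)
  finally show "norm (P t (u t)) \<le> C * \<nu> s powr \<epsilon> * norm \<xi> * w s t" by (simp add: mult_ac)
qed

section \<open>Existence of Lyapunov-Perron orbits\<close>

lemma LP_continuous:
  assumes s: "0 \<le> s" and adm: "admissible s h"
  shows "continuous_on {s..} (LP s \<xi> h)"
proof (rule continuous_on_Ici)
  fix t
  show "continuous_on {s..t} (LP s \<xi> h)"
  proof (cases "s \<le> t")
    case True
    have "(\<lambda>r. T s r (h r)) integrable_on {s..t}" using adm True by (auto simp: admissible_def)
    then have "continuous_on {s..t} (\<lambda>t. integral {s..t} (\<lambda>r. T s r (h r)))"
      by (rule indefinite_integral_continuous_1)
    moreover have "continuous_on {s..t} (\<lambda>t. T t s)"
      by (rule continuous_on_subset[OF T_continuous_left[OF s]]) (use s in auto)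
    ultimately show ?thesis unfolding LP_def[abs_def]
      by (intro blinfun.continuous_on continuous_intros)
  qed simp
qed

text \<open>The weighted bound defines the set \<open>S\<close>, whereas distances are measured in
  the plain supremum norm, in which the factor is again \<open>2 * \<theta>\<close>. Completeness is
  thus inherited from bounded continuous functions, and no weighted space has to be built.\<close>

lemma LP_orbit_exists:
  assumes s: "0 \<le> s" and \<xi>: "P s \<xi> = \<xi>" "norm \<xi> \<le> \<delta> * \<beta> s"
  shows "\<exists>u. LP_orbit s \<xi> u"
proof -
  define K where "K = 2 * C * \<delta> * m s"
  have K: "0 \<le> K" using C_ge_1 \<delta> m_pos[OF s] by (simp add: K_def)
  \<comment> \<open>These functions live on all of \<open>real\<close>. The \<open>max s t\<close>
    extends bound and image constantly to times before \<open>s\<close>, while \<open>LP\<close>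
    reads \<open>z\<close> only on \<open>{s..}\<close>.\<close>
  define S where "S = {z :: real \<Rightarrow>\<^sub>C 'a. \<forall>t. norm (z t) \<le> K * w s (max s t)}"
  have cls: "orbit_class s z" if "z \<in> S" for z
  proof -
    have "norm (z t) \<le> 2 * C * \<delta> * m s * w s t" if "s \<le> t" for t
      using \<open>z \<in> S\<close> that unfolding S_def K_def by (auto dest!: spec[of _ t] simp: max_absorb2)
    then show ?thesis by (simp add: orbit_class_def)
  qed
  have LP_in: "norm (LP s \<xi> (\<lambda>r. f r (z r)) t) \<le> K * w s t" if z: "z \<in> S" and t: "s \<le> t" for z t
  proof -
    have "norm (LP s \<xi> (\<lambda>r. f r (z r)) t - LP s 0 (\<lambda>r. f r 0) t) \<le> norm (T t s (\<xi> - 0)) + 2 * \<theta> * K * w s t"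
      by (rule LP_Lipschitz[OF s t cls[OF z] orbit_class_zero[OF s] weight_w[OF s] K])
         (use cls[OF z] in \<open>auto simp: orbit_class_def K_def\<close>)
    also have "norm (T t s (\<xi> - 0)) \<le> D * \<nu> s powr \<epsilon> * norm \<xi> * w s t"
      using norm_T_P[OF s t \<xi>(1)] by simp
    also have "\<dots> \<le> D * \<nu> s powr \<epsilon> * (\<delta> * \<beta> s) * w s t"
      using D \<xi>(2) w_pos[OF s t] by (intro mult_right_mono mult_left_mono) auto
    also have "D * \<nu> s powr \<epsilon> * (\<delta> * \<beta> s) * w s t + 2 * \<theta> * K * w s t = (D + 4 * C * \<theta>) * (\<delta> * m s * w s t)"
      by (simp add: K_def m_def algebra_simps)
    also have "\<dots> \<le> (2 * C) * (\<delta> * m s * w s t)"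
      using small(1) C_ge_1 \<delta> m_pos[OF s] w_pos[OF s t] by (intro mult_right_mono) auto
    finally show ?thesis by (simp add: LP_zero[OF s] K_def mult_ac)
  qed
  define F where "F z = Bcontfun (\<lambda>t. LP s \<xi> (\<lambda>r. f r (z r)) (max s t))" for z :: "real \<Rightarrow>\<^sub>C 'a"
  have F: "F z t = LP s \<xi> (\<lambda>r. f r (z r)) (max s t)" if z: "z \<in> S" for z t
  proof -
    have "(\<lambda>t. LP s \<xi> (\<lambda>r. f r (z r)) (max s t)) \<in> bcontfun"
      unfolding bcontfun_def
    proof (intro CollectI conjI)
      show "continuous_on UNIV (\<lambda>t. LP s \<xi> (\<lambda>r. f r (z r)) (max s t))"
        by (rule continuous_on_compose2[OF LP_continuous[OF s orbit_class_admissible[OF s cls[OF z]]]])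
           (auto intro!: continuous_intros)
      show "bounded (range (\<lambda>t. LP s \<xi> (\<lambda>r. f r (z r)) (max s t)))"
        unfolding bounded_iff
      proof (intro exI[of _ K] ballI, clarify)
        fix t
        have "norm (LP s \<xi> (\<lambda>r. f r (z r)) (max s t)) \<le> K * w s (max s t)" by (rule LP_in[OF z]) simp
        also have "\<dots> \<le> K * 1" using K w_le_1[OF s, of "max s t"] by (intro mult_left_mono) auto
        finally show "norm (LP s \<xi> (\<lambda>r. f r (z r)) (max s t)) \<le> K" by simp
      qed
    qed
    then show ?thesis by (simp add: F_def Bcontfun_inverse)
  qed
  have "\<exists>!z\<in>S. F z = z"
  proof (rule Banach_fix[where c = "2 * \<theta>"])
    show "complete S"
      unfolding complete_eq_closed closed_sequential_limits
    proof (intro allI impI, elim conjE)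
      fix z l assume z: "\<forall>n. z n \<in> S" and l: "z \<longlonglongrightarrow> l"
      have "norm (l t) \<le> K * w s (max s t)" for t
      proof (rule tendsto_upperbound)
        show "(\<lambda>n. norm (z n t)) \<longlonglongrightarrow> norm (l t)"
          by (intro tendsto_norm tendsto_uniform_limitI[OF tendsto_bcontfun_uniform_limit[OF l]]) simp
        show "\<forall>\<^sub>F n in sequentially. norm (z n t) \<le> K * w s (max s t)"
          using z by (auto simp: S_def)
      qed simp
      then show "l \<in> S" by (simp add: S_def)
    qed
    have "(const_bcontfun 0 :: real \<Rightarrow>\<^sub>C 'a) \<in> S"
      using K less_imp_le[OF w_pos[OF s]] by (simp add: S_def const_bcontfun.rep_eq)
    then show "S \<noteq> {}" by auto
    show "0 \<le> 2 * \<theta>" using theta_nonneg by simp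
    have "4 * \<theta> \<le> 4 * C * \<theta>" using C_ge_1 theta_nonneg by (simp add: mult_right_mono)
    then show "2 * \<theta> < 1" using small(2) by simp
    show "F ` S \<subseteq> S"
    proof (clarify)
      fix z assume z: "z \<in> S"
      show "F z \<in> S" unfolding S_def using LP_in[OF z] by (auto simp: F[OF z])
    qed
    fix z z' assume z: "z \<in> S" "z' \<in> S"
    show "dist (F z) (F z') \<le> 2 * \<theta> * dist z z'"
    proof (rule dist_bound)
      fix t
      have "norm (LP s \<xi> (\<lambda>r. f r (z r)) (max s t) - LP s \<xi> (\<lambda>r. f r (z' r)) (max s t))
          \<le> norm (T (max s t) s (\<xi> - \<xi>)) + 2 * \<theta> * dist z z' * 1"
        by (rule LP_Lipschitz[OF s _ cls[OF z(1)] cls[OF z(2)] weight_const[OF s]])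
           (auto simp: dist_norm[symmetric] dist_bounded)
      then show "dist (F z t) (F z' t) \<le> 2 * \<theta> * dist z z'"
        unfolding F[OF z(1)] F[OF z(2)] by (simp add: dist_norm)
    qed
  qed
  then obtain z where z: "z \<in> S" "F z = z" by blast
  have "z t = LP s \<xi> (\<lambda>r. f r (z r)) t" if "s \<le> t" for t
    using F[OF z(1), of t] z(2) that by (simp add: max_def)
  then show ?thesis using cls[OF z(1)] by (auto simp: LP_orbit_def)
qed

section \<open>The graph and its invariance\<close>

definition U :: "real \<Rightarrow> 'a \<Rightarrow> real \<Rightarrow> 'a" where "U s \<xi> = (SOME u. LP_orbit s \<xi> u)"

text \<open>The choice in \<open>U\<close> is immaterial where it matters: for
  \<open>\<xi> \<in> ball s\<close> uniqueness fixes \<open>U s \<xi>\<close> on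
  \<open>{s..}\<close>.\<close>

definition \<phi> :: "real \<times> 'a \<Rightarrow> 'a" where "\<phi> p = (case p of (s, \<xi>) \<Rightarrow> Q s (U s \<xi> s))"

abbreviation ball where "ball \<equiv> B_ball P \<delta> \<beta>"
abbreviation small_ball where "small_ball \<equiv> B_ball P (\<delta> / C) (beta_tilde \<mu> \<nu> a \<epsilon> q)"

lemma ballD:
  assumes "0 \<le> s" "\<xi> \<in> ball s"
  shows "P s \<xi> = \<xi>" "norm \<xi> < \<delta> * \<beta> s"
  using assms by (auto simp: B_ball_def P_idem)

text \<open>The factor \<open>\<nu> s powr (- \<epsilon>) / C\<close> between the two radii is the
  inverse of the growth factor in \<open>LP_orbit_bounds\<close>.\<close>

lemma small_ballD:
  assumes s: "0 \<le> s" and \<xi>: "\<xi> \<in> small_ball s"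
  shows "C * \<nu> s powr \<epsilon> * norm \<xi> < \<delta> * \<beta> s" "\<xi> \<in> ball s"
proof -
  have C0: "0 < C" using C_ge_1 by simp
  have n: "norm \<xi> < \<delta> / C * (\<beta> s * \<nu> s powr (- \<epsilon>))"
    using \<xi> by (simp add: B_ball_def beta_tilde_def)
  have "C * \<nu> s powr \<epsilon> * norm \<xi> < C * \<nu> s powr \<epsilon> * (\<delta> / C * (\<beta> s * \<nu> s powr (- \<epsilon>)))"
    using n C0 nu_ge_1[OF s] by (intro mult_strict_left_mono) auto
  also have "\<dots> = \<delta> * \<beta> s * (\<nu> s powr \<epsilon> * \<nu> s powr (- \<epsilon>))" using C0 by (simp add: field_simps)
  finally show 1: "C * \<nu> s powr \<epsilon> * norm \<xi> < \<delta> * \<beta> s" by (simp add: nu_powr_cancel[OF s])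
  have "1 * 1 \<le> C * \<nu> s powr \<epsilon>"
    using C_ge_1 nu_ge_1[OF s] \<epsilon> by (intro mult_mono ge_one_powr_ge_zero) auto
  then have "1 * norm \<xi> \<le> C * \<nu> s powr \<epsilon> * norm \<xi>" by (intro mult_right_mono) auto
  then show "\<xi> \<in> ball s" using 1 \<xi> by (auto simp: B_ball_def)
qed

lemma LP_orbit_U:
  assumes "0 \<le> s" "\<xi> \<in> ball s"
  shows "LP_orbit s \<xi> (U s \<xi>)"
  unfolding U_def by (rule someI_ex[OF LP_orbit_exists]) (use assms ballD[OF assms] in auto)

lemma zero_in_ball: "0 \<le> s \<Longrightarrow> 0 \<in> ball s"
  using beta_pos[of s] \<delta> by (auto simp: B_ball_def intro!: range_eqI[of _ _ 0])

lemma LP_orbit_start: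
  assumes s: "0 \<le> s" and u: "LP_orbit s \<xi> u" and \<xi>: "P s \<xi> = \<xi>"
  shows "\<xi> + Q s (u s) = u s" "Q s (u s) = - integral {s..} (\<lambda>r. Q s (T s r (f r (u r))))"
    "u s = \<xi> - integral {s..} (\<lambda>r. Q s (T s r (f r (u r))))"
proof -
  have cls: "orbit_class s u" using u by (simp add: LP_orbit_def)
  have us: "u s = LP s \<xi> (\<lambda>r. f r (u r)) s" by (rule LP_orbitD[OF u order_refl])
  note adm = orbit_class_admissible[OF s cls]
  have "P s (u s) = \<xi>" using P_LP(1)[OF s order_refl adm \<xi>] us s by (simp add: T_self)
  then show 1: "\<xi> + Q s (u s) = u s" by (simp add: Q_apply)
  show 2: "Q s (u s) = - integral {s..} (\<lambda>r. Q s (T s r (f r (u r))))"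
    using P_LP(2)[OF s order_refl adm \<xi>] us by simp
  show "u s = \<xi> - integral {s..} (\<lambda>r. Q s (T s r (f r (u r))))" using 1 2 by simp
qed

lemma LP_orbit_sol:
  assumes s: "0 \<le> s" and u: "LP_orbit s \<xi> u" and \<xi>: "P s \<xi> = \<xi>" and t: "s \<le> t"
  shows "sol_defined (perturbed_rhs A f) s (\<xi> + Q s (u s)) t"
    "sol (perturbed_rhs A f) s (\<xi> + Q s (u s)) t = u t"
proof -
  have mild: "u t = T t s (\<xi> + Q s (u s) + integral {s..t} (\<lambda>r. T s r (f r (u r))))" if "s \<le> t" for t
    using u that unfolding LP_orbit_start(2)[OF s u \<xi>] by (simp add: LP_orbit_def LP_def)
  have cu: "continuous_on {s..} u" using u by (simp add: LP_orbit_def orbit_class_def)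
  show "sol_defined (perturbed_rhs A f) s (\<xi> + Q s (u s)) t"
    by (rule mild_solution_is_sol(1)[OF s cu _ t]) (rule mild)
  show "sol (perturbed_rhs A f) s (\<xi> + Q s (u s)) t = u t"
    by (rule mild_solution_is_sol(2)[OF s cu _ t]) (rule mild)
qed

text \<open>\<open>\<phi> (s, \<xi>)\<close> is minus the unstable integral. In a difference,
  \<open>C * \<nu> s powr \<epsilon>\<close> from the orbits meets
  \<open>\<theta> * \<nu> s powr (- \<epsilon>)\<close> from the integral, so the slope is at most
  \<open>C * \<theta> \<le> 1\<close>.\<close>

lemma phi_X_space: "\<phi> \<in> X_space P \<delta> \<beta>"
  unfolding X_space_def
proof (intro CollectI allI impI)
  fix s \<xi> \<xi>' assume "(s, \<xi>) \<in> G_dom P \<delta> \<beta> \<and> (s, \<xi>') \<in> G_dom P \<delta> \<beta>"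
  then have s: "0 \<le> s" and \<xi>: "\<xi> \<in> ball s" "\<xi>' \<in> ball s" by (auto simp: G_dom_def)
  let ?u = "U s \<xi>" let ?v = "U s \<xi>'"
  have u: "LP_orbit s \<xi> ?u" "LP_orbit s \<xi>' ?v" "LP_orbit s 0 (U s 0)"
    using LP_orbit_U[OF s] \<xi> zero_in_ball[OF s] by auto
  have P\<xi>: "P s \<xi> = \<xi>" "P s \<xi>' = \<xi>'" using ballD(1)[OF s] \<xi> by auto
  have 1: "\<phi> (s, \<xi>) \<in> range (Q s)" by (simp add: \<phi>_def)
  have "U s 0 s = 0"
    using LP_orbit_unique[OF s order_refl u(3) LP_orbit_zero[OF s]] by (simp add: blinfun.zero_right)
  then have 2: "\<phi> (s, 0) = 0" by (simp add: \<phi>_def blinfun.zero_right)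
  have cls: "orbit_class s ?u" "orbit_class s ?v" using u by (auto simp: LP_orbit_def)
  let ?h = "\<lambda>r. f r (?u r) - f r (?v r)" let ?N = "C * \<nu> s powr \<epsilon> * norm (\<xi> - \<xi>')"
  have N: "0 \<le> ?N" using C_ge_1 by simp
  have int: "(\<lambda>r. T s r (?h r)) integrable_on {s..x}" for x
    using integrable_diff[OF orbit_class_integrable[OF s cls(1)] orbit_class_integrable[OF s cls(2)], of x]
    by (simp add: blinfun.diff_right)
  have dom: "dominated s (w s) ?N (4 * C * \<delta>) {s..} ?h"
    by (rule dominated_diff[OF s cls]) (use LP_orbit_Lipschitz[OF s _ u(1,2) P\<xi>] in auto)
  have "norm (integral {s..} (\<lambda>r. Q s (T s r (?h r)))) \<le> \<theta> * ?N * \<nu> s powr (- \<epsilon>) * w s s"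
    by (rule Q_T_integral_bound(2)[OF s order_refl weight_w[OF s] N _ int dom]) (use C_ge_1 \<delta> in auto)
  also have "\<dots> = (C * \<theta>) * norm (\<xi> - \<xi>') * (\<nu> s powr \<epsilon> * \<nu> s powr (- \<epsilon>))"
    by (simp add: w_self[OF s] mult_ac)
  also have "\<dots> = (C * \<theta>) * norm (\<xi> - \<xi>')" by (simp add: nu_powr_cancel[OF s])
  also have "\<dots> \<le> 1 * norm (\<xi> - \<xi>')"
  proof (rule mult_right_mono)
    have "0 \<le> C * \<theta>" using C_ge_1 theta_nonneg by simp
    then show "C * \<theta> \<le> 1" using small(2) by simp
  qed simp
  finally have le: "norm (integral {s..} (\<lambda>r. Q s (T s r (?h r)))) \<le> norm (\<xi> - \<xi>')" by simp
  have adm: "admissible s (\<lambda>r. f r (?u r))" "admissible s (\<lambda>r. f r (?v r))"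
    using orbit_class_admissible[OF s] cls by auto
  have "\<phi> (s, \<xi>) - \<phi> (s, \<xi>') = - integral {s..} (\<lambda>r. Q s (T s r (?h r)))"
    using Henstock_Kurzweil_Integration.integral_diff[of "\<lambda>r. Q s (T s r (f r (?u r)))" "{s..}"
        "\<lambda>r. Q s (T s r (f r (?v r)))"] adm LP_orbit_start(2)[OF s u(1) P\<xi>(1)] LP_orbit_start(2)[OF s u(2) P\<xi>(2)]
    by (simp add: \<phi>_def admissible_def blinfun.diff_right)
  then have 3: "norm (\<phi> (s, \<xi>) - \<phi> (s, \<xi>')) \<le> norm (\<xi> - \<xi>')" using le by simp
  show "\<phi> (s, \<xi>) \<in> range (blinfun_apply (compl_proj (P s))) \<and> \<phi> (s, 0) = 0 \<and>
     norm (\<phi> (s, \<xi>) - \<phi> (s, \<xi>')) \<le> norm (\<xi> - \<xi>')" using 1 2 3 by simp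
qed

text \<open>Starting in the small ball, the orbit is below
  \<open>\<delta> * \<beta> s * w s r\<close>; splitting \<open>w s r\<close> at \<open>t\<close>
  and using \<open>beta_w_le\<close> turns this into \<open>\<delta> * \<beta> t * w t r\<close>,
  which suffices both for the ball and for the class at time \<open>t\<close>.\<close>

lemma LP_orbit_shift:
  assumes s: "0 \<le> s" "s \<le> t" and \<xi>: "\<xi> \<in> small_ball s" and u: "LP_orbit s \<xi> u"
  shows "P t (u t) \<in> ball t" "LP_orbit t (P t (u t)) u"
proof -
  have P\<xi>: "P s \<xi> = \<xi>" using ballD(1)[OF s(1) small_ballD(2)[OF s(1) \<xi>]] .
  have t: "0 \<le> t" using s by simp
  have cls: "orbit_class s u" using u by (simp add: LP_orbit_def)
  have "norm (P t (u t)) \<le> C * \<nu> s powr \<epsilon> * norm \<xi> * w s t" by (rule LP_orbit_bounds(2)[OF s u P\<xi>])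
  also have "\<dots> < \<delta> * \<beta> s * w s t"
    using small_ballD(1)[OF s(1) \<xi>] w_pos[OF s] by (intro mult_strict_right_mono) auto
  also have "\<dots> \<le> \<delta> * \<beta> t" using beta_w_le[OF s] \<delta> by (simp add: mult.assoc)
  finally show "P t (u t) \<in> ball t" by (simp add: B_ball_def)
  have "norm (u r) \<le> 2 * C * \<delta> * m t * w t r" if r: "t \<le> r" for r
  proof -
    have "norm (u r) \<le> C * \<nu> s powr \<epsilon> * norm \<xi> * w s r"
      by (rule LP_orbit_bounds(1)[OF s(1) _ u P\<xi>]) (use s r in simp)
    also have "\<dots> \<le> \<delta> * \<beta> s * w s r"
      using small_ballD(1)[OF s(1) \<xi>] w_pos[of s r] s r by (intro mult_right_mono) auto
    also have "\<dots> = \<delta> * (\<beta> s * w s t) * w t r" using w_trans[OF s r] by (simp add: mult_ac)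
    also have "\<dots> \<le> \<delta> * m t * w t r"
      using order_trans[OF beta_w_le[OF s] beta_le_m[OF t]] \<delta> less_imp_le[OF w_pos[OF t r]]
      by (intro mult_right_mono mult_left_mono) auto
    also have "\<dots> \<le> (2 * C) * (\<delta> * m t * w t r)"
      using mult_right_mono[of 1 "2 * C" "\<delta> * m t * w t r"] C_ge_1
        mult_nonneg_nonneg[OF mult_nonneg_nonneg[OF less_imp_le[OF \<delta>] less_imp_le[OF m_pos[OF t]]]
          less_imp_le[OF w_pos[OF t r]]] by simp
    finally show ?thesis by (simp add: mult_ac)
  qed
  moreover have "continuous_on {t..} u"
    by (rule continuous_on_subset[of "{s..}"]) (use cls s(2) in \<open>auto simp: orbit_class_def\<close>)
  moreover have "u r = LP t (P t (u t)) (\<lambda>r. f r (u r)) r" if r: "t \<le> r" for r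
  proof -
    have eq: "LP s \<xi> (\<lambda>r. f r (u r)) x = u x" if "s \<le> x" for x
      by (rule LP_orbitD[OF u that, symmetric])
    show ?thesis
      using LP_shift[OF s r orbit_class_admissible[OF s(1) cls] P\<xi>] eq[of t] eq[of r] s r by simp
  qed
  ultimately show "LP_orbit t (P t (u t)) u" unfolding LP_orbit_def orbit_class_def by blast
qed

lemma phi_orbit:
  assumes s: "0 \<le> s" "s \<le> t" and \<xi>: "\<xi> \<in> ball s"
  shows "sol_defined (perturbed_rhs A f) s (\<xi> + \<phi> (s, \<xi>)) t"
    "sol (perturbed_rhs A f) s (\<xi> + \<phi> (s, \<xi>)) t = U s \<xi> t"
  using LP_orbit_sol[OF s(1) LP_orbit_U[OF s(1) \<xi>] ballD(1)[OF s(1) \<xi>] s(2)] by (simp_all add: \<phi>_def)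

lemma phi_invariant: "invariant_graph A f P C \<delta> \<beta> (beta_tilde \<mu> \<nu> a \<epsilon> q) \<phi>"
  unfolding invariant_graph_def
proof (intro allI impI conjI ballI subsetI)
  fix \<tau> :: real assume \<tau>: "0 \<le> \<tau>"
  {
    fix p assume "p \<in> V_graph P \<phi> (\<delta> / C) (beta_tilde \<mu> \<nu> a \<epsilon> q)"
    then obtain s \<xi> where p: "p = (s, \<xi>, \<phi> (s, \<xi>))" "0 \<le> s" "\<xi> \<in> small_ball s"
      by (auto simp: V_graph_def G_dom_def)
    have st: "s \<le> s + \<tau>" "0 \<le> s + \<tau>" using \<tau> p(2) by auto
    have ball: "\<xi> \<in> ball s" by (rule small_ballD(2)[OF p(2,3)])
    let ?u = "U s \<xi>" let ?x = "P (s + \<tau>) (?u (s + \<tau>))"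
    have def: "Psi_defined A f \<tau> p" using phi_orbit(1)[OF p(2) st(1) ball] by (simp add: p(1) Psi_defined_def)
    have Psi: "Psi A f P \<tau> p = (s + \<tau>, ?x, Q (s + \<tau>) (?u (s + \<tau>)))"
      using phi_orbit(2)[OF p(2) st(1) ball] by (simp add: p(1) Psi_def Let_def)
    have sh: "?x \<in> ball (s + \<tau>)" "LP_orbit (s + \<tau>) ?x ?u"
      using LP_orbit_shift[OF p(2) st(1) p(3) LP_orbit_U[OF p(2) ball]] by auto
    \<comment> \<open>Uniqueness identifies the orbit chosen at the new base point with the old one,
      so the unstable component there is the value of \<open>\<phi>\<close>.\<close>
    have "U (s + \<tau>) ?x (s + \<tau>) = ?u (s + \<tau>)"
      by (rule LP_orbit_unique[OF st(2) order_refl LP_orbit_U[OF st(2) sh(1)] sh(2) ballD(1)[OF st(2) sh(1)]])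
    then have "Psi A f P \<tau> p = (s + \<tau>, ?x, \<phi> (s + \<tau>, ?x))" by (simp add: Psi \<phi>_def)
    then have "Psi A f P \<tau> p \<in> V_graph P \<phi> \<delta> \<beta>"
      using sh(1) st(2) by (auto simp: V_graph_def G_dom_def)
    note def this
  }
  note * = this
  show "Psi_defined A f \<tau> p" if "p \<in> V_graph P \<phi> (\<delta> / C) (beta_tilde \<mu> \<nu> a \<epsilon> q)" for p
    using *(1)[OF that] .
  show "x \<in> V_graph P \<phi> \<delta> \<beta>" if "x \<in> Psi A f P \<tau> ` V_graph P \<phi> (\<delta> / C) (beta_tilde \<mu> \<nu> a \<epsilon> q)" for x
    using *(2) that by auto
qed

lemma Psi_phi_dist:
  assumes s: "0 \<le> s" "s \<le> t" and \<xi>: "\<xi> \<in> small_ball s" "\<xi>' \<in> small_ball s"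
  shows "X_dist (Psi A f P (t - s) (s, \<xi>, \<phi> (s, \<xi>))) (Psi A f P (t - s) (s, \<xi>', \<phi> (s, \<xi>')))
    \<le> 2 * C * (\<mu> t / \<mu> s) powr a * \<nu> s powr \<epsilon> * norm (\<xi> - \<xi>')"
proof -
  have ball: "\<xi> \<in> ball s" "\<xi>' \<in> ball s" using small_ballD(2)[OF s(1)] \<xi> by auto
  have "X_dist (Psi A f P (t - s) (s, \<xi>, \<phi> (s, \<xi>))) (Psi A f P (t - s) (s, \<xi>', \<phi> (s, \<xi>')))
      = norm (U s \<xi> t - U s \<xi>' t)"
    using phi_orbit(2)[OF s] ball by (simp add: X_dist_def Psi_def Let_def Q_apply)
  also have "\<dots> \<le> C * \<nu> s powr \<epsilon> * norm (\<xi> - \<xi>') * w s t"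
    using LP_orbit_Lipschitz[OF s LP_orbit_U[OF s(1) ball(1)] LP_orbit_U[OF s(1) ball(2)]] ballD(1)[OF s(1)] ball
    by simp
  also have "\<dots> \<le> 2 * (C * \<nu> s powr \<epsilon> * norm (\<xi> - \<xi>') * w s t)"
    using C_ge_1 w_pos[OF s] by simp
  finally show ?thesis by (simp add: w_def mult_ac)
qed

text \<open>The weight \<open>w s\<close> may jump, so the bound is propagated by comparing with a point of first failure
  rather than by continuity of the quotient.\<close>

lemma decay_bootstrap:
  assumes s: "0 \<le> s" and \<xi>: "P s \<xi> = \<xi>" "norm \<xi> * (C * \<nu> s powr \<epsilon>) \<le> \<delta> * \<beta> s"
    and v: "continuous_on {s..} v" and half: "\<And>r. s \<le> r \<Longrightarrow> norm (v r) \<le> 2 * norm (P r (v r))"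
    and Pv: "\<And>r. s \<le> r \<Longrightarrow> norm (P r (v r)) \<le> \<delta> * \<beta> s"
    and eq: "\<And>t. s \<le> t \<Longrightarrow> P t (v t) = T t s \<xi> + integral {s..t} (\<lambda>r. P t (T t r (f r (v r))))"
    and t: "s \<le> t"
  shows "norm (P t (v t)) \<le> \<delta> * \<beta> s * w s t"
proof (rule ccontr)
  define K where "K = \<delta> * \<beta> s"
  have K: "0 < K" using \<delta> beta_pos[OF s] by (simp add: K_def)
  have Km: "2 * K \<le> 4 * C * \<delta> * m s"
  proof -
    have "K \<le> \<delta> * m s" using beta_le_m[OF s] \<delta> by (simp add: K_def)
    also have "\<dots> \<le> (2 * C) * (\<delta> * m s)"
      using mult_right_mono[of 1 "2 * C" "\<delta> * m s"] C_ge_1 \<delta> m_pos[OF s] by simp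
    finally show ?thesis by simp
  qed
  define bad where "bad = {t. s \<le> t \<and> K * w s t < norm (P t (v t))}"
  assume "\<not> norm (P t (v t)) \<le> \<delta> * \<beta> s * w s t"
  then have tb: "t \<in> bad" using t by (simp add: bad_def K_def)
  define t0 where "t0 = Inf bad"
  have bdd: "bdd_below bad" by (rule bdd_belowI[of _ s]) (simp add: bad_def)
  have st0: "s \<le> t0" unfolding t0_def by (rule cInf_greatest) (use tb in \<open>auto simp: bad_def\<close>)
  have t0: "0 \<le> t0" using s st0 by simp
  have good: "norm (P r (v r)) \<le> K * w s r" if "r \<in> {s..<t0}" for r
  proof -
    have "r \<notin> bad" using cInf_lower[OF _ bdd, of r] that by (auto simp: t0_def)
    then show ?thesis using that by (simp add: bad_def)
  qed
  let ?h = "\<lambda>r. f r (v r)"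
  have v_sub: "continuous_on {x..y} v" if "s \<le> x" for x y
    using that by (auto intro: continuous_on_subset[OF v])
  \<comment> \<open>The interval is half-open because \<open>t0\<close> itself may be bad.\<close>
  have dom: "dominated s (w s) (2 * K) (4 * C * \<delta>) {s..<t0} ?h"
    unfolding dominated_def
  proof
    fix r assume r: "r \<in> {s..<t0}"
    have v1: "norm (v r) \<le> 2 * K * w s r" using half[of r] good[OF r] r by simp
    also have "\<dots> \<le> 4 * C * \<delta> * m s * w s r"
      by (rule mult_right_mono[OF Km]) (use w_pos[of s r] r s in auto)
    finally have "norm (f r (v r) - f r 0) \<le> c * (2 * K * w s r) * (4 * C * \<delta> * m s * w s r) powr q"
      using v1 r s by (intro f_lip_le) auto
    then show "norm (f r (v r)) \<le> c * (2 * K) * w s r * (4 * C * \<delta> * m s * w s r) powr q"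
      using f_zero[of r] r s by (simp add: mult_ac)
  qed
  \<comment> \<open>From \<open>t0\<close> on only the a priori bound
    \<open>norm (v r) \<le> 2 * K\<close> is available. \<open>M\<close> bounds the integrand there
    in units of \<open>w s x\<close>, since \<open>w r x = w s x / w s r\<close> and
    \<open>w s r \<ge> w s (t0 + 1)\<close>.\<close>
  define M where "M = D * \<nu> (t0 + 1) powr \<epsilon> * (c * (2 * K) * (2 * K) powr q) / w s (t0 + 1)"
  have wp1: "0 < w s (t0 + 1)" by (rule w_pos) (use s st0 in auto)
  have M: "0 \<le> M" using D c K wp1 by (simp add: M_def)
  \<comment> \<open>The share of \<open>K * w s x\<close> left over by the linear term
    (\<open>D / C\<close>) and the integral up to \<open>t0\<close> (\<open>2 * \<theta>\<close>);
    \<open>\<eta>\<close> makes the integral from \<open>t0\<close> to \<open>x\<close> fit into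
    it.\<close>
  define \<sigma> where "\<sigma> = 1 - D / C - 2 * \<theta>"
  have \<sigma>: "0 < \<sigma>"
  proof -
    have "0 \<le> C * \<theta>" using C_ge_1 theta_nonneg by simp
    then have "D + 2 * \<theta> * C < C" using small(1) C by (simp add: mult_ac)
    then have "0 < (C - D - 2 * \<theta> * C) / C" using C_ge_1 by simp
    then show ?thesis using C_ge_1 by (simp add: \<sigma>_def diff_divide_distrib)
  qed
  define \<eta> where "\<eta> = min 1 (K * \<sigma> / (M + 1))"
  have \<eta>: "0 < \<eta>" "\<eta> \<le> 1" using K \<sigma> M by (auto simp: \<eta>_def)
  have M\<eta>: "M * \<eta> \<le> K * \<sigma>"
  proof -
    have "M * \<eta> \<le> M * (K * \<sigma> / (M + 1))" using M by (intro mult_left_mono) (auto simp: \<eta>_def)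
    also have "\<dots> \<le> K * \<sigma>" using M K \<sigma> by (simp add: field_simps)
    finally show ?thesis .
  qed
  have improved: "norm (P x (v x)) \<le> K * w s x" if x: "t0 \<le> x" "x \<le> t0 + \<eta>" for x
  proof -
    have sx: "s \<le> x" "0 \<le> x" using x st0 s by auto
    have wx: "0 < w s x" by (rule w_pos[OF s sx(1)])
    have TI: "(\<lambda>r. T x r (?h r)) integrable_on {s..x}"
      by (rule T_f_integrable[OF s sx(2) v_sub[OF order_refl]])
    have PI: "(\<lambda>r. P x (T x r (?h r))) integrable_on {s..x}"
      using integrable_linear[OF TI blinfun.bounded_linear_right, of "P x"] by (simp add: o_def)
    have I1: "norm (integral {s..t0} (\<lambda>r. P x (T x r (?h r)))) \<le> 2 * \<theta> * K * w s x"
    proof -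
      have "norm (integral {s..t0} (\<lambda>r. P x (T x r (?h r)))) \<le> \<theta> * (2 * K) * \<nu> s powr (- \<epsilon>) * w s x"
        by (rule P_T_integral_bound[OF s st0 x(1) weight_w[OF s] _ _ _ dom])
           (use K C_ge_1 \<delta> in \<open>auto intro: T_f_integrable[OF s s v_sub]\<close>)
      also have "\<dots> \<le> \<theta> * (2 * K) * 1 * w s x"
        using nu_powr_le_1[OF s] theta_nonneg K wx by (intro mult_right_mono mult_left_mono) auto
      finally show ?thesis by (simp add: mult_ac)
    qed
    have I2: "norm (integral {t0..x} (\<lambda>r. P x (T x r (?h r)))) \<le> M * w s x * (x - t0)"
    proof (rule norm_integral_le_real[OF integrable_real_subinterval[OF PI st0 order_refl] x(1)])
      fix r assume r: "r \<in> {t0..x}"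
      have r': "0 \<le> r" "s \<le> r" "r \<le> x" "r \<le> t0 + 1" using r x \<eta> t0 st0 by auto
      have "norm (v r) \<le> 2 * K" using half[OF r'(2)] Pv[OF r'(2)] by (simp add: K_def)
      then have h: "norm (?h r) \<le> c * (2 * K) * (2 * K) powr q" by (rule f_norm_le[OF r'(1)])
      have w_rx: "w r x \<le> w s x / w s (t0 + 1)"
      proof -
        have "w s (t0 + 1) * w r x \<le> w s r * w r x"
          using w_antimono[OF s r'(2,4)] w_pos[OF r'(1,3)] by (intro mult_right_mono) auto
        then show ?thesis using w_trans[OF s r'(2,3)] wp1 by (simp add: pos_le_divide_eq mult.commute)
      qed
      have n_r: "\<nu> r powr \<epsilon> \<le> \<nu> (t0 + 1) powr \<epsilon>"
        using nu_mono[OF r'(1,4)] nu_ge_1[OF r'(1)] \<epsilon> by (intro powr_mono2) auto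
      have "norm (P x (T x r (?h r))) \<le> D * w r x * \<nu> r powr \<epsilon> * norm (?h r)"
        by (rule norm_P_T[OF r'(1,3)])
      also have "\<dots> \<le> D * (w s x / w s (t0 + 1)) * \<nu> (t0 + 1) powr \<epsilon> * (c * (2 * K) * (2 * K) powr q)"
        using D w_rx n_r h wx wp1 w_pos[OF r'(1,3)] by (intro mult_mono) auto
      finally show "norm (P x (T x r (?h r))) \<le> M * w s x" by (simp add: M_def mult_ac)
    qed
    have I3: "norm (T x s \<xi>) \<le> D / C * K * w s x"
    proof -
      have "norm (T x s \<xi>) \<le> D * \<nu> s powr \<epsilon> * norm \<xi> * w s x" by (rule norm_T_P[OF s sx(1) \<xi>(1)])
      also have "\<dots> = D / C * (norm \<xi> * (C * \<nu> s powr \<epsilon>)) * w s x" using C_ge_1 by simp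
      also have "\<dots> \<le> D / C * K * w s x"
        using \<xi>(2) D C_ge_1 wx unfolding K_def by (intro mult_right_mono mult_left_mono) auto
      finally show ?thesis .
    qed
    have "P x (v x) = T x s \<xi> + (integral {s..t0} (\<lambda>r. P x (T x r (?h r))) + integral {t0..x} (\<lambda>r. P x (T x r (?h r))))"
      unfolding eq[OF sx(1)]
      using Henstock_Kurzweil_Integration.integral_combine[where a=s and c=t0 and b=x, OF st0 x(1) PI] by simp
    then have "norm (P x (v x)) \<le> norm (T x s \<xi>) + (norm (integral {s..t0} (\<lambda>r. P x (T x r (?h r))))
        + norm (integral {t0..x} (\<lambda>r. P x (T x r (?h r)))))"
      using norm_triangle_ineq[of "T x s \<xi>" "integral {s..t0} (\<lambda>r. P x (T x r (?h r))) + integral {t0..x} (\<lambda>r. P x (T x r (?h r)))"]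
        norm_triangle_ineq[of "integral {s..t0} (\<lambda>r. P x (T x r (?h r)))" "integral {t0..x} (\<lambda>r. P x (T x r (?h r)))"]
      by simp
    also have "\<dots> \<le> D / C * K * w s x + (2 * \<theta> * K * w s x + M * w s x * (x - t0))"
      using I1 I2 I3 by simp
    also have "M * w s x * (x - t0) \<le> M * w s x * \<eta>" using M wx x by (intro mult_left_mono) auto
    also have "M * w s x * \<eta> \<le> K * \<sigma> * w s x" using mult_right_mono[OF M\<eta>, of "w s x"] wx by (simp add: mult_ac)
    also have "D / C * K * w s x + (2 * \<theta> * K * w s x + K * \<sigma> * w s x) = K * w s x"
      by (simp add: \<sigma>_def algebra_simps)
    finally show ?thesis by simp
  qed
  have "\<exists>x\<in>bad. x < t0 + \<eta>"
    by (rule cInf_lessD) (use tb \<eta> in \<open>auto simp: t0_def\<close>)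
  then obtain x where x: "x \<in> bad" "x < t0 + \<eta>" by blast
  moreover have "t0 \<le> x" unfolding t0_def by (rule cInf_lower[OF x(1) bdd])
  ultimately show False using improved[of x] by (auto simp: bad_def)
qed

text \<open>Backward transport costs \<open>\<mu> t powr (- b) * \<nu> t powr \<epsilon>\<close> and
  the decay of \<open>v\<close> supplies \<open>\<mu> t powr a\<close>; their product is the
  quantity assumed to vanish in \<open>lim\<close>.\<close>

lemma unstable_part_limit:
  assumes s: "0 \<le> s" and le: "\<And>t. s \<le> t \<Longrightarrow> norm (v t) \<le> K * w s t"
  shows "((\<lambda>t. Q s (T s t (v t))) \<longlongrightarrow> 0) at_top"
proof (rule Lim_null_comparison)
  define M where "M = D * K * \<mu> s powr (b - a)"
  show "((\<lambda>t. M * (\<mu> t powr (a - b) * \<nu> t powr \<epsilon>)) \<longlongrightarrow> 0) at_top"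
    using tendsto_mult[OF tendsto_const[of M] lim] by simp
  show "\<forall>\<^sub>F t in at_top. norm (Q s (T s t (v t))) \<le> M * (\<mu> t powr (a - b) * \<nu> t powr \<epsilon>)"
    using eventually_ge_at_top[of s]
  proof eventually_elim
    case (elim t)
    have pos: "0 < \<mu> s" "0 < \<mu> t" using mu_ge_1[of s] mu_ge_1[of t] s elim by auto
    have "norm (Q s (T s t (v t))) \<le> D * (\<mu> t / \<mu> s) powr (- b) * \<nu> t powr \<epsilon> * norm (v t)"
      by (rule norm_Q_T[OF s elim])
    also have "\<dots> \<le> D * (\<mu> t / \<mu> s) powr (- b) * \<nu> t powr \<epsilon> * (K * w s t)"
      using D le[OF elim] by (intro mult_left_mono) auto
    also have "\<dots> = D * K * ((\<mu> t / \<mu> s) powr (- b) * (\<mu> t / \<mu> s) powr a) * \<nu> t powr \<epsilon>"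
      by (simp add: w_def mult_ac)
    also have "(\<mu> t / \<mu> s) powr (- b) * (\<mu> t / \<mu> s) powr a = \<mu> t powr (a - b) * \<mu> s powr (b - a)"
    proof -
      have "(\<mu> t / \<mu> s) powr (- b) * (\<mu> t / \<mu> s) powr a = (\<mu> t / \<mu> s) powr (a - b)"
        by (simp add: powr_add[symmetric])
      also have "\<dots> = \<mu> t powr (a - b) / \<mu> s powr (a - b)" using pos by (simp add: powr_divide)
      also have "\<dots> = \<mu> t powr (a - b) * \<mu> s powr (- (a - b))" by (simp only: powr_minus divide_inverse)
      finally show ?thesis by simp
    qed
    finally show ?case by (simp add: M_def mult_ac)
  qed
qed

lemma invariant_graph_unique:
  assumes \<psi>: "\<psi> \<in> X_space P \<delta> \<beta>" and inv: "invariant_graph A f P C \<delta> \<beta> (beta_tilde \<mu> \<nu> a \<epsilon> q) \<psi>"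
    and s: "0 \<le> s" and \<xi>: "\<xi> \<in> small_ball s"
  shows "\<psi> (s, \<xi>) = \<phi> (s, \<xi>)"
proof -
  let ?y = "\<psi> (s, \<xi>)"
  define v where "v = sol (perturbed_rhs A f) s (\<xi> + ?y)"
  have ball: "\<xi> \<in> ball s" by (rule small_ballD(2)[OF s \<xi>])
  have P\<xi>: "P s \<xi> = \<xi>" by (rule ballD(1)[OF s ball])
  have \<psi>D: "\<psi> (t, x) \<in> range (Q t)" "norm (\<psi> (t, x)) \<le> norm x" if "0 \<le> t" "x \<in> ball t" for t x
  proof -
    have *: "(t, x) \<in> G_dom P \<delta> \<beta> \<and> (t, 0) \<in> G_dom P \<delta> \<beta>" using that zero_in_ball[OF that(1)] by (simp add: G_dom_def)
    then have "\<psi> (t, x) \<in> range (Q t) \<and> \<psi> (t, 0) = 0 \<and> norm (\<psi> (t, x) - \<psi> (t, 0)) \<le> norm (x - 0)"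
      using \<psi> unfolding X_space_def by blast
    then show "\<psi> (t, x) \<in> range (Q t)" "norm (\<psi> (t, x)) \<le> norm x" by auto
  qed
  have Qy: "Q s ?y = ?y" "P s ?y = 0" using \<psi>D(1)[OF s ball] s by (auto simp: Q_Q P_Q)
  have p: "(s, \<xi>, ?y) \<in> V_graph P \<psi> (\<delta> / C) (beta_tilde \<mu> \<nu> a \<epsilon> q)"
    using s \<xi> by (force simp: V_graph_def G_dom_def)
  have def: "sol_defined (perturbed_rhs A f) s (\<xi> + ?y) t" if "s \<le> t" for t
  proof -
    have "Psi_defined A f (t - s) (s, \<xi>, ?y)" using inv p that by (simp add: invariant_graph_def)
    then show ?thesis by (simp add: Psi_defined_def)
  qed
  have graph: "P t (v t) \<in> ball t" "Q t (v t) = \<psi> (t, P t (v t))" if "s \<le> t" for t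
  proof -
    have "Psi A f P (t - s) (s, \<xi>, ?y) \<in> V_graph P \<psi> \<delta> \<beta>"
      using inv p that unfolding invariant_graph_def by (meson diff_ge_0_iff_ge image_subset_iff)
    then have "(t, P t (v t), Q t (v t)) \<in> V_graph P \<psi> \<delta> \<beta>" by (simp add: Psi_def Let_def v_def)
    then show "P t (v t) \<in> ball t" "Q t (v t) = \<psi> (t, P t (v t))"
      by (auto simp: V_graph_def G_dom_def)
  qed
  have cv: "continuous_on {s..} v" unfolding v_def by (rule global_sol_mild(1)[OF s]) (use def in auto)
  have vs: "v s = \<xi> + ?y" unfolding v_def by (rule global_sol_mild(2)[OF s]) (use def in auto)
  have mild: "v t = T t s (\<xi> + ?y + integral {s..t} (\<lambda>r. T s r (f r (v r))))" if "s \<le> t" for t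
    unfolding v_def by (rule global_sol_mild(3)[OF s]) (use def that in auto)
  let ?h = "\<lambda>r. f r (v r)"
  have v_sub: "continuous_on {s..t} v" for t by (rule continuous_on_subset[OF cv]) auto
  have TI: "(\<lambda>r. T x r (?h r)) integrable_on {s..t}" if "0 \<le> x" for x t
    by (rule T_f_integrable[OF s that v_sub])
  \<comment> \<open>On a graph of slope at most 1 through the origin the unstable component is no
    larger than the stable one, so only the latter has to be estimated.\<close>
  have half: "norm (v t) \<le> 2 * norm (P t (v t))" if "s \<le> t" for t
  proof -
    have "norm (v t) \<le> norm (P t (v t)) + norm (Q t (v t))"
      using norm_triangle_ineq[of "P t (v t)" "Q t (v t)"] by (simp add: Q_apply)
    also have "norm (Q t (v t)) \<le> norm (P t (v t))"
      using graph[OF that] \<psi>D(2)[of t "P t (v t)"] s that by simp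
    finally show ?thesis by simp
  qed
  have decay: "norm (P t (v t)) \<le> \<delta> * \<beta> s * w s t" if t: "s \<le> t" for t
  proof (rule decay_bootstrap[OF s P\<xi> _ cv half _ _ t])
    show "norm \<xi> * (C * \<nu> s powr \<epsilon>) \<le> \<delta> * \<beta> s" using small_ballD(1)[OF s \<xi>] by (simp add: mult_ac)
    fix r assume r: "s \<le> r"
    have "norm (P r (v r)) \<le> \<delta> * \<beta> r" using ballD(2)[OF _ graph(1)[OF r]] s r by simp
    \<comment> \<open>Decrease of \<open>\<beta>\<close> turns the moving radius into the fixed
      bound from which the bootstrap starts.\<close>
    also have "\<dots> \<le> \<delta> * \<beta> s" using beta_antimono[OF s r] \<delta> by simp
    finally show "norm (P r (v r)) \<le> \<delta> * \<beta> s" .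
    have "P r (v r) = P r (T r s (\<xi> + ?y + integral {s..r} (\<lambda>x. T s x (?h x))))"
      using mild[OF r] by simp
    also have "\<dots> = T r s (P s (\<xi> + ?y)) + P r (T r s (integral {s..r} (\<lambda>x. T s x (?h x))))"
      using s r by (simp add: blinfun.add_right P_T)
    also have "T r s (integral {s..r} (\<lambda>x. T s x (?h x))) = integral {s..r} (\<lambda>x. T r x (?h x))"
      by (rule T_integral(2)[OF _ s _ TI[OF s]]) (use s r in auto)
    also have "P r (integral {s..r} (\<lambda>x. T r x (?h x))) = integral {s..r} (\<lambda>x. P r (T r x (?h x)))"
      using integral_linear[OF TI blinfun.bounded_linear_right, of r r "P r"] s r by (simp add: o_def)
    finally show "P r (v r) = T r s \<xi> + integral {s..r} (\<lambda>x. P r (T r x (?h x)))"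
      by (simp add: blinfun.add_right P\<xi> Qy)
  qed
  have v_le: "norm (v t) \<le> 2 * (\<delta> * \<beta> s) * w s t" if "s \<le> t" for t
    using half[OF that] decay[OF that] by simp
  have cls: "orbit_class s v"
    unfolding orbit_class_def
  proof (intro conjI allI impI cv)
    fix t assume t: "s \<le> t"
    have "norm (v t) \<le> 2 * (\<delta> * \<beta> s) * w s t" by (rule v_le[OF t])
    also have "\<dots> \<le> 2 * (C * (\<delta> * m s)) * w s t"
    proof (intro mult_right_mono mult_left_mono)
      have "1 * (\<delta> * \<beta> s) \<le> C * (\<delta> * m s)"
        using C_ge_1 \<delta> beta_le_m[OF s] beta_pos[OF s] by (intro mult_mono) auto
      then show "\<delta> * \<beta> s \<le> C * (\<delta> * m s)" by simp
    qed (use w_pos[OF s t] in auto)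
    finally show "norm (v t) \<le> 2 * C * \<delta> * m s * w s t" by (simp add: mult_ac)
  qed
  have adm: "admissible s ?h" by (rule orbit_class_admissible[OF s cls])
  let ?J = "integral {s..} (\<lambda>r. Q s (T s r (?h r)))"
  have QI: "(\<lambda>r. Q s (T s r (?h r))) integrable_on {s..}" using adm by (simp add: admissible_def)
  \<comment> \<open>Seen from time \<open>s\<close>, the unstable component of \<open>v t\<close> is
    \<open>?y\<close> plus the integral up to \<open>t\<close>. Since it also tends to 0,
    \<open>?y\<close> must be minus the improper integral, the value prescribed by
    \<open>LP\<close>.\<close>
  have "((\<lambda>t. ?y + integral {s..t} (\<lambda>r. Q s (T s r (?h r)))) \<longlongrightarrow> ?y + ?J) at_top"
    by (intro tendsto_intros integral_Ici_tendsto[OF QI])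
  moreover have "((\<lambda>t. ?y + integral {s..t} (\<lambda>r. Q s (T s r (?h r)))) \<longlongrightarrow> 0) at_top"
  proof (rule Lim_transform_eventually[OF unstable_part_limit[OF s v_le]])
    show "\<forall>\<^sub>F t in at_top. Q s (T s t (v t)) = ?y + integral {s..t} (\<lambda>r. Q s (T s r (?h r)))"
      using eventually_ge_at_top[of s]
    proof eventually_elim
      case (elim t)
      have "T s t (v t) = \<xi> + ?y + integral {s..t} (\<lambda>r. T s r (?h r))"
        unfolding mild[OF elim] using s elim by (intro T_inverse) auto
      then have "Q s (T s t (v t)) = Q s \<xi> + Q s ?y + Q s (integral {s..t} (\<lambda>r. T s r (?h r)))"
        by (simp add: blinfun.add_right)
      also have "Q s (integral {s..t} (\<lambda>r. T s r (?h r))) = integral {s..t} (\<lambda>r. Q s (T s r (?h r)))"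
        using integral_linear[OF TI blinfun.bounded_linear_right, of s t "Q s"] s by (simp add: o_def)
      finally show ?case by (simp add: Qy Q_apply[of s \<xi>] P\<xi>)
    qed
  qed
  ultimately have "?y + ?J = 0" using tendsto_unique[OF trivial_limit_at_top_linorder] by blast
  then have yJ: "?y = - ?J" by (simp add: eq_neg_iff_add_eq_0)
  have "LP_orbit s \<xi> v"
    unfolding LP_orbit_def
  proof (intro conjI allI impI cls)
    fix t assume t: "s \<le> t"
    show "v t = LP s \<xi> ?h t" unfolding LP_def using mild[OF t] unfolding yJ by simp
  qed
  then have "U s \<xi> s = v s"
    by (rule LP_orbit_unique[OF s order_refl LP_orbit_U[OF s ball] _ P\<xi>])
  then have "\<phi> (s, \<xi>) = Q s (\<xi> + ?y)" using vs by (simp add: \<phi>_def)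
  then show ?thesis by (simp add: blinfun.add_right Qy Q_apply[of s \<xi>] P\<xi>)
qed

end

theorem theorem2p1:
  fixes A :: "real \<Rightarrow> 'a::banach \<Rightarrow>\<^sub>L 'a"
    and T :: "real \<Rightarrow> real \<Rightarrow> 'a \<Rightarrow>\<^sub>L 'a"
    and P :: "real \<Rightarrow> 'a \<Rightarrow>\<^sub>L 'a"
    and f :: "real \<Rightarrow> 'a \<Rightarrow> 'a"
    and \<mu> \<nu> :: "real \<Rightarrow> real"
    and D a b \<epsilon> c q C :: real
  assumes A_cont: "continuous_on {0..} A"
    and evol: "evolution_operator A T"
    and \<mu>: "growth_rate \<mu>" and \<nu>: "growth_rate \<nu>"
    and dich: "nonuniform_dichotomy T \<mu> \<nu> P D a b \<epsilon>"
    and c: "c > 0" and q: "q > 0"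
    and f_zero: "\<And>t. t \<ge> 0 \<Longrightarrow> f t 0 = 0"
    and f_lip: "\<And>t u v. t \<ge> 0 \<Longrightarrow>
      norm (f t u - f t v) \<le> c * norm (u - v) * (norm u + norm v) powr q"
    and wellposed: "\<And>s v0. s \<ge> 0 \<Longrightarrow> \<exists>\<omega> v. maximal_solution (perturbed_rhs A f) s v0 \<omega> v"
    and lim: "((\<lambda>t. \<mu> t powr (a - b) * \<nu> t powr \<epsilon>) \<longlongrightarrow> 0) at_top"
    and int: "(\<lambda>r. \<mu> r powr (a * q) * \<nu> r powr \<epsilon>) integrable_on {0..}"
    and beta_dec: "antimono_on {0..} (beta \<mu> \<nu> a \<epsilon> q)"
    and quot_dec: "antimono_on {0..} (\<lambda>t. \<mu> t powr a * inverse (beta \<mu> \<nu> a \<epsilon> q t))"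
    and C: "C > D"
  shows "\<exists>\<delta>0>0. \<forall>\<delta>. 0 < \<delta> \<and> \<delta> < \<delta>0 \<longrightarrow>
    (\<exists>\<phi>\<in>X_space P \<delta> (beta \<mu> \<nu> a \<epsilon> q).
       invariant_graph A f P C \<delta> (beta \<mu> \<nu> a \<epsilon> q) (beta_tilde \<mu> \<nu> a \<epsilon> q) \<phi> \<and>
       (\<forall>\<psi>\<in>X_space P \<delta> (beta \<mu> \<nu> a \<epsilon> q).
          invariant_graph A f P C \<delta> (beta \<mu> \<nu> a \<epsilon> q) (beta_tilde \<mu> \<nu> a \<epsilon> q) \<psi> \<longrightarrow>
          (\<forall>p\<in>G_dom P (\<delta> / C) (beta_tilde \<mu> \<nu> a \<epsilon> q). \<psi> p = \<phi> p)) \<and>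
       (\<forall>s\<ge>0. \<forall>t\<ge>s.
          \<forall>\<xi>\<in>B_ball P (\<delta> / C) (beta_tilde \<mu> \<nu> a \<epsilon> q) s.
          \<forall>\<xi>'\<in>B_ball P (\<delta> / C) (beta_tilde \<mu> \<nu> a \<epsilon> q) s.
            X_dist (Psi A f P (t - s) (s, \<xi>, \<phi> (s, \<xi>))) (Psi A f P (t - s) (s, \<xi>', \<phi> (s, \<xi>')))
              \<le> 2 * C * (\<mu> t / \<mu> s) powr a * \<nu> s powr \<epsilon> * norm (\<xi> - \<xi>')))"
proof -
  interpret dichotomy_equation A T f c q P \<mu> \<nu> D a b \<epsilon>
    by unfold_locales (fact A_cont evol \<mu> \<nu> dich c q f_zero f_lip wellposed int)+
  have C0: "0 < C" using C D by simp
  \<comment> \<open>Chosen so that \<open>4 * C * D * c * e = min (C - D) 1\<close>;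
    \<open>\<delta>0\<close> solves \<open>(4 * C * \<delta>0) powr q = e\<close>, which gives both
    conditions in \<open>small\<close>.\<close>
  define e where "e = min (C - D) 1 / (4 * C * D * c)"
  have e: "0 < e" using C C0 D c by (simp add: e_def)
  define \<delta>0 where "\<delta>0 = e powr (1 / q) / (4 * C)"
  have "\<delta>0 > 0" using e C0 by (simp add: \<delta>0_def)
  have lp: "lyapunov_perron A T f c q P \<mu> \<nu> D a b \<epsilon> C \<delta>" if \<delta>: "0 < \<delta>" "\<delta> < \<delta>0" for \<delta>
  proof
    have "4 * C * \<delta> \<le> e powr (1 / q)" using \<delta>(2) C0 by (simp add: \<delta>0_def field_simps)
    then have "(4 * C * \<delta>) powr q \<le> (e powr (1 / q)) powr q"
      using \<delta>(1) C0 q by (intro powr_mono2) auto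
    also have "\<dots> = e" using e q by (simp add: powr_powr)
    finally have "4 * C * \<Theta> (4 * C * \<delta>) \<le> 4 * C * (D * c * e)"
      using C0 D c by (simp add: \<Theta>_def)
    also have "\<dots> = min (C - D) 1" using C0 D c by (simp add: e_def)
    finally show "4 * C * \<Theta> (4 * C * \<delta>) \<le> C - D" "4 * C * \<Theta> (4 * C * \<delta>) \<le> 1" by auto
  qed (fact lim beta_dec quot_dec C \<delta>(1))+
  show ?thesis
  proof (intro exI[of _ \<delta>0] conjI allI impI)
    show "\<delta>0 > 0" by fact
    fix \<delta> assume \<delta>: "0 < \<delta> \<and> \<delta> < \<delta>0"
    interpret LP: lyapunov_perron A T f c q P \<mu> \<nu> D a b \<epsilon> C \<delta> by (rule lp) (use \<delta> in auto)
    show "\<exists>\<phi>\<in>X_space P \<delta> (beta \<mu> \<nu> a \<epsilon> q).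
       invariant_graph A f P C \<delta> (beta \<mu> \<nu> a \<epsilon> q) (beta_tilde \<mu> \<nu> a \<epsilon> q) \<phi> \<and>
       (\<forall>\<psi>\<in>X_space P \<delta> (beta \<mu> \<nu> a \<epsilon> q).
          invariant_graph A f P C \<delta> (beta \<mu> \<nu> a \<epsilon> q) (beta_tilde \<mu> \<nu> a \<epsilon> q) \<psi> \<longrightarrow>
          (\<forall>p\<in>G_dom P (\<delta> / C) (beta_tilde \<mu> \<nu> a \<epsilon> q). \<psi> p = \<phi> p)) \<and>
       (\<forall>s\<ge>0. \<forall>t\<ge>s.
          \<forall>\<xi>\<in>B_ball P (\<delta> / C) (beta_tilde \<mu> \<nu> a \<epsilon> q) s.
          \<forall>\<xi>'\<in>B_ball P (\<delta> / C) (beta_tilde \<mu> \<nu> a \<epsilon> q) s.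
            X_dist (Psi A f P (t - s) (s, \<xi>, \<phi> (s, \<xi>))) (Psi A f P (t - s) (s, \<xi>', \<phi> (s, \<xi>')))
              \<le> 2 * C * (\<mu> t / \<mu> s) powr a * \<nu> s powr \<epsilon> * norm (\<xi> - \<xi>'))"
    proof (intro bexI[OF _ LP.phi_X_space] conjI ballI allI impI)
      show "invariant_graph A f P C \<delta> (beta \<mu> \<nu> a \<epsilon> q) (beta_tilde \<mu> \<nu> a \<epsilon> q) LP.\<phi>"
        by (rule LP.phi_invariant)
    next
      fix \<psi> p
      assume "\<psi> \<in> X_space P \<delta> (beta \<mu> \<nu> a \<epsilon> q)"
        "invariant_graph A f P C \<delta> (beta \<mu> \<nu> a \<epsilon> q) (beta_tilde \<mu> \<nu> a \<epsilon> q) \<psi>"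
        "p \<in> G_dom P (\<delta> / C) (beta_tilde \<mu> \<nu> a \<epsilon> q)"
      then show "\<psi> p = LP.\<phi> p" using LP.invariant_graph_unique by (auto simp: G_dom_def)
    next
      fix s t :: real and \<xi> \<xi>'
      assume "0 \<le> s" "s \<le> t" "\<xi> \<in> B_ball P (\<delta> / C) (beta_tilde \<mu> \<nu> a \<epsilon> q) s"
        "\<xi>' \<in> B_ball P (\<delta> / C) (beta_tilde \<mu> \<nu> a \<epsilon> q) s"
      then show "X_dist (Psi A f P (t - s) (s, \<xi>, LP.\<phi> (s, \<xi>))) (Psi A f P (t - s) (s, \<xi>', LP.\<phi> (s, \<xi>')))
          \<le> 2 * C * (\<mu> t / \<mu> s) powr a * \<nu> s powr \<epsilon> * norm (\<xi> - \<xi>')"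
        by (rule LP.Psi_phi_dist)
    qed
  qed
qed

end
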